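(* Let $C$ be a non-classic weighted oriented cycle on vertices $x_1,\dots,x_n$ with generators $m_1,\dots,m_n$ of $I(C)$, labelled so that $m_n$ is a blockend, and let $\mathcal G(I(C))$ be totally ordered by $m_1>_Im_2>_I\cdots>_Im_n$. Then $I(C)$ is bridge-friendly and has a Batzies-Welker matching. In particular, for every $r$ and $\mathbf a\in\mathbb N^n$: if there exists $\sigma\subseteq\mathcal G(I(C))$ such that $\sigma$ has neither a bridge nor a true gap (with respect to $>_I$), $|\sigma|=r$ and $\operatorname{lcm}(\sigma)=\mathbf x^{\mathbf a}$, then $\beta_{r,\mathbf a}(R/I(C))=1$; otherwise $\beta_{r,\mathbf a}(R/I(C))=0$.
   Context: A weighted oriented graph is a triple $\mathcal D=(V,E,\mathbf w)$ with $V$ a finite vertex set, $E$ a set of directed edges whose underlying undirected graph is simple, and $\mathbf w:V\to\mathbb N^+$. Over a field $\Bbbk$, with $R=\Bbbk[V]$, its edge ideal is $I(\mathcal D)=(xy^{\mathbf w(y)}\mid(x,y)\in E)$, where $(x,y)$ is the edge oriented from $x$ to $y$. A weighted oriented cycle $C$ has underlying graph a cycle $x_1,x_2,\dots,x_n$ (arbitrary orientations); $m_i$ is the generator of $I(C)$ corresponding to the edge between $x_i$ and $x_{i+1}$, indices modulo $n$. $m_i$ is a blockend if $m_i\nmid\operatorname{lcm}(m_{i-1},m_{i+1})$. $C$ is classic if there are no blockends, and non-classic otherwise. $\mathbf x^{\mathbf a}=x_1^{a_1}\cdots x_n^{a_n}$ and $\beta_{r,\mathbf a}$ denotes $\mathbb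 Z^n$-graded Betti numbers. Let $I$ be a monomial ideal with minimal monomial generating set $\mathcal G(I)$ and $>_I$ a total ordering on $\mathcal G(I)$. $m\in\mathcal G(I)$ is a bridge of $\sigma\subseteq\mathcal G(I)$ if $m\in\sigma$ and $\operatorname{lcm}(\sigma\setminus m)=\operatorname{lcm}(\sigma)$. $m$ is a gap of $\sigma$ if $m\notin\sigma$ and $\operatorname{lcm}(\sigma\cup m)=\operatorname{lcm}(\sigma)$. $m$ is a true gap of $\sigma$ if it is a gap and every bridge $m'$ of $\sigma\cup m$ with $m>_Im'$ is already a bridge of $\sigma$. $\operatorname{sb}(\sigma)$ is the $>_I$-smallest bridge of $\sigma$ if one exists, and $\emptyset$ otherwise ($\sigma\setminus\emptyset=\sigma$). Batzies-Welker matching. Let $G=(V,E)$ be the directed graph whose vertices are all subsets of $\mathcal G(I)$ and whose directed edges are the pairs $(\sigma,\sigma')$ with $\sigma'\subseteq\sigma$, $|\sigma'|=|\sigma|-1$. For $A\subseteq E$ let $G^A$ be obtained by reversing the edges in $A$. $A$ is an $\operatorname{lcm}$-homogeneous acyclic matching if every subset appears in at most one edge of $A$, $G^A$ has no directed cycle, and $\operatorname{lcm}(\sigma)=\operatorname{lcm}(\sigma')$ for all $(\sigma,\sigma')\in A$. Subsets in no edge of $A$ are critical. $A$ is a Batzies-Welker matching if moreover $\operatorname{lcm}(\sigma)\ne\operatorname{lcm}(\sigma')$ for any two distinct critical subsets. Bridge-friendliness. Barile-Macchia algorithm: start with $A=\emptyset$, $\Omega=\{\sigma\subseteq\mathcal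 G(I):|\sigma|\ge3\}$. (1) Pick $\sigma\in\Omega$ of maximal cardinality. (2) Replace $\Omega$ by $\Omega\setminus\{\sigma,\sigma\setminus\operatorname{sb}(\sigma)\}$; if $\operatorname{sb}(\sigma)\neq\emptyset$ add the directed edge $(\sigma,\sigma\setminus\operatorname{sb}(\sigma))$ to $A$; if $\Omega\ne\emptyset$ return to (1). (3) Whenever two distinct edges $(\sigma,\sigma\setminus\operatorname{sb}(\sigma))$, $(\sigma',\sigma'\setminus\operatorname{sb}(\sigma'))$ of $A$ have the same target, remove the one whose smallest bridge is larger with respect to $>_I$. A subset $\sigma$ is potentially-type-2 if the edge $(\sigma,\sigma\setminus\operatorname{sb}(\sigma))$ is added in step (2); it is type-2 if this edge remains in the final $A$. $I$ is bridge-friendly if there exists a total ordering $>_I$ on $\mathcal G(I)$ such that all potentially-type-2 subsets are type-2. *)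

theory Defs
  imports
    "HOL-Library.Poly_Mapping"
    "HOL-Library.Function_Algebras"
    "Jordan_Normal_Form.Matrix_Kernel"
begin

text \<open>
  A monomial over the finite variable type \<open>'v\<close> is its exponent vector \<open>'v \<Rightarrow> nat\<close>: multiplication is
  pointwise addition and divisibility is the pointwise order \<open>\<le>\<close>.  The polynomial ring \<open>R = k[V]\<close>
  is the monoid algebra \<open>('v \<Rightarrow> nat) \<Rightarrow>\<^sub>0 'k\<close>, with \<open>V\<close> the whole type \<open>'v\<close>.
\<close>

type_synonym 'v monomial = "'v \<Rightarrow> nat"
type_synonym ('v, 'k) polyring = "'v monomial \<Rightarrow>\<^sub>0 'k"

abbreviation mono_poly :: "'v monomial \<Rightarrow> ('v, 'k::field) polyring" where
  "mono_poly a \<equiv> Poly_Mapping.single a 1"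

abbreviation ideal_gen :: "('v, 'k::field) polyring set \<Rightarrow> ('v, 'k) polyring set" where
  "ideal_gen S \<equiv> module.span (*) S"

text \<open>The union with \<open>{0}\<close> gives \<open>lcm \<emptyset> = 1\<close>.\<close>

definition mlcm :: "'v monomial set \<Rightarrow> 'v monomial" where
  "mlcm \<sigma> = (\<lambda>v. Max ({0} \<union> (\<lambda>m. m v) ` \<sigma>))"

definition min_gens :: "('v, 'k::field) polyring set \<Rightarrow> 'v monomial set" where
  "min_gens I = {a. mono_poly a \<in> I \<and> (\<forall>b. mono_poly b \<in> I \<and> b \<le> a \<longrightarrow> b = a)}"


section \<open>Weighted oriented graphs and cycles\<close>

text \<open>The vertex set is the finite type \<open>'v\<close>; \<open>asym\<close> says that the underlying undirected graph is
  simple (no loops, no edge oriented both ways).\<close>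

definition weighted_oriented_graph :: "('v::finite \<times> 'v) set \<Rightarrow> ('v \<Rightarrow> nat) \<Rightarrow> bool" where
  "weighted_oriented_graph E w \<longleftrightarrow> asym E \<and> (\<forall>v. w v > 0)"

definition edge_monomial :: "('v \<Rightarrow> nat) \<Rightarrow> 'v \<Rightarrow> 'v \<Rightarrow> 'v monomial" where
  "edge_monomial w u v = (\<lambda>_. 0)(u := 1, v := w v)"

definition edge_ideal :: "('v \<times> 'v) set \<Rightarrow> ('v \<Rightarrow> nat) \<Rightarrow> ('v, 'k::field) polyring set" where
  "edge_ideal E w = ideal_gen {mono_poly (edge_monomial w u v) | u v. (u, v) \<in> E}"

text \<open>Cyclic successor and predecessor on the index set \<open>{1..n}\<close>.\<close>

definition cnext :: "nat \<Rightarrow> nat \<Rightarrow> nat" where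
  "cnext n i = (if i = n then 1 else i + 1)"

definition cprev :: "nat \<Rightarrow> nat \<Rightarrow> nat" where
  "cprev n i = (if i = 1 then n else i - 1)"

definition weighted_oriented_cycle ::
    "nat \<Rightarrow> (nat \<Rightarrow> 'v::finite) \<Rightarrow> ('v \<times> 'v) set \<Rightarrow> ('v \<Rightarrow> nat) \<Rightarrow> bool" where
  "weighted_oriented_cycle n x E w \<longleftrightarrow>
     weighted_oriented_graph E w \<and> n \<ge> 3 \<and> bij_betw x {1..n} UNIV \<and>
     {{u, v} | u v. (u, v) \<in> E} = {{x i, x (cnext n i)} | i. i \<in> {1..n}}"

definition cycle_gen ::
    "nat \<Rightarrow> (nat \<Rightarrow> 'v) \<Rightarrow> ('v \<times> 'v) set \<Rightarrow> ('v \<Rightarrow> nat) \<Rightarrow> nat \<Rightarrow> 'v monomial" where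
  "cycle_gen n x E w i =
     (let y = x i; z = x (cnext n i)
      in if (y, z) \<in> E then edge_monomial w y z else edge_monomial w z y)"

definition blockend ::
    "nat \<Rightarrow> (nat \<Rightarrow> 'v) \<Rightarrow> ('v \<times> 'v) set \<Rightarrow> ('v \<Rightarrow> nat) \<Rightarrow> nat \<Rightarrow> bool" where
  "blockend n x E w i \<longleftrightarrow>
     \<not> cycle_gen n x E w i \<le> mlcm {cycle_gen n x E w (cprev n i), cycle_gen n x E w (cnext n i)}"

definition classic ::
    "nat \<Rightarrow> (nat \<Rightarrow> 'v) \<Rightarrow> ('v \<times> 'v) set \<Rightarrow> ('v \<Rightarrow> nat) \<Rightarrow> bool" where
  "classic n x E w \<longleftrightarrow> \<not> (\<exists>i\<in>{1..n}. blockend n x E w i)"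


section \<open>Bridges, gaps and true gaps\<close>

text \<open>Throughout, \<open>G\<close> is the minimal generating set and \<open>gt m m'\<close> means \<open>m >\<^sub>I m'\<close>.\<close>

definition total_ordering_on :: "'a set \<Rightarrow> ('a \<Rightarrow> 'a \<Rightarrow> bool) \<Rightarrow> bool" where
  "total_ordering_on G gt \<longleftrightarrow> irreflp_on G gt \<and> transp_on G gt \<and> totalp_on G gt"

definition is_bridge :: "'v monomial \<Rightarrow> 'v monomial set \<Rightarrow> bool" where
  "is_bridge m \<sigma> \<longleftrightarrow> m \<in> \<sigma> \<and> mlcm (\<sigma> - {m}) = mlcm \<sigma>"

definition is_gap :: "'v monomial set \<Rightarrow> 'v monomial \<Rightarrow> 'v monomial set \<Rightarrow> bool" where
  "is_gap G m \<sigma> \<longleftrightarrow> m \<in> G \<and> m \<notin> \<sigma> \<and> mlcm (insert m \<sigma>) = mlcm \<sigma>"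

definition is_true_gap ::
    "'v monomial set \<Rightarrow> ('v monomial \<Rightarrow> 'v monomial \<Rightarrow> bool) \<Rightarrow> 'v monomial \<Rightarrow> 'v monomial set \<Rightarrow> bool" where
  "is_true_gap G gt m \<sigma> \<longleftrightarrow>
     is_gap G m \<sigma> \<and> (\<forall>m'. is_bridge m' (insert m \<sigma>) \<and> gt m m' \<longrightarrow> is_bridge m' \<sigma>)"

text \<open>The smallest bridge as a set with at most one element, so that \<open>\<sigma> - sb gt \<sigma>\<close> also covers the
  case of no bridge.\<close>

definition sb :: "('v monomial \<Rightarrow> 'v monomial \<Rightarrow> bool) \<Rightarrow> 'v monomial set \<Rightarrow> 'v monomial set" where
  "sb gt \<sigma> = {m. is_bridge m \<sigma> \<and> (\<forall>m'. is_bridge m' \<sigma> \<and> m' \<noteq> m \<longrightarrow> gt m' m)}"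


section \<open>Batzies-Welker matchings\<close>

definition subset_edges :: "'v monomial set \<Rightarrow> ('v monomial set \<times> 'v monomial set) set" where
  "subset_edges G = {(\<sigma>, \<sigma>'). \<sigma> \<subseteq> G \<and> \<sigma>' \<subseteq> \<sigma> \<and> card \<sigma> = card \<sigma>' + 1}"

definition lcm_homogeneous_acyclic_matching ::
    "'v monomial set \<Rightarrow> ('v monomial set \<times> 'v monomial set) set \<Rightarrow> bool" where
  "lcm_homogeneous_acyclic_matching G A \<longleftrightarrow>
     A \<subseteq> subset_edges G \<and>
     (\<forall>e\<in>A. \<forall>e'\<in>A. e \<noteq> e' \<longrightarrow> {fst e, snd e} \<inter> {fst e', snd e'} = {}) \<and>
     acyclic ((subset_edges G - A) \<union> A\<inverse>) \<and>
     (\<forall>(\<sigma>, \<sigma>')\<in>A. mlcm \<sigma> = mlcm \<sigma>')"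

definition critical ::
    "'v monomial set \<Rightarrow> ('v monomial set \<times> 'v monomial set) set \<Rightarrow> 'v monomial set \<Rightarrow> bool" where
  "critical G A \<sigma> \<longleftrightarrow> \<sigma> \<subseteq> G \<and> (\<forall>e\<in>A. \<sigma> \<noteq> fst e \<and> \<sigma> \<noteq> snd e)"

definition BW_matching ::
    "'v monomial set \<Rightarrow> ('v monomial set \<times> 'v monomial set) set \<Rightarrow> bool" where
  "BW_matching G A \<longleftrightarrow>
     lcm_homogeneous_acyclic_matching G A \<and>
     (\<forall>\<sigma> \<sigma>'. critical G A \<sigma> \<and> critical G A \<sigma>' \<and> \<sigma> \<noteq> \<sigma>' \<longrightarrow> mlcm \<sigma> \<noteq> mlcm \<sigma>')"

definition has_BW_matching :: "('v, 'k::field) polyring set \<Rightarrow> bool" where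
  "has_BW_matching I \<longleftrightarrow> (\<exists>A. BW_matching (min_gens I) A)"


section \<open>The Barile-Macchia algorithm and bridge-friendliness\<close>

text \<open>\<open>bm_reach G gt \<Omega> A\<close>: the state \<open>(\<Omega>, A)\<close> can occur after finitely many rounds of steps (1) and
  (2), for some choice of the picked subsets.\<close>

inductive bm_reach ::
    "'v monomial set \<Rightarrow> ('v monomial \<Rightarrow> 'v monomial \<Rightarrow> bool) \<Rightarrow>
     'v monomial set set \<Rightarrow> ('v monomial set \<times> 'v monomial set) set \<Rightarrow> bool"
  for G gt where
  start: "bm_reach G gt {\<sigma>. \<sigma> \<subseteq> G \<and> card \<sigma> \<ge> 3} {}"
| round: "\<lbrakk> bm_reach G gt \<Omega> A; \<sigma> \<in> \<Omega>; \<forall>\<tau>\<in>\<Omega>. card \<tau> \<le> card \<sigma> \<rbrakk> \<Longrightarrow>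
    bm_reach G gt (\<Omega> - {\<sigma>, \<sigma> - sb gt \<sigma>})
      (if sb gt \<sigma> \<noteq> {} then insert (\<sigma>, \<sigma> - sb gt \<sigma>) A else A)"

text \<open>Step (3).  Distinct sources with a common target have distinct smallest bridges, so for each
  target exactly the edge with the least smallest bridge survives.\<close>

definition bm_prune ::
    "('v monomial \<Rightarrow> 'v monomial \<Rightarrow> bool) \<Rightarrow> ('v monomial set \<times> 'v monomial set) set \<Rightarrow>
     ('v monomial set \<times> 'v monomial set) set" where
  "bm_prune gt A = {(\<sigma>, \<tau>) \<in> A. \<not> (\<exists>\<sigma>'. (\<sigma>', \<tau>) \<in> A \<and> \<sigma>' \<noteq> \<sigma> \<and>
                      (\<exists>b\<in>sb gt \<sigma>. \<exists>b'\<in>sb gt \<sigma>'. gt b b'))}"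

definition potentially_type2 ::
    "('v monomial \<Rightarrow> 'v monomial \<Rightarrow> bool) \<Rightarrow> ('v monomial set \<times> 'v monomial set) set \<Rightarrow>
     'v monomial set \<Rightarrow> bool" where
  "potentially_type2 gt A \<sigma> \<longleftrightarrow> (\<sigma>, \<sigma> - sb gt \<sigma>) \<in> A"

definition type2 ::
    "('v monomial \<Rightarrow> 'v monomial \<Rightarrow> bool) \<Rightarrow> ('v monomial set \<times> 'v monomial set) set \<Rightarrow>
     'v monomial set \<Rightarrow> bool" where
  "type2 gt A \<sigma> \<longleftrightarrow> (\<sigma>, \<sigma> - sb gt \<sigma>) \<in> bm_prune gt A"

text \<open>\<open>bm_reach G gt {} A\<close> says that \<open>A\<close> is the result of a complete run of steps (1) and (2).  Since
  subsets are treated by decreasing cardinality, this \<open>A\<close> exists and does not depend on the choices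
  made in step (1).\<close>

definition bridge_friendly :: "('v, 'k::field) polyring set \<Rightarrow> bool" where
  "bridge_friendly I \<longleftrightarrow>
     (\<exists>gt. total_ordering_on (min_gens I) gt \<and>
       (\<forall>A. bm_reach (min_gens I) gt {} A \<longrightarrow>
         (\<forall>\<sigma>. potentially_type2 gt A \<sigma> \<longrightarrow> type2 gt A \<sigma>)))"


section \<open>Multigraded Betti numbers\<close>

text \<open>
  A finitely generated multigraded free module \<open>\<Oplus>\<^sub>j R(-a\<^sub>j)\<close> is given by the list of its shifts
  \<open>a\<^sub>j\<close>; its underlying module is \<open>carrier_vec\<close> of the length of the list.  In a complex, \<open>D r\<close> lists
  the shifts of \<open>F\<^sub>r\<close>, and the matrix \<open>d r\<close> represents the differential from \<open>F\<^sub>r\<^sub>+\<^sub>1\<close> to \<open>F\<^sub>r\<close>.  The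
  augmentation from \<open>F\<^sub>0\<close> to \<open>R/I\<close> maps \<open>v\<close> to the class of \<open>\<epsilon> \<bullet> v\<close>.
\<close>

definition homogeneous_of_degree :: "'v monomial \<Rightarrow> ('v, 'k::field) polyring \<Rightarrow> bool" where
  "homogeneous_of_degree a p \<longleftrightarrow> Poly_Mapping.keys p \<subseteq> {a}"

text \<open>Degree preservation: the \<open>(i, j)\<close> entry of a graded map \<open>\<Oplus>\<^sub>j R(-b\<^sub>j) \<rightarrow> \<Oplus>\<^sub>i R(-a\<^sub>i)\<close> is
  homogeneous of degree \<open>b\<^sub>j - a\<^sub>i\<close>, and zero if \<open>a\<^sub>i\<close> does not divide \<open>b\<^sub>j\<close>.\<close>

definition graded_matrix ::
    "'v monomial list \<Rightarrow> 'v monomial list \<Rightarrow> ('v, 'k::field) polyring mat \<Rightarrow> bool" where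
  "graded_matrix as bs M \<longleftrightarrow>
     M \<in> carrier_mat (length as) (length bs) \<and>
     (\<forall>i < length as. \<forall>j < length bs.
        if as ! i \<le> bs ! j then homogeneous_of_degree (bs ! j - as ! i) (M $$ (i, j))
        else M $$ (i, j) = 0)"

definition graded_free_resolution ::
    "('v, 'k::field) polyring set \<Rightarrow> (nat \<Rightarrow> 'v monomial list) \<Rightarrow>
     (nat \<Rightarrow> ('v, 'k) polyring mat) \<Rightarrow> ('v, 'k) polyring vec \<Rightarrow> bool" where
  "graded_free_resolution I D d \<epsilon> \<longleftrightarrow>
     (\<forall>r. graded_matrix (D r) (D (Suc r)) (d r)) \<and>
     \<epsilon> \<in> carrier_vec (length (D 0)) \<and>
     (\<forall>j < length (D 0). homogeneous_of_degree (D 0 ! j) (\<epsilon> $ j)) \<and>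
     (\<forall>f. \<exists>v \<in> carrier_vec (length (D 0)). f - \<epsilon> \<bullet> v \<in> I) \<and>
     {v \<in> carrier_vec (length (D 0)). \<epsilon> \<bullet> v \<in> I} =
       (\<lambda>v. d 0 *\<^sub>v v) ` carrier_vec (length (D 1)) \<and>
     (\<forall>r. mat_kernel (d r) = (\<lambda>v. d (Suc r) *\<^sub>v v) ` carrier_vec (length (D (Suc (Suc r)))))"

text \<open>Minimality: every differential has its image in the maximal ideal times the target, that is, no
  matrix entry has a constant term.\<close>

definition minimal_graded_free_resolution ::
    "('v, 'k::field) polyring set \<Rightarrow> (nat \<Rightarrow> 'v monomial list) \<Rightarrow>
     (nat \<Rightarrow> ('v, 'k) polyring mat) \<Rightarrow> ('v, 'k) polyring vec \<Rightarrow> bool" where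
  "minimal_graded_free_resolution I D d \<epsilon> \<longleftrightarrow>
     graded_free_resolution I D d \<epsilon> \<and>
     (\<forall>r. \<forall>i < length (D r). \<forall>j < length (D (Suc r)).
        Poly_Mapping.lookup (d r $$ (i, j)) 0 = 0)"

text \<open>\<open>betti I r a\<close> is the multigraded Betti number of \<open>R/I\<close>: the number of summands \<open>R(-a)\<close> in
  homological degree \<open>r\<close> of the minimal multigraded free resolution of \<open>R/I\<close>, which is unique up to
  isomorphism.\<close>

definition betti :: "('v, 'k::field) polyring set \<Rightarrow> nat \<Rightarrow> 'v monomial \<Rightarrow> nat" where
  "betti I r a =
     (THE b. \<exists>D d \<epsilon>. minimal_graded_free_resolution I D d \<epsilon> \<and> b = count_list (D r) a)"

end

theory Submission
  imports Defs
begin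

text \<open>
  Each generator of the cycle involves just two neighbouring vertices, so \<open>m\<^sub>i\<close> divides the lcm of other generators only through its two neighbours:
  \<open>m\<^sub>i\<close> is a bridge or a gap of \<open>\<sigma>\<close> iff it is not a blockend and \<open>m\<^sub>i\<^sub>-\<^sub>1, m\<^sub>i\<^sub>+\<^sub>1 \<in> \<sigma>\<close>
  (\<open>neighbours_iff\<close>).  As \<open>m\<^sub>n\<close> is a blockend it is never a bridge or a gap, which cuts the cycle open:
  a subset of the generators becomes a bit string on the positions \<open>0, \<dots>, n\<close> with equal end bits,
  and only the positions \<open>1, \<dots>, n - 1\<close> can ever be changed without changing the lcm.

  Call a position \<open>i\<close> swinging if \<open>m\<^sub>i\<close> may be added or removed in this way and \<open>i + 1\<close> would not
  be a bridge once \<open>m\<^sub>i\<close> is present.  A present swinging generator is a bridge, an absent one is a true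
  gap, and conversely the bridge of largest index and every true gap swing.  Whether \<open>i\<close> swings depends on
  the bits \<open>i - 1\<close>, \<open>i + 1\<close> and \<open>i + 2\<close> only, so flipping the bit at the largest swinging position,
  the pivot, does not move the pivot (\<open>pivot_toggle\<close>).  Flipping at the pivot is therefore an involution,
  and it defines a matching whose critical sets are those with neither bridges nor true gaps.

  Bridge-friendliness: if the pivot is present it is the smallest bridge with respect to \<open>>\<^sub>I\<close>; if it
  is absent, the set has left the algorithm together with the larger set that contains the pivot.  So every
  edge that the algorithm produces belongs to the pivot matching, and in a matching no two edges share a target.  Acyclicity: along a directed path that alternates between adding the
  pivot and removing another bridge, the removed bridge always has a smaller index than the
  pivot, so the bit string, read as a binary number, increases.  Distinct critical
  sets have distinct lcms: at the largest position where two critical sets with the same lcm differ, the set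
  without the generator has a gap there; as this gap is not true, the next position is a bridge
  of the other set.

  The Betti numbers follow from a statement about arbitrary monomial ideals
  (\<open>betti_BW_matching\<close>): for a Batzies-Welker matching, \<open>\<beta>\<^sub>r\<^sub>,\<^sub>a\<close> counts the critical sets of size \<open>r\<close> and
  lcm \<open>x\<^sup>a\<close>.  A multigraded resolution is determined by scalar matrices, and it is exact iff in
  every multidegree a complex of vector spaces is exact (\<open>graded_free_resolution_iff_strands\<close>).  In this
  form three things are shown.  The Taylor complex is exact, being a cone in each
  multidegree.  An acyclic matching cuts out a subcomplex of the Taylor complex that is still
  exact and has one basis element for each critical set (\<open>morse_strand_resolution\<close>); it is
  minimal because no two critical sets have the same lcm.  Finally, comparison maps
  between two resolutions compose to the identity up to homotopy, and on the basis elements of one fixed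
  multidegree a minimal differential leaves no room for the homotopy, so all minimal resolutions have the same
  shifts (\<open>count_list_le_of_minimal\<close>).
\<close>

section \<open>Monomial ideals\<close>

interpretation polyring: Modules.module "(*) :: ('v, 'k::field) polyring \<Rightarrow> _ \<Rightarrow> _"
  by unfold_locales (simp_all add: algebra_simps)

definition multiples :: "'v monomial set \<Rightarrow> 'v monomial set" where
  "multiples G = {c. \<exists>m\<in>G. m \<le> c}"

lemma multiples_upward: "a \<in> multiples G \<Longrightarrow> a \<le> b \<Longrightarrow> b \<in> multiples G"
  unfolding multiples_def by (blast intro: order_trans)

lemma monomial_diff_add: "(a::'v monomial) \<le> c \<Longrightarrow> a + (c - a) = c"
  by (auto simp: fun_eq_iff le_fun_def)

lemma monomial_diff_eq_iff: "(a::'v monomial) \<le> b \<Longrightarrow> a \<le> c \<Longrightarrow> b - a = c - a \<longleftrightarrow> b = c"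
  by (metis monomial_diff_add)

lemma lookup_single_mult:
  fixes p :: "('v, 'k::field) polyring"
  shows "Poly_Mapping.lookup (Poly_Mapping.single d a * p) k = (if d \<le> k then a * Poly_Mapping.lookup p (k - d) else 0)"
proof -
  have "Poly_Mapping.lookup (Poly_Mapping.single d a * p) k
      = (\<Sum>l. (a when d = l) * (\<Sum>q. Poly_Mapping.lookup p q when k = l + q))"
    by (simp add: lookup_mult lookup_single)
  also have "\<dots> = a * (\<Sum>q. Poly_Mapping.lookup p q when k = d + q)"
    by (simp add: when_mult)
  also have "(\<Sum>q. Poly_Mapping.lookup p q when k = d + q) = (if d \<le> k then Poly_Mapping.lookup p (k - d) else 0)"
  proof (cases "d \<le> k")
    case True
    then have "k = d + q \<longleftrightarrow> k - d = q" for q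
      by (metis monomial_diff_add add_left_cancel)
    with True show ?thesis by simp
  next
    case False
    then have "k \<noteq> d + q" for q
      by (auto simp: le_fun_def)
    with False show ?thesis by simp
  qed
  finally show ?thesis by simp
qed

lemma polyring_sum_monomials:
  fixes f :: "('v, 'k::field) polyring"
  shows "f = (\<Sum>k\<in>Poly_Mapping.keys f. Poly_Mapping.single k (Poly_Mapping.lookup f k))"
  by (rule poly_mapping_eqI)
     (simp add: lookup_sum lookup_single when_def in_keys_iff sum.delta cong: if_cong)

text \<open>A monomial ideal is spanned over the field by the monomials that it contains; membership can be
  tested coefficient by coefficient.\<close>

lemma ideal_gen_mono_poly_iff:
  fixes f :: "('v, 'k::field) polyring"
  shows "f \<in> ideal_gen (mono_poly ` G) \<longleftrightarrow> Poly_Mapping.keys f \<subseteq> multiples G"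
proof
  assume "f \<in> ideal_gen (mono_poly ` G)"
  then show "Poly_Mapping.keys f \<subseteq> multiples G"
  proof (induction rule: polyring.span_induct_alt)
    case base
    show ?case by simp
  next
    case (step c x y)
    from step(1) obtain m where m: "m \<in> G" "x = mono_poly m" by blast
    have "Poly_Mapping.keys (c * x) \<subseteq> multiples G"
    proof
      fix k assume "k \<in> Poly_Mapping.keys (c * x)"
      then have "Poly_Mapping.lookup (Poly_Mapping.single m 1 * c) k \<noteq> 0"
        by (simp add: in_keys_iff m(2) mult.commute)
      then have "m \<le> k" by (auto simp: lookup_single_mult split: if_splits)
      with m show "k \<in> multiples G" by (auto simp: multiples_def)
    qed
    with step(2) show ?case
      by (meson Poly_Mapping.keys_add Un_least order_trans)
  qed
next
  assume *: "Poly_Mapping.keys f \<subseteq> multiples G"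
  have "Poly_Mapping.single k (Poly_Mapping.lookup f k) \<in> ideal_gen (mono_poly ` G)" if "k \<in> Poly_Mapping.keys f" for k
  proof -
    from * that obtain m where m: "m \<in> G" "m \<le> k" by (auto simp: multiples_def)
    have "Poly_Mapping.single k (Poly_Mapping.lookup f k)
        = Poly_Mapping.single (k - m) (Poly_Mapping.lookup f k) * mono_poly m"
      by (simp add: mult_single add.commute monomial_diff_add[OF m(2)])
    moreover have "\<dots> \<in> ideal_gen (mono_poly ` G)"
      using m(1) by (intro polyring.span_scale polyring.span_base imageI)
    ultimately show ?thesis by metis
  qed
  then have "(\<Sum>k\<in>Poly_Mapping.keys f. Poly_Mapping.single k (Poly_Mapping.lookup f k))
      \<in> ideal_gen (mono_poly ` G)"
    by (intro polyring.span_sum)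
  then show "f \<in> ideal_gen (mono_poly ` G)"
    using polyring_sum_monomials[of f] by metis
qed

lemma mono_poly_in_ideal_gen_iff:
  "(mono_poly a :: ('v, 'k::field) polyring) \<in> ideal_gen (mono_poly ` G) \<longleftrightarrow> a \<in> multiples G"
  by (simp add: ideal_gen_mono_poly_iff)

lemma min_gens_antichain:
  assumes "\<And>a b. a \<in> G \<Longrightarrow> b \<in> G \<Longrightarrow> a \<le> b \<Longrightarrow> a = b"
  shows "min_gens (ideal_gen (mono_poly ` G) :: ('v, 'k::field) polyring set) = G"
proof -
  have "a \<in> multiples G \<and> (\<forall>b. b \<in> multiples G \<and> b \<le> a \<longrightarrow> b = a) \<longleftrightarrow> a \<in> G" for a
  proof
    assume a: "a \<in> multiples G \<and> (\<forall>b. b \<in> multiples G \<and> b \<le> a \<longrightarrow> b = a)"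
    then obtain g where g: "g \<in> G" "g \<le> a" by (auto simp: multiples_def)
    then have "g \<in> multiples G" by (auto simp: multiples_def)
    with a g show "a \<in> G" by metis
  next
    assume a: "a \<in> G"
    have "b = a" if "b \<in> multiples G" "b \<le> a" for b
    proof -
      obtain g where g: "g \<in> G" "g \<le> b" using \<open>b \<in> multiples G\<close> by (auto simp: multiples_def)
      have "g = a" by (rule assms[OF g(1) a order_trans[OF g(2) \<open>b \<le> a\<close>]])
      with g(2) have "a \<le> b" by simp
      with \<open>b \<le> a\<close> show ?thesis by (rule order_antisym)
    qed
    with a show "a \<in> multiples G \<and> (\<forall>b. b \<in> multiples G \<and> b \<le> a \<longrightarrow> b = a)"
      by (auto simp: multiples_def)
  qed
  then show ?thesis by (simp add: min_gens_def mono_poly_in_ideal_gen_iff)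
qed

section \<open>Multidegree strands of a graded resolution\<close>

text \<open>The multidegree \<open>c\<close> part of the free module with shifts \<open>D\<close> has as basis the elements
  \<open>x\<^sup>c\<^sup>-\<^sup>D\<^sup>j e\<^sub>j\<close> with \<open>D\<^sub>j \<le> c\<close>.  A member of the strand is the coordinate vector of an element of this part.\<close>

definition strand :: "'v monomial list \<Rightarrow> 'v monomial \<Rightarrow> (nat \<Rightarrow> 'k::field) set" where
  "strand D c = {v. \<forall>j. v j \<noteq> 0 \<longrightarrow> j < length D \<and> D ! j \<le> c}"

text \<open>The scalar matrices that come from homogeneous maps: a degree preserving map between
  \<open>R(-b\<^sub>j)\<close> and \<open>R(-a\<^sub>i)\<close> is a scalar multiple of \<open>x\<^sup>b\<^sup>j\<^sup>-\<^sup>a\<^sup>i\<close>, and zero unless \<open>a\<^sub>i \<le> b\<^sub>j\<close>.  Entries with an index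
  outside the two lists vanish, so that equality of maps is equality of functions.\<close>

definition compatible :: "'v monomial list \<Rightarrow> 'v monomial list \<Rightarrow> (nat \<Rightarrow> nat \<Rightarrow> 'k::field) \<Rightarrow> bool" where
  "compatible as bs A \<longleftrightarrow>
     (\<forall>i j. A i j \<noteq> 0 \<longrightarrow> i < length as \<and> j < length bs \<and> as ! i \<le> bs ! j)"

definition apply_mat :: "nat \<Rightarrow> (nat \<Rightarrow> nat \<Rightarrow> 'k::field) \<Rightarrow> (nat \<Rightarrow> 'k) \<Rightarrow> nat \<Rightarrow> 'k" where
  "apply_mat L A u = (\<lambda>i. \<Sum>j<L. A i j * u j)"

lemma strand_zero [simp]: "(\<lambda>_. 0) \<in> strand D c"
  by (simp add: strand_def)

lemma apply_mat_strand:
  assumes "compatible as bs A" "u \<in> strand bs c"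
  shows "apply_mat L A u \<in> strand as c"
proof -
  have "i < length as \<and> as ! i \<le> c" if nz: "apply_mat L A u i \<noteq> 0" for i
  proof -
    obtain j where "A i j * u j \<noteq> 0"
      using nz unfolding apply_mat_def by (meson sum.neutral)
    then have "A i j \<noteq> 0" "u j \<noteq> 0" by auto
    with assms have "i < length as" and le: "as ! i \<le> bs ! j" "bs ! j \<le> c"
      by (auto simp: compatible_def strand_def)
    then show ?thesis using order_trans[OF le] by blast
  qed
  then show ?thesis by (simp add: strand_def)
qed

definition component :: "'v monomial list \<Rightarrow> 'v monomial \<Rightarrow> ('v, 'k::field) polyring vec \<Rightarrow> nat \<Rightarrow> 'k" where
  "component D c v = (\<lambda>j. if j < length D \<and> D ! j \<le> c then Poly_Mapping.lookup (v $ j) (c - D ! j) else 0)"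

definition scalar_entries ::
    "'v monomial list \<Rightarrow> 'v monomial list \<Rightarrow> ('v, 'k::field) polyring mat \<Rightarrow> nat \<Rightarrow> nat \<Rightarrow> 'k" where
  "scalar_entries as bs M = (\<lambda>i j. if i < length as \<and> j < length bs \<and> as ! i \<le> bs ! j
     then Poly_Mapping.lookup (M $$ (i, j)) (bs ! j - as ! i) else 0)"

lemma component_strand: "component D c v \<in> strand D c"
  by (simp add: component_def strand_def)

lemma compatible_scalar_entries: "compatible as bs (scalar_entries as bs M)"
  by (auto simp: compatible_def scalar_entries_def)

lemma eq_if_components_eq:
  assumes "v \<in> carrier_vec (length D)" "v' \<in> carrier_vec (length D)"
    and "\<And>c. component D c v = component D c v'"
  shows "v = v'"
proof (rule eq_vecI)
  fix j assume j: "j < dim_vec v'"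
  show "v $ j = v' $ j"
  proof (rule poly_mapping_eqI)
    fix k
    have "D ! j \<le> k + D ! j" "k + D ! j - D ! j = k" 
      by (auto simp: le_fun_def)
    with fun_cong[OF assms(3)[of "k + D ! j"], of j] j assms(2)
    show "Poly_Mapping.lookup (v $ j) k = Poly_Mapping.lookup (v' $ j) k"
      by (simp add: component_def)
  qed
qed (use assms in auto)

lemma homogeneous_eq_single:
  assumes "homogeneous_of_degree a p" shows "p = Poly_Mapping.single a (Poly_Mapping.lookup p a)"
  using assms unfolding homogeneous_of_degree_def
  by (intro poly_mapping_eqI) (auto simp: lookup_single when_def in_keys_iff)

lemma graded_matrix_entry:
  assumes "graded_matrix as bs M" "i < length as" "j < length bs"
  shows "M $$ (i, j) = (if as ! i \<le> bs ! j
    then Poly_Mapping.single (bs ! j - as ! i) (scalar_entries as bs M i j) else 0)"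
  using assms homogeneous_eq_single unfolding graded_matrix_def scalar_entries_def
  by (smt (verit, best))

text \<open>The scalars of a homogeneous matrix are the same in every multidegree, so multiplication by the
  matrix acts on each strand through one and the same scalar matrix.\<close>

lemma component_mult:
  fixes M :: "('v, 'k::field) polyring mat"
  assumes M: "graded_matrix as bs M" and v: "v \<in> carrier_vec (length bs)"
  shows "component as c (M *\<^sub>v v) = apply_mat (length bs) (scalar_entries as bs M) (component bs c v)"
proof
  fix i
  have car: "M \<in> carrier_mat (length as) (length bs)"
    using M by (simp add: graded_matrix_def)
  show "component as c (M *\<^sub>v v) i = apply_mat (length bs) (scalar_entries as bs M) (component bs c v) i"
  proof (cases "i < length as \<and> as ! i \<le> c")
    case True
    have "component as c (M *\<^sub>v v) i = Poly_Mapping.lookup (\<Sum>j<length bs. M $$ (i, j) * v $ j) (c - as ! i)"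
      using True car v by (auto simp: component_def scalar_prod_def atLeast0LessThan)
    also have "\<dots> = (\<Sum>j<length bs. Poly_Mapping.lookup (M $$ (i, j) * v $ j) (c - as ! i))"
      by (simp add: lookup_sum)
    also have "\<dots> = (\<Sum>j<length bs. scalar_entries as bs M i j * component bs c v j)"
    proof (rule sum.cong)
      fix j assume "j \<in> {..<length bs}"
      then have j: "j < length bs" by simp
      show "Poly_Mapping.lookup (M $$ (i, j) * v $ j) (c - as ! i) = scalar_entries as bs M i j * component bs c v j"
      proof (cases "as ! i \<le> bs ! j")
        case False
        with graded_matrix_entry[OF M, of i j] j True show ?thesis
          by (simp add: scalar_entries_def)
      next
        case le: True
        have iff: "bs ! j - as ! i \<le> c - as ! i \<longleftrightarrow> bs ! j \<le> c"
          using le True by (simp add: le_fun_def le_diff_iff)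
        have eq: "c - as ! i - (bs ! j - as ! i) = c - bs ! j"
          using le True by (auto simp: le_fun_def fun_eq_iff)
        show ?thesis
          using graded_matrix_entry[OF M, of i j] j True le iff eq
          by (simp add: lookup_single_mult component_def)
      qed
    qed simp
    finally show ?thesis by (simp add: apply_mat_def)
  next
    case False
    have "scalar_entries as bs M i j * component bs c v j = 0" for j
      using False order_trans[of "as ! i" "bs ! j" c] by (auto simp: scalar_entries_def component_def)
    then have "apply_mat (length bs) (scalar_entries as bs M) (component bs c v) i = 0"
      unfolding apply_mat_def by (intro sum.neutral) blast
    with False show ?thesis by (auto simp: component_def)
  qed
qed

text \<open>Elements of a free module can be prescribed multidegree by multidegree, as long as almost all
  of the prescribed components vanish.\<close>

lemma assemble:
  assumes t: "\<And>c. t c \<in> strand D c" and fin: "finite {c. t c \<noteq> (\<lambda>_. 0)}"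
  obtains v :: "('v, 'k::field) polyring vec" 
  where "v \<in> carrier_vec (length D)" "\<And>c. component D c v = t c"
proof
  define C where "C = {c. t c \<noteq> (\<lambda>_. 0)}"
  define v where "v = vec (length D) (\<lambda>j. \<Sum>c\<in>C. Poly_Mapping.single (c - D ! j) (t c j))"
  show "v \<in> carrier_vec (length D)" by (simp add: v_def)
  have finC: "finite C" using fin by (simp add: C_def)
  fix c
  show "component D c v = t c"
  proof
    fix j
    show "component D c v j = t c j"
    proof (cases "j < length D \<and> D ! j \<le> c")
      case False
      with t[of c] show ?thesis by (auto simp: component_def strand_def)
    next
      case True
      have "component D c v j = (\<Sum>b\<in>C. t b j when b - D ! j = c - D ! j)"
        using True by (simp add: component_def v_def lookup_sum lookup_single)
      also have "\<dots> = (\<Sum>b\<in>C. if b = c then t c j else 0)"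
      proof (rule sum.cong)
        fix b
        show "(t b j when b - D ! j = c - D ! j) = (if b = c then t c j else 0)"
        proof (cases "t b j = 0")
          case False
          then have "D ! j \<le> b" using t[of b] by (auto simp: strand_def)
          then have "b - D ! j = c - D ! j \<longleftrightarrow> b = c"
            using True by (simp add: monomial_diff_eq_iff)
          then show ?thesis by auto
        qed auto
      qed simp
      also have "\<dots> = t c j"
        using finC by (auto simp: C_def)
      finally show ?thesis .
    qed
  qed
qed

lemma finite_component_support:
  fixes v :: "('v, 'k::field) polyring vec"
  shows "finite {c. component D c v \<noteq> (\<lambda>_. 0)}"
proof -
  have "{c. component D c v \<noteq> (\<lambda>_. 0)} \<subseteq> (\<Union>j<length D. (\<lambda>k. D ! j + k) ` Poly_Mapping.keys (v $ j))"
  proof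
    fix c assume "c \<in> {c. component D c v \<noteq> (\<lambda>_. 0)}"
    then obtain j where "component D c v j \<noteq> 0" by auto
    then have "j < length D" "D ! j \<le> c" "c - D ! j \<in> Poly_Mapping.keys (v $ j)"
      by (auto simp: component_def in_keys_iff split: if_splits)
    then show "c \<in> (\<Union>j<length D. (\<lambda>k. D ! j + k) ` Poly_Mapping.keys (v $ j))"
      by (metis (no_types, lifting) UN_I image_eqI lessThan_iff monomial_diff_add)
  qed
  then show ?thesis by (rule finite_subset) auto
qed

lemma homogeneous_vec:
  assumes "u \<in> strand D b"
  obtains v :: "('v, 'k::field) polyring vec" 
  where "v \<in> carrier_vec (length D)" "\<And>c. component D c v = (if c = b then u else (\<lambda>_. 0))"
  using assemble[of "\<lambda>c. if c = b then u else (\<lambda>_. 0)" D thesis] assms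
  by (auto simp: if_distrib cong: if_cong)

text \<open>Exactness at one place of a complex splits into exactness in the multidegrees.  To pass from the strands
  back to modules, preimages are chosen in each multidegree separately; choosing \<open>0\<close>
  as the preimage of \<open>0\<close> keeps the support finite.\<close>

lemma image_eq_strandwise:
  fixes M :: "('v, 'k::field) polyring mat"
  assumes M: "graded_matrix as bs M"
    and P: "\<And>v. v \<in> carrier_vec (length as) \<Longrightarrow> P v \<longleftrightarrow> (\<forall>c. Q c (component as c v))"
    and Q0: "\<And>c. Q c (\<lambda>_. 0)"
  shows "{v \<in> carrier_vec (length as). P v} = (\<lambda>v. M *\<^sub>v v) ` carrier_vec (length bs) \<longleftrightarrow>
    (\<forall>c. \<forall>u\<in>strand as c. Q c u \<longleftrightarrow> (\<exists>t\<in>strand bs c. u = apply_mat (length bs) (scalar_entries as bs M) t))"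
    (is "?L = ?R \<longleftrightarrow> ?S")
proof
  have car: "M *\<^sub>v t \<in> carrier_vec (length as)" if "t \<in> carrier_vec (length bs)" for t
    using M that by (auto simp: graded_matrix_def)
  assume LR: "?L = ?R"
  show ?S
  proof (intro allI ballI)
    fix c and u :: "nat \<Rightarrow> 'k" assume u: "u \<in> strand as c"
    obtain v where v: "v \<in> carrier_vec (length as)"
      "\<And>b. component as b v = (if b = c then u else (\<lambda>_. 0))"
      using homogeneous_vec[OF u] by blast
    have PQ: "P v \<longleftrightarrow> Q c u" using P[OF v(1)] v(2) Q0 by auto
    show "Q c u \<longleftrightarrow> (\<exists>t\<in>strand bs c. u = apply_mat (length bs) (scalar_entries as bs M) t)"
    proof
      assume "Q c u"
      with PQ v LR obtain t where "t \<in> carrier_vec (length bs)" "v = M *\<^sub>v t" by blast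
      with component_mult[OF M, of t c] v(2)[of c] component_strand
      show "\<exists>t\<in>strand bs c. u = apply_mat (length bs) (scalar_entries as bs M) t" by metis
    next
      assume "\<exists>t\<in>strand bs c. u = apply_mat (length bs) (scalar_entries as bs M) t"
      then obtain t where t: "t \<in> strand bs c" "u = apply_mat (length bs) (scalar_entries as bs M) t" by blast
      obtain s where s: "s \<in> carrier_vec (length bs)"
        "\<And>b. component bs b s = (if b = c then t else (\<lambda>_. 0))"
        using homogeneous_vec[OF t(1)] by blast
      have "v = M *\<^sub>v s"
        using v s t by (intro eq_if_components_eq[where D = as] car)
          (auto simp: component_mult[OF M s(1)] apply_mat_def)
      with s LR have "v \<in> ?L" by blast
      with PQ show "Q c u" by blast
    qed
  qed
next
  have car: "M *\<^sub>v t \<in> carrier_vec (length as)" if "t \<in> carrier_vec (length bs)" for t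
    using M that by (auto simp: graded_matrix_def)
  assume S: ?S
  show "?L = ?R"
  proof (intro subset_antisym subsetI)
    fix v assume "v \<in> ?L"
    then have v: "v \<in> carrier_vec (length as)" "\<And>c. Q c (component as c v)" using P by auto
    have "\<exists>t\<in>strand bs c. component as c v = apply_mat (length bs) (scalar_entries as bs M) t \<and>
        (component as c v = (\<lambda>_. 0) \<longrightarrow> t = (\<lambda>_. 0))" for c
    proof (cases "component as c v = (\<lambda>_. 0)")
      case True
      then show ?thesis by (intro bexI[of _ "\<lambda>_. 0"]) (auto simp: apply_mat_def)
    next
      case False
      with S v(2) component_strand[of as c v] show ?thesis by blast
    qed
    then obtain t where t: "\<And>c. t c \<in> strand bs c"
      "\<And>c. component as c v = apply_mat (length bs) (scalar_entries as bs M) (t c)"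
      "\<And>c. component as c v = (\<lambda>_. 0) \<Longrightarrow> t c = (\<lambda>_. 0)" by metis
    have "finite {c. t c \<noteq> (\<lambda>_. 0)}"
      by (rule finite_subset[OF _ finite_component_support[of as v]]) (use t(3) in blast)
    then obtain s where s: "s \<in> carrier_vec (length bs)" "\<And>c. component bs c s = t c"
      using assemble[OF t(1)] by blast
    have "v = M *\<^sub>v s"
      using v s t(2) by (intro eq_if_components_eq[where D = as] car) (auto simp: component_mult[OF M s(1)])
    with s show "v \<in> ?R" by blast
  next
    fix v assume "v \<in> ?R"
    then obtain s where s: "s \<in> carrier_vec (length bs)" "v = M *\<^sub>v s" by blast
    then have v: "v \<in> carrier_vec (length as)" using car by simp
    have "Q c (component as c v)" for c
      using S s component_strand component_mult[OF M s(1)] by metis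
    with P v show "v \<in> ?L" by simp
  qed
qed

text \<open>In homological degree \<open>0\<close> the next map is the augmentation to \<open>R/I\<close>, whose part of multidegree \<open>c\<close>
  is zero if \<open>x\<^sup>c \<in> I\<close> (that is, \<open>c \<in> S\<close>) and one-dimensional otherwise.\<close>

definition strand_cycle ::
    "'v monomial set \<Rightarrow> (nat \<Rightarrow> 'v monomial list) \<Rightarrow> (nat \<Rightarrow> nat \<Rightarrow> nat \<Rightarrow> 'k::field) \<Rightarrow> (nat \<Rightarrow> 'k) \<Rightarrow>
     nat \<Rightarrow> 'v monomial \<Rightarrow> (nat \<Rightarrow> 'k) \<Rightarrow> bool" where
  "strand_cycle S D A e r c u = (case r of
      0 \<Rightarrow> c \<in> S \<or> (\<Sum>j<length (D 0). e j * u j) = 0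
    | Suc r' \<Rightarrow> apply_mat (length (D r)) (A r') u = (\<lambda>_. 0))"

definition strand_resolution ::
    "'v monomial set \<Rightarrow> (nat \<Rightarrow> 'v monomial list) \<Rightarrow> (nat \<Rightarrow> nat \<Rightarrow> nat \<Rightarrow> 'k::field) \<Rightarrow> (nat \<Rightarrow> 'k) \<Rightarrow> bool" where
  "strand_resolution S D A e \<longleftrightarrow>
     (\<forall>r. compatible (D r) (D (Suc r)) (A r)) \<and>
     (\<forall>c. c \<notin> S \<longrightarrow> (\<exists>j<length (D 0). D 0 ! j \<le> c \<and> e j \<noteq> 0)) \<and>
     (\<forall>r c. \<forall>u\<in>strand (D r) c. strand_cycle S D A e r c u \<longleftrightarrow>
        (\<exists>t\<in>strand (D (Suc r)) c. u = apply_mat (length (D (Suc r))) (A r) t))"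

definition aug_entries :: "'v monomial list \<Rightarrow> ('v, 'k::field) polyring vec \<Rightarrow> nat \<Rightarrow> 'k" where
  "aug_entries D \<epsilon> = (\<lambda>j. if j < length D then Poly_Mapping.lookup (\<epsilon> $ j) (D ! j) else 0)"

lemma lookup_augmentation:
  fixes \<epsilon> :: "('v, 'k::field) polyring vec"
  assumes \<epsilon>: "\<epsilon> \<in> carrier_vec (length D)"
    and hom: "\<And>j. j < length D \<Longrightarrow> homogeneous_of_degree (D ! j) (\<epsilon> $ j)"
    and v: "v \<in> carrier_vec (length D)"
  shows "Poly_Mapping.lookup (\<epsilon> \<bullet> v) c = (\<Sum>j<length D. aug_entries D \<epsilon> j * component D c v j)"
proof -
  have "Poly_Mapping.lookup (\<epsilon> \<bullet> v) c = (\<Sum>j<length D. Poly_Mapping.lookup (\<epsilon> $ j * v $ j) c)"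
    using v by (simp add: scalar_prod_def lookup_sum atLeast0LessThan)
  also have "\<dots> = (\<Sum>j<length D. aug_entries D \<epsilon> j * component D c v j)"
  proof (rule sum.cong)
    fix j assume "j \<in> {..<length D}"
    then have j: "j < length D" by simp
    have "\<epsilon> $ j = Poly_Mapping.single (D ! j) (aug_entries D \<epsilon> j)"
      using homogeneous_eq_single[OF hom[OF j]] j by (simp add: aug_entries_def)
    then show "Poly_Mapping.lookup (\<epsilon> $ j * v $ j) c = aug_entries D \<epsilon> j * component D c v j"
      using j by (simp add: lookup_single_mult component_def)
  qed simp
  finally show ?thesis .
qed

text \<open>Only the multidegrees of monomials outside the ideal impose a condition, and there the target is
  one-dimensional, so surjectivity means that some coefficient is nonzero.\<close>

lemma augmentation_surjective_iff:
  fixes \<epsilon> :: "('v, 'k::field) polyring vec"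
  assumes \<epsilon>: "\<epsilon> \<in> carrier_vec (length D)"
    and hom: "\<And>j. j < length D \<Longrightarrow> homogeneous_of_degree (D ! j) (\<epsilon> $ j)"
  shows "(\<forall>f. \<exists>v \<in> carrier_vec (length D). f - \<epsilon> \<bullet> v \<in> ideal_gen (mono_poly ` G)) \<longleftrightarrow>
    (\<forall>c. c \<notin> multiples G \<longrightarrow> (\<exists>j<length D. D ! j \<le> c \<and> aug_entries D \<epsilon> j \<noteq> 0))"
    (is "?L \<longleftrightarrow> ?R")
proof
  assume L: ?L
  show ?R
  proof (intro allI impI)
    fix c assume c: "c \<notin> multiples G"
    obtain v where v: "v \<in> carrier_vec (length D)"
      "mono_poly c - \<epsilon> \<bullet> v \<in> ideal_gen (mono_poly ` G)" using L by blast
    have "Poly_Mapping.lookup (mono_poly c - \<epsilon> \<bullet> v) c = 0"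
      using c v(2) by (auto simp: ideal_gen_mono_poly_iff in_keys_iff)
    then have "(\<Sum>j<length D. aug_entries D \<epsilon> j * component D c v j) \<noteq> 0"
      using lookup_augmentation[OF \<epsilon> hom v(1), of c] by (simp add: lookup_minus)
    then obtain j where "j < length D" "aug_entries D \<epsilon> j * component D c v j \<noteq> 0"
      by (metis (no_types, lifting) lessThan_iff sum.neutral)
    then show "\<exists>j<length D. D ! j \<le> c \<and> aug_entries D \<epsilon> j \<noteq> 0"
      by (auto simp: component_def split: if_splits)
  qed
next
  assume R: ?R
  show ?L
  proof
    fix f :: "('v, 'k) polyring"
    from R obtain J where J: "\<And>c. c \<notin> multiples G \<Longrightarrow> J c < length D"
      "\<And>c. c \<notin> multiples G \<Longrightarrow> D ! J c \<le> c" "\<And>c. c \<notin> multiples G \<Longrightarrow> aug_entries D \<epsilon> (J c) \<noteq> 0"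
      by metis
    define t where "t = (\<lambda>c j. if c \<in> multiples G then 0 else
      if j = J c then Poly_Mapping.lookup f c / aug_entries D \<epsilon> j else 0)"
    have t: "t c \<in> strand D c" for c
      using J[of c] by (auto simp: t_def strand_def)
    have "{c. t c \<noteq> (\<lambda>_. 0)} \<subseteq> Poly_Mapping.keys f"
      by (auto simp: t_def in_keys_iff fun_eq_iff split: if_splits)
    then have "finite {c. t c \<noteq> (\<lambda>_. 0)}" by (rule finite_subset) simp
    then obtain v :: "('v, 'k) polyring vec" where v: "v \<in> carrier_vec (length D)" "\<And>c. component D c v = t c"
      using assemble[OF t] by blast
    have "Poly_Mapping.lookup (f - \<epsilon> \<bullet> v) c = 0" if c: "c \<notin> multiples G" for c
    proof -
      have "(\<Sum>j<length D. aug_entries D \<epsilon> j * t c j)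
          = (\<Sum>j<length D. if j = J c then Poly_Mapping.lookup f c else 0)"
        using c J(3)[OF c] by (intro sum.cong) (auto simp: t_def)
      then show ?thesis
        using J(1)[OF c] v by (simp add: lookup_minus lookup_augmentation[OF \<epsilon> hom v(1)])
    qed
    then have "f - \<epsilon> \<bullet> v \<in> ideal_gen (mono_poly ` G)"
      by (auto simp: ideal_gen_mono_poly_iff in_keys_iff)
    with v(1) show "\<exists>v \<in> carrier_vec (length D). f - \<epsilon> \<bullet> v \<in> ideal_gen (mono_poly ` G)" by blast
  qed
qed

text \<open>This reduces statements about multigraded resolutions over the polynomial ring to linear algebra
  over the field, with \<open>scalar_entries\<close> and \<open>aug_entries\<close> as the only data.\<close>

lemma graded_free_resolution_iff_strands:
  fixes \<epsilon> :: "('v, 'k::field) polyring vec"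
  shows "graded_free_resolution (ideal_gen (mono_poly ` G)) D d \<epsilon> \<longleftrightarrow>
    (\<forall>r. graded_matrix (D r) (D (Suc r)) (d r)) \<and>
    \<epsilon> \<in> carrier_vec (length (D 0)) \<and>
    (\<forall>j<length (D 0). homogeneous_of_degree (D 0 ! j) (\<epsilon> $ j)) \<and>
    strand_resolution (multiples G) D (\<lambda>r. scalar_entries (D r) (D (Suc r)) (d r)) (aug_entries (D 0) \<epsilon>)"
proof (cases "(\<forall>r. graded_matrix (D r) (D (Suc r)) (d r)) \<and> \<epsilon> \<in> carrier_vec (length (D 0)) \<and>
    (\<forall>j<length (D 0). homogeneous_of_degree (D 0 ! j) (\<epsilon> $ j))")
  case False
  then show ?thesis unfolding graded_free_resolution_def by blast
next
  case True
  then have M: "\<And>r. graded_matrix (D r) (D (Suc r)) (d r)"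
    and \<epsilon>: "\<epsilon> \<in> carrier_vec (length (D 0))"
    and hom: "\<And>j. j < length (D 0) \<Longrightarrow> homogeneous_of_degree (D 0 ! j) (\<epsilon> $ j)" by blast+
  let ?S = "multiples G" and ?A = "\<lambda>r. scalar_entries (D r) (D (Suc r)) (d r)" and ?e = "aug_entries (D 0) \<epsilon>"
  have car: "d r \<in> carrier_mat (length (D r)) (length (D (Suc r)))" for r
    using M[of r] by (simp add: graded_matrix_def)
  have base: "{v \<in> carrier_vec (length (D 0)). \<epsilon> \<bullet> v \<in> ideal_gen (mono_poly ` G)} =
       (\<lambda>v. d 0 *\<^sub>v v) ` carrier_vec (length (D 1)) \<longleftrightarrow>
     (\<forall>c. \<forall>u\<in>strand (D 0) c. strand_cycle ?S D ?A ?e 0 c u \<longleftrightarrow>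
        (\<exists>t\<in>strand (D (Suc 0)) c. u = apply_mat (length (D (Suc 0))) (?A 0) t))"
    unfolding One_nat_def
  proof (rule image_eq_strandwise[OF M])
    fix v :: "('v, 'k) polyring vec" assume v: "v \<in> carrier_vec (length (D 0))"
    show "\<epsilon> \<bullet> v \<in> ideal_gen (mono_poly ` G) \<longleftrightarrow>
        (\<forall>c. strand_cycle ?S D ?A ?e 0 c (component (D 0) c v))"
      by (auto simp: strand_cycle_def ideal_gen_mono_poly_iff in_keys_iff
          lookup_augmentation[OF \<epsilon> hom v])
  qed (simp add: strand_cycle_def)
  have step: "mat_kernel (d r) = (\<lambda>v. d (Suc r) *\<^sub>v v) ` carrier_vec (length (D (Suc (Suc r)))) \<longleftrightarrow>
     (\<forall>c. \<forall>u\<in>strand (D (Suc r)) c. strand_cycle ?S D ?A ?e (Suc r) c u \<longleftrightarrow>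
        (\<exists>t\<in>strand (D (Suc (Suc r))) c. u = apply_mat (length (D (Suc (Suc r)))) (?A (Suc r)) t))" for r
  proof -
    have "mat_kernel (d r) = {v \<in> carrier_vec (length (D (Suc r))). d r *\<^sub>v v = 0\<^sub>v (length (D r))}"
      using car[of r] by (simp add: mat_kernel_def)
    moreover have "{v \<in> carrier_vec (length (D (Suc r))). d r *\<^sub>v v = 0\<^sub>v (length (D r))} =
       (\<lambda>v. d (Suc r) *\<^sub>v v) ` carrier_vec (length (D (Suc (Suc r)))) \<longleftrightarrow>
     (\<forall>c. \<forall>u\<in>strand (D (Suc r)) c. strand_cycle ?S D ?A ?e (Suc r) c u \<longleftrightarrow>
        (\<exists>t\<in>strand (D (Suc (Suc r))) c. u = apply_mat (length (D (Suc (Suc r)))) (?A (Suc r)) t))"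
    proof (rule image_eq_strandwise[OF M])
      fix v :: "('v, 'k) polyring vec" assume v: "v \<in> carrier_vec (length (D (Suc r)))"
      have dv: "d r *\<^sub>v v \<in> carrier_vec (length (D r))" using car[of r] v by simp
      have zero: "component (D r) c (0\<^sub>v (length (D r))) = (\<lambda>_. 0 :: 'k)" for c
        by (auto simp: component_def)
      have "d r *\<^sub>v v = 0\<^sub>v (length (D r)) \<longleftrightarrow> (\<forall>c. component (D r) c (d r *\<^sub>v v) = (\<lambda>_. 0))"
        using eq_if_components_eq[OF dv zero_carrier_vec] zero by metis
      then show "d r *\<^sub>v v = 0\<^sub>v (length (D r)) \<longleftrightarrow>
          (\<forall>c. strand_cycle ?S D ?A ?e (Suc r) c (component (D (Suc r)) c v))"
        by (simp add: strand_cycle_def component_mult[OF M v])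
    qed (simp add: strand_cycle_def apply_mat_def)
    ultimately show ?thesis by simp
  qed
  have all: "(\<forall>r. P r) \<longleftrightarrow> P 0 \<and> (\<forall>r. P (Suc r))" for P :: "nat \<Rightarrow> bool"
    by (metis nat.exhaust)
  have res: "strand_resolution ?S D ?A ?e \<longleftrightarrow>
     (\<forall>c. c \<notin> ?S \<longrightarrow> (\<exists>j<length (D 0). D 0 ! j \<le> c \<and> ?e j \<noteq> 0)) \<and>
     (\<forall>c. \<forall>u\<in>strand (D 0) c. strand_cycle ?S D ?A ?e 0 c u \<longleftrightarrow>
        (\<exists>t\<in>strand (D (Suc 0)) c. u = apply_mat (length (D (Suc 0))) (?A 0) t)) \<and>
     (\<forall>r c. \<forall>u\<in>strand (D (Suc r)) c. strand_cycle ?S D ?A ?e (Suc r) c u \<longleftrightarrow>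
        (\<exists>t\<in>strand (D (Suc (Suc r))) c. u = apply_mat (length (D (Suc (Suc r)))) (?A (Suc r)) t))"
    unfolding strand_resolution_def
    using all[of "\<lambda>r. \<forall>c. \<forall>u\<in>strand (D r) c. strand_cycle ?S D ?A ?e r c u \<longleftrightarrow>
        (\<exists>t\<in>strand (D (Suc r)) c. u = apply_mat (length (D (Suc r))) (?A r) t)"]
    by (simp only: compatible_scalar_entries simp_thms)
  have surj: "(\<forall>f. \<exists>v \<in> carrier_vec (length (D 0)). f - \<epsilon> \<bullet> v \<in> ideal_gen (mono_poly ` G)) \<longleftrightarrow>
      (\<forall>c. c \<notin> ?S \<longrightarrow> (\<exists>j<length (D 0). D 0 ! j \<le> c \<and> ?e j \<noteq> 0))"
    using augmentation_surjective_iff[OF \<epsilon> hom] .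
  show ?thesis
    unfolding res unfolding graded_free_resolution_def surj base step
    using M \<epsilon> hom by (simp only: simp_thms)
qed

section \<open>Comparison of minimal resolutions\<close>

text \<open>Matrices are total functions, so products carry the length \<open>L\<close> of the summation range.\<close>

definition mat_prod :: "nat \<Rightarrow> (nat \<Rightarrow> nat \<Rightarrow> 'k::field) \<Rightarrow> (nat \<Rightarrow> nat \<Rightarrow> 'k) \<Rightarrow> nat \<Rightarrow> nat \<Rightarrow> 'k" where
  "mat_prod L P Q = (\<lambda>i j. \<Sum>k<L. P i k * Q k j)"

lemma mat_prod_column: "(\<lambda>i. mat_prod L P Q i j) = apply_mat L P (\<lambda>k. Q k j)"
  by (simp add: mat_prod_def apply_mat_def)

lemma apply_mat_prod: "apply_mat L (mat_prod K P Q) u = apply_mat K P (apply_mat L Q u)"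
proof
  fix i
  have "apply_mat L (mat_prod K P Q) u i = (\<Sum>j<L. \<Sum>k<K. P i k * Q k j * u j)"
    by (simp add: apply_mat_def mat_prod_def sum_distrib_right)
  also have "\<dots> = (\<Sum>k<K. \<Sum>j<L. P i k * Q k j * u j)"
    by (rule sum.swap)
  also have "\<dots> = apply_mat K P (apply_mat L Q u) i"
    by (simp add: apply_mat_def sum_distrib_left mult.assoc)
  finally show "apply_mat L (mat_prod K P Q) u i = apply_mat K P (apply_mat L Q u) i" .
qed

lemma mat_prod_assoc: "mat_prod L (mat_prod K P Q) R = mat_prod K P (mat_prod L Q R)"
proof -
  have "(\<lambda>i. mat_prod L (mat_prod K P Q) R i j) = (\<lambda>i. mat_prod K P (mat_prod L Q R) i j)" for j
    by (simp only: mat_prod_column apply_mat_prod)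
  then show ?thesis by (metis (no_types, lifting) ext)
qed

lemma mat_prod_zero [simp]: "mat_prod L P (\<lambda>_ _. 0) = (\<lambda>_ _. 0)" "mat_prod L (\<lambda>_ _. 0) P = (\<lambda>_ _. 0)"
  by (simp_all add: mat_prod_def)

lemma apply_mat_zero: "apply_mat L P (\<lambda>_. 0) = (\<lambda>_. 0)"
  by (simp add: apply_mat_def)

lemma mat_prod_diff_right: "mat_prod L P (\<lambda>i j. Q i j - R i j) = (\<lambda>i j. mat_prod L P Q i j - mat_prod L P R i j)"
  by (simp add: mat_prod_def right_diff_distrib sum_subtractf)

lemma mat_prod_diff_left: "mat_prod L (\<lambda>i j. Q i j - R i j) P = (\<lambda>i j. mat_prod L Q P i j - mat_prod L R P i j)"
  by (simp add: mat_prod_def left_diff_distrib sum_subtractf)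

lemma compatible_column:
  "compatible as bs M \<Longrightarrow> (\<lambda>i. M i j) \<in> strand as (bs ! j)"
  by (auto simp: compatible_def strand_def)

lemma compatible_mat_prod:
  assumes P: "compatible as bs P" and Q: "compatible bs cs Q"
  shows "compatible as cs (mat_prod L P Q)"
  unfolding compatible_def
proof (intro allI impI)
  fix i j assume nz: "mat_prod L P Q i j \<noteq> 0"
  then obtain k where "P i k * Q k j \<noteq> 0" unfolding mat_prod_def by (meson sum.neutral)
  then have "P i k \<noteq> 0" "Q k j \<noteq> 0" by auto
  with P Q have *: "i < length as" "j < length cs" and le: "as ! i \<le> bs ! k" "bs ! k \<le> cs ! j"
    by (auto simp: compatible_def)
  with order_trans[OF le] show "i < length as \<and> j < length cs \<and> as ! i \<le> cs ! j" by blast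
qed

lemma compatible_diff:
  "compatible as bs P \<Longrightarrow> compatible as bs Q \<Longrightarrow> compatible as bs (\<lambda>i j. P i j - Q i j)"
  unfolding compatible_def by (metis diff_zero)

definition unit_mat :: "nat \<Rightarrow> nat \<Rightarrow> nat \<Rightarrow> 'k::field" where
  "unit_mat L i j = (if i = j \<and> i < L then 1 else 0)"

lemma compatible_unit_mat: "compatible as as (unit_mat (length as))"
  by (auto simp: compatible_def unit_mat_def)

lemma mat_prod_unit_mat:
  assumes "compatible as bs P"
  shows "mat_prod (length bs) P (unit_mat (length bs)) = P" "mat_prod (length as) (unit_mat (length as)) P = P"
proof -
  have z: "P i j = 0" if "\<not> i < length as \<or> \<not> j < length bs" for i j
    using assms that by (auto simp: compatible_def)
  show "mat_prod (length bs) P (unit_mat (length bs)) = P"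
  proof (intro ext)
    fix i j
    have "mat_prod (length bs) P (unit_mat (length bs)) i j
        = (\<Sum>k<length bs. if k = j then P i j else 0)"
      unfolding mat_prod_def unit_mat_def by (intro sum.cong) auto
    then show "mat_prod (length bs) P (unit_mat (length bs)) i j = P i j"
      using z[of i j] by auto
  qed
  show "mat_prod (length as) (unit_mat (length as)) P = P"
  proof (intro ext)
    fix i j
    have "mat_prod (length as) (unit_mat (length as)) P i j
        = (\<Sum>k<length as. if i = k then P i j else 0)"
      unfolding mat_prod_def unit_mat_def by (intro sum.cong) auto
    then show "mat_prod (length as) (unit_mat (length as)) P i j = P i j"
      using z[of i j] by auto
  qed
qed

lemma apply_unit_mat:
  assumes "u \<in> strand D c"
  shows "apply_mat (length D) (unit_mat (length D)) u = u"
proof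
  fix i
  have "apply_mat (length D) (unit_mat (length D)) u i = (\<Sum>k<length D. if i = k then u i else 0)"
    unfolding apply_mat_def unit_mat_def by (intro sum.cong) auto
  then show "apply_mat (length D) (unit_mat (length D)) u i = u i"
    using assms by (auto simp: strand_def)
qed

lemma apply_mat_diff: "apply_mat L (\<lambda>i j. P i j - Q i j) u = (\<lambda>i. apply_mat L P u i - apply_mat L Q u i)"
  by (simp add: apply_mat_def left_diff_distrib sum_subtractf)

lemma strand_resolutionD:
  assumes "strand_resolution S D A e"
  shows "compatible (D r) (D (Suc r)) (A r)"
    and "u \<in> strand (D r) c \<Longrightarrow> strand_cycle S D A e r c u \<longleftrightarrow>
        (\<exists>t\<in>strand (D (Suc r)) c. u = apply_mat (length (D (Suc r))) (A r) t)"
    and "c \<notin> S \<Longrightarrow> \<exists>j<length (D 0). D 0 ! j \<le> c \<and> e j \<noteq> 0"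
  using assms unfolding strand_resolution_def by blast+

lemma differential_square:
  assumes "strand_resolution S D A e"
  shows "mat_prod (length (D (Suc r))) (A r) (A (Suc r)) = (\<lambda>_ _. 0)"
proof -
  note component = strand_resolutionD(1)[OF assms]
  have "(\<lambda>i. mat_prod (length (D (Suc r))) (A r) (A (Suc r)) i j) = (\<lambda>_. 0)" for j
  proof -
    define c where "c = D (Suc (Suc r)) ! j"
    have "(\<lambda>i. A (Suc r) i j) = apply_mat (length (D (Suc (Suc r)))) (A (Suc r))
        (\<lambda>i. unit_mat (length (D (Suc (Suc r)))) i j)"
      using mat_prod_column[of "length (D (Suc (Suc r)))" "A (Suc r)" "unit_mat (length (D (Suc (Suc r))))" j]
        mat_prod_unit_mat(1)[OF component[of "Suc r"]] by simp
    moreover have "(\<lambda>i. unit_mat (length (D (Suc (Suc r)))) i j) \<in> strand (D (Suc (Suc r))) c"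
      unfolding c_def by (rule compatible_column[OF compatible_unit_mat])
    moreover have "(\<lambda>i. A (Suc r) i j) \<in> strand (D (Suc r)) c"
      unfolding c_def by (rule compatible_column[OF component])
    ultimately have "strand_cycle S D A e (Suc r) c (\<lambda>i. A (Suc r) i j)"
      using strand_resolutionD(2)[OF assms] by blast
    then show ?thesis by (simp add: mat_prod_column strand_cycle_def)
  qed
  then show ?thesis by (metis (no_types, lifting) ext)
qed

text \<open>Free modules are projective: a homogeneous map into the cycles factors through the differential,
  since each column has a preimage in its own multidegree.\<close>

lemma lift_columns:
  assumes G: "strand_resolution S D A e"
    and M: "compatible (D r) bs M"
    and cyc: "\<And>j. j < length bs \<Longrightarrow> strand_cycle S D A e r (bs ! j) (\<lambda>i. M i j)"
  obtains N where "compatible (D (Suc r)) bs N" "mat_prod (length (D (Suc r))) (A r) N = M"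
proof -
  have "\<exists>t\<in>strand (D (Suc r)) (bs ! j). (\<lambda>i. M i j) = apply_mat (length (D (Suc r))) (A r) t \<and>
      (\<not> j < length bs \<longrightarrow> t = (\<lambda>_. 0))" for j
  proof (cases "j < length bs")
    case True
    with cyc[OF True] strand_resolutionD(2)[OF G compatible_column[OF M]] show ?thesis by blast
  next
    case False
    then have "(\<lambda>i. M i j) = (\<lambda>_. 0)" using M by (auto simp: compatible_def)
    then show ?thesis by (intro bexI[of _ "\<lambda>_. 0"]) (auto simp: apply_mat_def)
  qed
  then obtain T where T: "\<And>j. T j \<in> strand (D (Suc r)) (bs ! j)"
    "\<And>j. (\<lambda>i. M i j) = apply_mat (length (D (Suc r))) (A r) (T j)"
    "\<And>j. \<not> j < length bs \<Longrightarrow> T j = (\<lambda>_. 0)" by metis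
  show ?thesis
  proof
    show "compatible (D (Suc r)) bs (\<lambda>i j. T j i)"
      unfolding compatible_def
    proof (intro allI impI)
      fix i j assume nz: "T j i \<noteq> 0"
      then have "j < length bs" using T(3)[of j] by (auto simp: fun_eq_iff)
      with nz T(1)[of j] show "i < length (D (Suc r)) \<and> j < length bs \<and> D (Suc r) ! i \<le> bs ! j"
        by (auto simp: strand_def)
    qed
    have "(\<lambda>i. mat_prod (length (D (Suc r))) (A r) (\<lambda>i j. T j i) i j) = (\<lambda>i. M i j)" for j
      by (simp add: mat_prod_column T(2))
    then show "mat_prod (length (D (Suc r))) (A r) (\<lambda>i j. T j i) = M"
      by (metis (no_types, lifting) ext)
  qed
qed

definition augment :: "nat \<Rightarrow> (nat \<Rightarrow> 'k::field) \<Rightarrow> (nat \<Rightarrow> 'k) \<Rightarrow> 'k" where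
  "augment L e u = (\<Sum>j<L. e j * u j)"

lemma augment_apply_mat: "augment L e (apply_mat K M u) = augment K (\<lambda>j. augment L e (\<lambda>i. M i j)) u"
  unfolding augment_def apply_mat_def sum_distrib_left sum_distrib_right
  by (subst sum.swap) (simp add: mult.assoc)

lemma strand_cycle_0: "strand_cycle S D A e 0 c u \<longleftrightarrow> c \<in> S \<or> augment (length (D 0)) e u = 0"
  by (simp add: strand_cycle_def augment_def)

lemma strand_cycle_Suc:
  "strand_cycle S D A e (Suc r) c u \<longleftrightarrow> apply_mat (length (D (Suc r))) (A r) u = (\<lambda>_. 0)"
  by (simp add: strand_cycle_def)

text \<open>The comparison theorem: the identity of \<open>R/I\<close> lifts to a chain map between resolutions.  The
  predicate \<open>P\<close> of the recursion records that cycles go to cycles, which is what the next lifting step needs.\<close>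

lemma chain_map_exists:
  fixes A A' :: "nat \<Rightarrow> nat \<Rightarrow> nat \<Rightarrow> 'k::field"
  assumes S: "\<forall>a\<in>S. \<forall>b. a \<le> b \<longrightarrow> b \<in> S"
    and F: "strand_resolution S D A e" and G: "strand_resolution S D' A' e'"
  obtains \<phi> where "\<And>r. compatible (D' r) (D r) (\<phi> r)"
    "\<And>r. mat_prod (length (D' (Suc r))) (A' r) (\<phi> (Suc r)) = mat_prod (length (D r)) (\<phi> r) (A r)"
    "\<And>c u. u \<in> strand (D 0) c \<Longrightarrow> c \<notin> S \<Longrightarrow>
       augment (length (D' 0)) e' (apply_mat (length (D 0)) (\<phi> 0) u) = augment (length (D 0)) e u"
proof -
  define P where "P = (\<lambda>r \<phi>. compatible (D' r) (D r) \<phi> \<and>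
    (\<forall>c. \<forall>u\<in>strand (D r) c. strand_cycle S D A e r c u \<longrightarrow>
       strand_cycle S D' A' e' r c (apply_mat (length (D r)) \<phi> u)) \<and>
    (r = 0 \<longrightarrow> (\<forall>c. \<forall>u\<in>strand (D 0) c. c \<notin> S \<longrightarrow>
       augment (length (D' 0)) e' (apply_mat (length (D 0)) \<phi> u) = augment (length (D 0)) e u)))"
  have base: "\<exists>\<phi>. P 0 \<phi>"
  proof -
    have "\<exists>t\<in>strand (D' 0) (D 0 ! j). (D 0 ! j \<notin> S \<longrightarrow> augment (length (D' 0)) e' t = e j) \<and>
        (\<not> j < length (D 0) \<or> D 0 ! j \<in> S \<longrightarrow> t = (\<lambda>_. 0))" if "j < length (D 0)" for j
    proof (cases "D 0 ! j \<in> S")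
      case False
      from strand_resolutionD(3)[OF G False] obtain i where
        i: "i < length (D' 0)" "D' 0 ! i \<le> D 0 ! j" "e' i \<noteq> 0" by blast
      define t where "t = (\<lambda>k. if k = i then e j / e' i else 0)"
      have "augment (length (D' 0)) e' t = (\<Sum>k<length (D' 0). if k = i then e j else 0)"
        unfolding augment_def t_def using i(3) by (intro sum.cong) auto
      then have "augment (length (D' 0)) e' t = e j" using i(1) by simp
      moreover have "t \<in> strand (D' 0) (D 0 ! j)" using i by (auto simp: t_def strand_def)
      ultimately show ?thesis using False that by blast
    qed (auto intro!: bexI[of _ "\<lambda>_. 0"])
    then obtain T where T: "\<And>j. j < length (D 0) \<Longrightarrow> T j \<in> strand (D' 0) (D 0 ! j)"
      "\<And>j. j < length (D 0) \<Longrightarrow> D 0 ! j \<notin> S \<Longrightarrow> augment (length (D' 0)) e' (T j) = e j"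
      by metis
    define \<phi> where "\<phi> = (\<lambda>i j. if j < length (D 0) then T j i else 0)"
    have "compatible (D' 0) (D 0) \<phi>"
      using T(1) by (auto simp: compatible_def \<phi>_def strand_def split: if_splits)
    moreover have aug_entries: "augment (length (D' 0)) e' (apply_mat (length (D 0)) \<phi> u) = augment (length (D 0)) e u"
      if u: "u \<in> strand (D 0) c" and c: "c \<notin> S" for c u
    proof -
      have "augment (length (D' 0)) e' (\<lambda>i. \<phi> i j) * u j = e j * u j" if j: "j < length (D 0)" for j
      proof (cases "u j = 0")
        case False
        then have "D 0 ! j \<le> c" using u by (auto simp: strand_def)
        then have "D 0 ! j \<notin> S" using S c by blast
        then show ?thesis using T(2)[OF j] j by (simp add: \<phi>_def)
      qed simp
      then show ?thesis
        by (subst augment_apply_mat) (auto simp: augment_def intro!: sum.cong)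
    qed
    ultimately show ?thesis
      unfolding P_def strand_cycle_0 by (intro exI[of _ \<phi>]) (metis (full_types))
  qed
  have step: "\<exists>\<phi>'. P (Suc r) \<phi>' \<and> mat_prod (length (D' (Suc r))) (A' r) \<phi>' = mat_prod (length (D r)) \<phi> (A r)"
    if \<phi>: "P r \<phi>" for r \<phi>
  proof -
    have component: "compatible (D' r) (D (Suc r)) (mat_prod (length (D r)) \<phi> (A r))"
      using \<phi> strand_resolutionD(1)[OF F] by (auto simp: P_def intro: compatible_mat_prod)
    obtain N where N: "compatible (D' (Suc r)) (D (Suc r)) N"
      "mat_prod (length (D' (Suc r))) (A' r) N = mat_prod (length (D r)) \<phi> (A r)"
    proof (rule lift_columns[OF G component])
      fix j assume "j < length (D (Suc r))"
      let ?c = "D (Suc r) ! j" and ?L = "length (D (Suc r))"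
      \<comment> \<open>Column \<open>j\<close> of the differential is the image of the basis vector \<open>e\<^sub>j\<close>, hence a cycle.\<close>
      have in_strand: "(\<lambda>i. A r i j) \<in> strand (D r) ?c"
        by (rule compatible_column[OF strand_resolutionD(1)[OF F]])
      have "(\<lambda>i. A r i j) = apply_mat ?L (A r) (\<lambda>i. unit_mat ?L i j)"
        using mat_prod_column[of ?L "A r" "unit_mat ?L" j]
          mat_prod_unit_mat(1)[OF strand_resolutionD(1)[OF F]] by simp
      moreover have "(\<lambda>i. unit_mat ?L i j) \<in> strand (D (Suc r)) ?c"
        by (rule compatible_column[OF compatible_unit_mat])
      ultimately have "strand_cycle S D A e r ?c (\<lambda>i. A r i j)"
        using strand_resolutionD(2)[OF F in_strand] by blast
      with \<phi> in_strand show "strand_cycle S D' A' e' r ?c (\<lambda>i. mat_prod (length (D r)) \<phi> (A r) i j)"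
        unfolding P_def mat_prod_column by blast
    qed
    have "apply_mat (length (D' (Suc r))) (A' r) (apply_mat (length (D (Suc r))) N u)
        = apply_mat (length (D r)) \<phi> (apply_mat (length (D (Suc r))) (A r) u)" for u
      by (metis apply_mat_prod N(2))
    then have "P (Suc r) N"
      unfolding P_def strand_cycle_Suc using N(1) by (simp add: apply_mat_zero)
    with N show ?thesis by blast
  qed
  have "\<exists>\<phi>. \<forall>r. P r (\<phi> r) \<and>
      mat_prod (length (D' (Suc r))) (A' r) (\<phi> (Suc r)) = mat_prod (length (D r)) (\<phi> r) (A r)"
    by (rule dependent_nat_choice) (use base step in blast)+
  then obtain \<phi> where "\<And>r. P r (\<phi> r)"
    "\<And>r. mat_prod (length (D' (Suc r))) (A' r) (\<phi> (Suc r)) = mat_prod (length (D r)) (\<phi> r) (A r)"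
    by blast
  with that[of \<phi>] show ?thesis by (auto simp: P_def)
qed

text \<open>A chain map that lifts the zero map is null-homotopic.  The recursion carries
  \<open>A\<^sub>r h\<^sub>r A\<^sub>r = \<theta>\<^sub>r A\<^sub>r\<close>, a consequence of the homotopy equation in degree \<open>r\<close> which suffices to see that
  \<open>\<theta>\<^sub>r\<^sub>+\<^sub>1 - h\<^sub>r A\<^sub>r\<close> maps to cycles; this treats degree \<open>0\<close> and the later degrees alike.\<close>

lemma homotopy_exists:
  fixes A :: "nat \<Rightarrow> nat \<Rightarrow> nat \<Rightarrow> 'k::field"
  assumes F: "strand_resolution S D A e"
    and \<theta>: "\<And>r. compatible (D r) (D r) (\<theta> r)"
    and chain: "\<And>r. mat_prod (length (D (Suc r))) (A r) (\<theta> (Suc r)) = mat_prod (length (D r)) (\<theta> r) (A r)"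
    and zero: "\<And>c u. u \<in> strand (D 0) c \<Longrightarrow> strand_cycle S D A e 0 c (apply_mat (length (D 0)) (\<theta> 0) u)"
  obtains h where "\<And>r. compatible (D (Suc r)) (D r) (h r)"
    "mat_prod (length (D 1)) (A 0) (h 0) = \<theta> 0"
    "\<And>r. mat_prod (length (D (Suc (Suc r)))) (A (Suc r)) (h (Suc r))
       = (\<lambda>i j. \<theta> (Suc r) i j - mat_prod (length (D r)) (h r) (A r) i j)"
proof -
  note component = strand_resolutionD(1)[OF F]
  define P where "P = (\<lambda>r h. compatible (D (Suc r)) (D r) h \<and>
    mat_prod (length (D (Suc r))) (A r) (mat_prod (length (D r)) h (A r)) = mat_prod (length (D r)) (\<theta> r) (A r) \<and>
    (r = 0 \<longrightarrow> mat_prod (length (D 1)) (A 0) h = \<theta> 0))"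
  have base: "\<exists>h. P 0 h"
  proof -
    obtain h where h: "compatible (D (Suc 0)) (D 0) h" "mat_prod (length (D (Suc 0))) (A 0) h = \<theta> 0"
    proof (rule lift_columns[OF F \<theta>])
      fix j assume "j < length (D 0)"
      have "apply_mat (length (D 0)) (\<theta> 0) (\<lambda>i. unit_mat (length (D 0)) i j) = (\<lambda>i. \<theta> 0 i j)"
        using mat_prod_column[of "length (D 0)" "\<theta> 0" "unit_mat (length (D 0))" j]
          mat_prod_unit_mat(1)[OF \<theta>] by simp
      with zero[OF compatible_column[OF compatible_unit_mat], of j]
      show "strand_cycle S D A e 0 (D 0 ! j) (\<lambda>i. \<theta> 0 i j)" by simp
    qed
    then show ?thesis by (auto simp: P_def mat_prod_assoc[symmetric])
  qed
  have step: "\<exists>h'. P (Suc r) h' \<and> mat_prod (length (D (Suc (Suc r)))) (A (Suc r)) h'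
       = (\<lambda>i j. \<theta> (Suc r) i j - mat_prod (length (D r)) h (A r) i j)" if h: "P r h" for r h
  proof -
    let ?M = "\<lambda>i j. \<theta> (Suc r) i j - mat_prod (length (D r)) h (A r) i j"
    have compM: "compatible (D (Suc r)) (D (Suc r)) ?M"
      using h \<theta> component by (auto simp: P_def intro!: compatible_diff intro: compatible_mat_prod)
    have "mat_prod (length (D (Suc r))) (A r) ?M = (\<lambda>_ _. 0)"
      using h by (simp add: mat_prod_diff_right P_def chain)
    then have z: "apply_mat (length (D (Suc r))) (A r) (\<lambda>i. ?M i j) = (\<lambda>_. 0)" for j
      using mat_prod_column[of "length (D (Suc r))" "A r" ?M j] by simp
    obtain h' where h': "compatible (D (Suc (Suc r))) (D (Suc r)) h'"
      "mat_prod (length (D (Suc (Suc r)))) (A (Suc r)) h' = ?M"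
      by (rule lift_columns[OF F compM]) (auto simp: strand_cycle_Suc z)
    have "mat_prod (length (D (Suc (Suc r)))) (A (Suc r)) (mat_prod (length (D (Suc r))) h' (A (Suc r)))
        = mat_prod (length (D (Suc r))) ?M (A (Suc r))"
      by (simp add: mat_prod_assoc[symmetric] h'(2))
    also have "\<dots> = mat_prod (length (D (Suc r))) (\<theta> (Suc r)) (A (Suc r))"
      by (simp add: mat_prod_diff_left mat_prod_assoc differential_square[OF F])
    finally have "P (Suc r) h'" using h'(1) by (simp add: P_def)
    with h' show ?thesis by blast
  qed
  have "\<exists>h. \<forall>r. P r (h r) \<and> mat_prod (length (D (Suc (Suc r)))) (A (Suc r)) (h (Suc r))
       = (\<lambda>i j. \<theta> (Suc r) i j - mat_prod (length (D r)) (h r) (A r) i j)"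
    by (rule dependent_nat_choice) (use base step in blast)+
  then obtain h where "\<And>r. P r (h r)"
    "\<And>r. mat_prod (length (D (Suc (Suc r)))) (A (Suc r)) (h (Suc r))
       = (\<lambda>i j. \<theta> (Suc r) i j - mat_prod (length (D r)) (h r) (A r) i j)"
    by blast
  with that[of h] show ?thesis by (auto simp: P_def)
qed

lemma sum_fun_apply: "(\<Sum>j\<in>J. f j) k = (\<Sum>j\<in>J. f j k)"
  by (induction J rule: infinite_finite_induct) auto

text \<open>If a product of a \<open>J \<times> K\<close> and a \<open>K \<times> J\<close> matrix is the identity, the columns of the second factor are
  independent in a space of dimension \<open>|K|\<close>.\<close>

lemma card_le_of_left_inverse:
  fixes P Q :: "nat \<Rightarrow> nat \<Rightarrow> 'k::field"
  assumes J: "finite J" and K: "finite K"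
    and inv: "\<And>j j'. j \<in> J \<Longrightarrow> j' \<in> J \<Longrightarrow> (\<Sum>k\<in>K. P j k * Q k j') = (if j = j' then 1 else 0)"
  shows "card J \<le> card K"
proof -
  interpret vs: vector_space "\<lambda>(c::'k) (f::nat \<Rightarrow> 'k) i. c * f i"
    by unfold_locales (auto simp: algebra_simps fun_eq_iff)
  define q where "q = (\<lambda>j k. if k \<in> K then Q k j else 0)"
  define \<delta> where "\<delta> = (\<lambda>k i :: nat. if i = k then 1 else 0 :: 'k)"
  have pair: "(\<Sum>k\<in>K. P j k * q j' k) = (if j = j' then 1 else 0)" if "j \<in> J" "j' \<in> J" for j j'
    using inv[OF that] by (simp add: q_def cong: sum.cong)
  have inj: "inj_on q J"
  proof (rule inj_onI)
    fix j j' assume j: "j \<in> J" "j' \<in> J" "q j = q j'"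
    from pair[OF j(1) j(2)] pair[OF j(1) j(1)] j(3) show "j = j'" by (auto split: if_splits)
  qed
  have "vs.independent (q ` J)"
  proof
    assume "vs.dependent (q ` J)"
    then obtain u where u: "(\<Sum>v\<in>q ` J. (\<lambda>i. u v * v i)) = 0" "\<exists>v\<in>q ` J. u v \<noteq> 0"
      using J by (auto simp: vs.dependent_finite)
    then obtain j where j: "j \<in> J" "u (q j) \<noteq> 0" by blast
    have "(\<Sum>v\<in>q ` J. (\<lambda>i. u v * v i)) = (\<Sum>j\<in>J. (\<lambda>i. u (q j) * q j i))"
      by (simp add: sum.reindex[OF inj])
    then have "(\<Sum>j\<in>J. (\<lambda>i. u (q j) * q j i)) = 0" using u(1) by simp
    then have z: "(\<Sum>j'\<in>J. u (q j') * q j' k) = 0" for k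
      using sum_fun_apply[of "\<lambda>j i. u (q j) * q j i" J k] by simp
    have "0 = (\<Sum>k\<in>K. P j k * (\<Sum>j'\<in>J. u (q j') * q j' k))" by (simp add: z)
    also have "\<dots> = (\<Sum>j'\<in>J. u (q j') * (\<Sum>k\<in>K. P j k * q j' k))"
      unfolding sum_distrib_left by (subst sum.swap) (simp add: mult.left_commute)
    also have "\<dots> = (\<Sum>j'\<in>J. if j = j' then u (q j') else 0)"
      by (intro sum.cong) (auto simp: pair[OF j(1)])
    also have "\<dots> = u (q j)" using J j by simp
    finally show False using j by simp
  qed
  moreover have "q ` J \<subseteq> vs.span (\<delta> ` K)"
  proof
    fix v assume "v \<in> q ` J"
    then obtain j where j: "v = q j" by blast
    have "q j = (\<Sum>k\<in>K. (\<lambda>i. Q k j * \<delta> k i))"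
    proof
      fix i
      have "(\<Sum>k\<in>K. (\<lambda>i. Q k j * \<delta> k i)) i = (\<Sum>k\<in>K. if i = k then Q i j else 0)"
        unfolding sum_fun_apply \<delta>_def by (intro sum.cong) auto
      then show "q j i = (\<Sum>k\<in>K. (\<lambda>i. Q k j * \<delta> k i)) i"
        using K by (simp add: q_def)
    qed
    also have "\<dots> \<in> vs.span (\<delta> ` K)"
      by (intro vs.span_sum vs.span_scale vs.span_base imageI)
    finally show "v \<in> vs.span (\<delta> ` K)" by (simp add: j)
  qed
  ultimately have "card (q ` J) \<le> card (\<delta> ` K)"
    using vs.independent_span_bound[of "\<delta> ` K" "q ` J"] K by simp
  with card_image[OF inj] card_image_le[OF K, of \<delta>] show ?thesis by simp
qed

text \<open>Let \<open>\<psi>\<phi> - 1 = A h + h A\<close> for comparison maps \<open>\<phi>, \<psi>\<close> in the two directions.  Restrict to the rows and columns with shift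
  \<open>a\<close>.  A product of homogeneous maps between two basis elements of shift \<open>a\<close> passes only through basis elements
  of shift \<open>a\<close>, where the minimal differential \<open>A\<close> has entry zero; so the right-hand side vanishes and the
  restricted \<open>\<phi>\<close> has a left inverse.\<close>

lemma count_list_le_of_minimal:
  fixes A A' :: "nat \<Rightarrow> nat \<Rightarrow> nat \<Rightarrow> 'k::field"
  assumes S: "\<forall>a\<in>S. \<forall>b. a \<le> b \<longrightarrow> b \<in> S"
    and F: "strand_resolution S D A e" and G: "strand_resolution S D' A' e'"
    and minimal: "\<And>r i j. i < length (D r) \<Longrightarrow> j < length (D (Suc r)) \<Longrightarrow> D r ! i = D (Suc r) ! j \<Longrightarrow> A r i j = 0"
  shows "count_list (D r) a \<le> count_list (D' r) a"
proof -
  note compA = strand_resolutionD(1)[OF F]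
  obtain \<phi> where \<phi>: "\<And>r. compatible (D' r) (D r) (\<phi> r)"
    "\<And>r. mat_prod (length (D' (Suc r))) (A' r) (\<phi> (Suc r)) = mat_prod (length (D r)) (\<phi> r) (A r)"
    "\<And>c u. u \<in> strand (D 0) c \<Longrightarrow> c \<notin> S \<Longrightarrow>
       augment (length (D' 0)) e' (apply_mat (length (D 0)) (\<phi> 0) u) = augment (length (D 0)) e u"
    using chain_map_exists[OF S F G] by blast
  obtain \<psi> where \<psi>: "\<And>r. compatible (D r) (D' r) (\<psi> r)"
    "\<And>r. mat_prod (length (D (Suc r))) (A r) (\<psi> (Suc r)) = mat_prod (length (D' r)) (\<psi> r) (A' r)"
    "\<And>c u. u \<in> strand (D' 0) c \<Longrightarrow> c \<notin> S \<Longrightarrow>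
       augment (length (D 0)) e (apply_mat (length (D' 0)) (\<psi> 0) u) = augment (length (D' 0)) e' u"
    using chain_map_exists[OF S G F] by blast
  \<comment> \<open>\<open>\<psi>\<phi> - 1\<close> lifts the zero map of \<open>R/I\<close>.\<close>
  define \<theta> where "\<theta> = (\<lambda>r i j. mat_prod (length (D' r)) (\<psi> r) (\<phi> r) i j - unit_mat (length (D r)) i j)"
  have component\<theta>: "compatible (D r) (D r) (\<theta> r)" for r
    unfolding \<theta>_def by (intro compatible_diff compatible_mat_prod[OF \<psi>(1) \<phi>(1)] compatible_unit_mat)
  have chain: "mat_prod (length (D (Suc r))) (A r) (\<theta> (Suc r)) = mat_prod (length (D r)) (\<theta> r) (A r)" for r
    unfolding \<theta>_def mat_prod_diff_left mat_prod_diff_right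
    by (simp add: mat_prod_unit_mat[OF compA] mat_prod_assoc \<phi>(2)[symmetric])
       (simp add: mat_prod_assoc[symmetric] \<psi>(2))
  have zero: "strand_cycle S D A e 0 c (apply_mat (length (D 0)) (\<theta> 0) u)" if u: "u \<in> strand (D 0) c" for c u
  proof (cases "c \<in> S")
    case False
    have "augment (length (D 0)) e (apply_mat (length (D 0)) (\<theta> 0) u)
      = augment (length (D 0)) e (apply_mat (length (D' 0)) (\<psi> 0) (apply_mat (length (D 0)) (\<phi> 0) u))
        - augment (length (D 0)) e u"
      unfolding \<theta>_def apply_mat_diff apply_unit_mat[OF u] apply_mat_prod
      by (simp add: augment_def right_diff_distrib sum_subtractf)
    also have "\<dots> = 0"
      using \<psi>(3)[OF apply_mat_strand[OF \<phi>(1) u] False] \<phi>(3)[OF u False] by simp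
    finally show ?thesis by (simp add: strand_cycle_0)
  qed (simp add: strand_cycle_0)
  obtain h where h: "\<And>r. compatible (D (Suc r)) (D r) (h r)"
    "mat_prod (length (D 1)) (A 0) (h 0) = \<theta> 0"
    "\<And>r. mat_prod (length (D (Suc (Suc r)))) (A (Suc r)) (h (Suc r))
       = (\<lambda>i j. \<theta> (Suc r) i j - mat_prod (length (D r)) (h r) (A r) i j)"
    using homotopy_exists[OF F component\<theta> chain zero] by blast
  define J where "J = {i. i < length (D r) \<and> D r ! i = a}"
  define K where "K = {i. i < length (D' r) \<and> D' r ! i = a}"
  have mmJ: "mat_prod L P Q i j = 0" if "i \<in> J" "j \<in> J" "\<And>k. D s ! k = a \<Longrightarrow> P i k * Q k j = 0"
      "compatible (D r) (D s) P" "compatible (D s) (D r) Q" for L P Q i j s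
    unfolding mat_prod_def
  proof (intro sum.neutral ballI)
    fix k
    show "P i k * Q k j = 0"
    proof (rule ccontr)
      assume nz: "P i k * Q k j \<noteq> 0"
      then have "D r ! i \<le> D s ! k" "D s ! k \<le> D r ! j"
        using that(4,5) by (auto simp: compatible_def)
      then have "D s ! k = a" using that(1,2) by (auto simp: J_def)
      with that(3) nz show False by blast
    qed
  qed
  have Ah: "mat_prod (length (D (Suc r))) (A r) (h r) i j = 0" if ij: "i \<in> J" "j \<in> J" for i j
  proof (rule mmJ[OF ij _ compA h(1)])
    fix k assume k: "D (Suc r) ! k = a"
    show "A r i k * h r k j = 0"
      using minimal[of i r k] compA[of r] ij k by (auto simp: J_def compatible_def)
  qed
  have \<theta>0: "\<theta> r i j = 0" if ij: "i \<in> J" "j \<in> J" for i j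
  proof (cases r)
    case 0
    with Ah[OF ij] h(2) show ?thesis by simp
  next
    case (Suc s)
    have "mat_prod (length (D s)) (h s) (A s) i j = 0"
    proof (rule mmJ[OF ij])
      fix k assume k: "D s ! k = a"
      show "h s i k * A s k j = 0"
        using minimal[of k s j] compA[of s] ij k Suc by (auto simp: J_def compatible_def)
    qed (use h(1) compA Suc in auto)
    moreover have "mat_prod (length (D (Suc r))) (A r) (h r) i j
        = \<theta> r i j - mat_prod (length (D s)) (h s) (A s) i j"
      using h(3)[of s] Suc by simp
    ultimately show ?thesis using Ah[OF ij] by simp
  qed
  have "card J \<le> card K"
  proof (rule card_le_of_left_inverse)
    fix i j assume ij: "i \<in> J" "j \<in> J"
    have "(\<Sum>k\<in>K. \<psi> r i k * \<phi> r k j) = (\<Sum>k<length (D' r). \<psi> r i k * \<phi> r k j)"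
    proof (rule sum.mono_neutral_left)
      show "\<forall>k\<in>{..<length (D' r)} - K. \<psi> r i k * \<phi> r k j = 0"
      proof
        fix k assume k: "k \<in> {..<length (D' r)} - K"
        show "\<psi> r i k * \<phi> r k j = 0"
        proof (rule ccontr)
          assume "\<psi> r i k * \<phi> r k j \<noteq> 0"
          then have "D r ! i \<le> D' r ! k" "D' r ! k \<le> D r ! j"
            using \<phi>(1)[of r] \<psi>(1)[of r] by (auto simp: compatible_def)
          with ij k show False by (auto simp: J_def K_def)
        qed
      qed
    qed (auto simp: K_def)
    also have "\<dots> = unit_mat (length (D r)) i j"
      using \<theta>0[OF ij] by (simp add: \<theta>_def mat_prod_def)
    finally show "(\<Sum>k\<in>K. \<psi> r i k * \<phi> r k j) = (if i = j then 1 else 0)"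
      using ij by (auto simp: unit_mat_def J_def)
  qed (auto simp: J_def K_def)
  moreover have "count_list xs a = card {i. i < length xs \<and> xs ! i = a}" for xs :: "'a monomial list"
    by (simp add: count_list_eq_length_filter length_filter_conv_card eq_commute[of a])
  ultimately show ?thesis by (simp add: J_def K_def)
qed

section \<open>The Taylor complex\<close>

lemma mlcm_le_iff:
  assumes "finite \<sigma>"
  shows "mlcm \<sigma> \<le> c \<longleftrightarrow> (\<forall>m\<in>\<sigma>. m \<le> c)"
  using assms by (auto simp: mlcm_def le_fun_def)

lemma le_mlcm: "finite \<sigma> \<Longrightarrow> m \<in> \<sigma> \<Longrightarrow> m \<le> mlcm \<sigma>"
  using mlcm_le_iff by blast

lemma mlcm_mono: "finite \<sigma> \<Longrightarrow> \<tau> \<subseteq> \<sigma> \<Longrightarrow> mlcm \<tau> \<le> mlcm \<sigma>"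
  using mlcm_le_iff le_mlcm finite_subset by (metis subsetD)

lemma mlcm_empty [simp]: "mlcm {} = (\<lambda>_. 0)"
  by (simp add: mlcm_def)

text \<open>Proved by induction and not by comparing the sum with its negative, so that it also holds in
  characteristic 2.\<close>

lemma antisymmetric_double_sum:
  fixes f :: "'a \<Rightarrow> 'a \<Rightarrow> 'b::ab_group_add"
  assumes "finite X" and "\<And>p q. p \<in> X \<Longrightarrow> q \<in> X \<Longrightarrow> p \<noteq> q \<Longrightarrow> f p q = - f q p"
  shows "(\<Sum>p\<in>X. \<Sum>q\<in>X - {p}. f p q) = 0"
  using assms
proof (induction X rule: finite_induct)
  case (insert a X)
  have "(\<Sum>q\<in>insert a X - {p}. f p q) = f p a + (\<Sum>q\<in>X - {p}. f p q)" if "p \<in> X" for p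
  proof -
    have "insert a X - {p} = insert a (X - {p})" using that insert.hyps by auto
    then show ?thesis using insert.hyps by simp
  qed
  then have e1: "(\<Sum>p\<in>X. \<Sum>q\<in>insert a X - {p}. f p q)
      = (\<Sum>p\<in>X. f p a + (\<Sum>q\<in>X - {p}. f p q))"
    by (rule sum.cong[OF refl])
  have e2: "insert a X - {a} = X" using insert.hyps by auto
  have "(\<Sum>p\<in>insert a X. \<Sum>q\<in>insert a X - {p}. f p q)
      = (\<Sum>q\<in>X. f a q) + ((\<Sum>p\<in>X. f p a) + (\<Sum>p\<in>X. \<Sum>q\<in>X - {p}. f p q))"
    by (subst sum.insert[OF insert.hyps], subst e2, subst e1, subst sum.distrib, rule refl)
  also have "(\<Sum>p\<in>X. f p a) = (\<Sum>p\<in>X. - f a p)"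
    using insert.hyps by (intro sum.cong refl insert.prems) auto
  also have "(\<Sum>p\<in>X. \<Sum>q\<in>X - {p}. f p q) = 0"
    by (intro insert.IH insert.prems insertI2)
  finally show ?case by (simp add: sum_negf)
qed simp

text \<open>The enumeration \<open>num\<close> orders the generators to fix the signs of the Taylor complex.  Chains of all sizes are kept in one function space, with a subset \<open>\<sigma>\<close>
  standing for the basis element of multidegree \<open>lcm(\<sigma>)\<close>.\<close>

locale taylor =
  fixes G :: "'v monomial set" and num :: "'v monomial \<Rightarrow> nat" and ty :: "'k::field itself"
  assumes finG: "finite G" and inj_num: "inj_on num G"
begin

definition face_sign :: "'v monomial \<Rightarrow> 'v monomial set \<Rightarrow> 'k" where
  "face_sign q \<sigma> = (-1) ^ card {m \<in> \<sigma>. num m < num q}"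

lemma face_sign_square: "face_sign q \<sigma> * face_sign q \<sigma> = 1"
  by (simp add: face_sign_def power_add[symmetric] flip: mult_2 power_mult)

lemma finite_cell: "\<sigma> \<subseteq> G \<Longrightarrow> finite \<sigma>"
  using finG finite_subset by blast

text \<open>The sign rule behind both \<open>\<partial>\<^sup>2 = 0\<close> and the cone homotopy: removing two generators in either
  order gives opposite signs.\<close>

lemma face_sign_swap:
  assumes \<sigma>: "\<sigma> \<subseteq> G" and q: "q \<in> \<sigma>" and g: "g \<in> \<sigma>" and ne: "q \<noteq> g"
  shows "face_sign g \<sigma> * face_sign q (\<sigma> - {g}) = - (face_sign q \<sigma> * face_sign g (\<sigma> - {q}))"
proof -
  have *: "face_sign g \<sigma> * face_sign q (\<sigma> - {g}) = - (face_sign q \<sigma> * face_sign g (\<sigma> - {q}))"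
    if q: "q \<in> \<sigma>" and g: "g \<in> \<sigma>" and lt: "num q < num g" for q g
  proof -
    have "{m \<in> \<sigma>. num m < num g} = insert q {m \<in> \<sigma> - {q}. num m < num g}"
      using q lt by auto
    then have 1: "face_sign g \<sigma> = - face_sign g (\<sigma> - {q})"
      using finite_cell[OF \<sigma>] by (simp add: face_sign_def)
    have "{m \<in> \<sigma> - {g}. num m < num q} = {m \<in> \<sigma>. num m < num q}"
      using lt by auto
    then have 2: "face_sign q (\<sigma> - {g}) = face_sign q \<sigma>" by (simp add: face_sign_def)
    show ?thesis unfolding 1 2 by simp
  qed
  have "num q \<noteq> num g" using assms inj_num by (auto dest: inj_onD)
  then consider "num q < num g" | "num g < num q" by linarith
  then show ?thesis
  proof cases
    case 1
    with *[OF q g] show ?thesis by simp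
  next
    case 2
    with *[OF g q] show ?thesis by simp
  qed
qed

text \<open>Monomial coefficients are left out: in a fixed multidegree \<open>c\<close> the Taylor complex is the augmented chain
  complex of the full simplex on the generators that divide \<open>x\<^sup>c\<close>.\<close>

definition boundary :: "('v monomial set \<Rightarrow> 'k) \<Rightarrow> 'v monomial set \<Rightarrow> 'k" where
  "boundary v \<tau> = (if \<tau> \<subseteq> G then \<Sum>q\<in>G - \<tau>. face_sign q (insert q \<tau>) * v (insert q \<tau>) else 0)"

definition chains :: "nat \<Rightarrow> 'v monomial \<Rightarrow> ('v monomial set \<Rightarrow> 'k) set" where
  "chains r c = {v. \<forall>\<sigma>. v \<sigma> \<noteq> 0 \<longrightarrow> \<sigma> \<subseteq> G \<and> card \<sigma> = r \<and> mlcm \<sigma> \<le> c}"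

lemma chainsD:
  "v \<in> chains r c \<Longrightarrow> v \<sigma> \<noteq> 0 \<Longrightarrow> \<sigma> \<subseteq> G \<and> card \<sigma> = r \<and> mlcm \<sigma> \<le> c"
  by (simp add: chains_def)

lemma zero_chains [simp]: "(\<lambda>_. 0) \<in> chains r c"
  by (simp add: chains_def)

lemma chains_mono: "v \<in> chains r b \<Longrightarrow> b \<le> c \<Longrightarrow> v \<in> chains r c"
  unfolding chains_def by (auto intro: order_trans)

lemma chains_sum:
  assumes "\<And>i. i \<in> I \<Longrightarrow> a i \<noteq> 0 \<Longrightarrow> f i \<in> chains r c"
  shows "(\<lambda>\<sigma>. \<Sum>i\<in>I. a i * f i \<sigma>) \<in> chains r c"
  unfolding chains_def mem_Collect_eq
proof (intro allI impI)
  fix \<sigma> assume "(\<Sum>i\<in>I. a i * f i \<sigma>) \<noteq> 0"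
  then obtain i where "i \<in> I" "a i * f i \<sigma> \<noteq> 0" by (meson sum.neutral)
  with assms chainsD show "\<sigma> \<subseteq> G \<and> card \<sigma> = r \<and> mlcm \<sigma> \<le> c" by fastforce
qed

lemma chains_diff: "v \<in> chains r c \<Longrightarrow> w \<in> chains r c \<Longrightarrow> (\<lambda>\<sigma>. v \<sigma> - w \<sigma>) \<in> chains r c"
  unfolding chains_def mem_Collect_eq by (metis diff_zero)

lemma boundary_zero [simp]: "boundary (\<lambda>_. 0) = (\<lambda>_. 0)"
  by (simp add: boundary_def fun_eq_iff)

lemma boundary_sum: "boundary (\<lambda>\<sigma>. \<Sum>i\<in>I. a i * f i \<sigma>) = (\<lambda>\<tau>. \<Sum>i\<in>I. a i * boundary (f i) \<tau>)"
proof
  fix \<tau>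
  show "boundary (\<lambda>\<sigma>. \<Sum>i\<in>I. a i * f i \<sigma>) \<tau> = (\<Sum>i\<in>I. a i * boundary (f i) \<tau>)"
    unfolding boundary_def by (auto simp: sum_distrib_left mult.left_commute intro: sum.swap)
qed

lemma boundary_diff: "boundary (\<lambda>\<sigma>. v \<sigma> - w \<sigma>) = (\<lambda>\<tau>. boundary v \<tau> - boundary w \<tau>)"
  by (auto simp: boundary_def fun_eq_iff right_diff_distrib sum_subtractf)

lemma boundary_nonzeroD:
  assumes "boundary v \<tau> \<noteq> 0"
  obtains q where "\<tau> \<subseteq> G" "q \<in> G" "q \<notin> \<tau>" "v (insert q \<tau>) \<noteq> 0"
proof -
  from assms have \<tau>: "\<tau> \<subseteq> G" and "(\<Sum>q\<in>G - \<tau>. face_sign q (insert q \<tau>) * v (insert q \<tau>)) \<noteq> 0"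
    by (auto simp: boundary_def split: if_splits)
  then obtain q where "q \<in> G - \<tau>" "face_sign q (insert q \<tau>) * v (insert q \<tau>) \<noteq> 0"
    by (meson sum.neutral)
  with \<tau> that show ?thesis by auto
qed

lemma boundary_chains: "v \<in> chains (Suc r) c \<Longrightarrow> boundary v \<in> chains r c"
  unfolding chains_def[of r] mem_Collect_eq
proof (intro allI impI)
  fix \<tau> assume v: "v \<in> chains (Suc r) c" and nz: "boundary v \<tau> \<noteq> 0"
  obtain q where q: "\<tau> \<subseteq> G" "q \<in> G" "q \<notin> \<tau>" "v (insert q \<tau>) \<noteq> 0"
    using boundary_nonzeroD[OF nz] by blast
  have fin: "finite \<tau>" by (rule finite_cell[OF q(1)])
  have "card (insert q \<tau>) = Suc r" "mlcm (insert q \<tau>) \<le> c"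
    using chainsD[OF v q(4)] by auto
  then show "\<tau> \<subseteq> G \<and> card \<tau> = r \<and> mlcm \<tau> \<le> c"
    using q fin by (auto simp: mlcm_le_iff)
qed

lemma boundary_chains_0: "v \<in> chains 0 c \<Longrightarrow> boundary v = (\<lambda>_. 0)"
proof
  fix \<tau> assume v: "v \<in> chains 0 c"
  show "boundary v \<tau> = 0"
  proof (rule ccontr)
    assume nz: "boundary v \<tau> \<noteq> 0"
    obtain q where q: "\<tau> \<subseteq> G" "v (insert q \<tau>) \<noteq> 0"
      using boundary_nonzeroD[OF nz] by blast
    with chainsD[OF v q(2)] finite_cell[OF q(1)] show False by simp
  qed
qed

lemma boundary_bd: "boundary (boundary v) = (\<lambda>_. 0)"
proof
  fix \<tau>
  show "boundary (boundary v) \<tau> = 0"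
  proof (cases "\<tau> \<subseteq> G")
    case True
    let ?X = "G - \<tau>"
    let ?f = "\<lambda>q g. face_sign q (insert q \<tau>) * (face_sign g (insert g (insert q \<tau>)) * v (insert g (insert q \<tau>)))"
    have "face_sign q (insert q \<tau>) * boundary v (insert q \<tau>) = (\<Sum>g\<in>?X - {q}. ?f q g)" if "q \<in> ?X" for q
    proof -
      have "G - insert q \<tau> = ?X - {q}" by auto
      then show ?thesis using that True by (simp add: boundary_def sum_distrib_left)
    qed
    then have "boundary (boundary v) \<tau> = (\<Sum>q\<in>?X. \<Sum>g\<in>?X - {q}. ?f q g)"
      using True by (simp add: boundary_def[of "boundary v"])
    also have "\<dots> = 0"
    proof (rule antisymmetric_double_sum)
      fix p q assume *: "p \<in> ?X" "q \<in> ?X" "p \<noteq> q"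
      let ?\<sigma> = "insert p (insert q \<tau>)"
      have "face_sign q ?\<sigma> * face_sign p (?\<sigma> - {q}) = - (face_sign p ?\<sigma> * face_sign q (?\<sigma> - {p}))"
        by (rule face_sign_swap) (use * True in auto)
      moreover have "?\<sigma> - {q} = insert p \<tau>" "?\<sigma> - {p} = insert q \<tau>" "insert q (insert p \<tau>) = ?\<sigma>"
        using * by auto
      ultimately have "face_sign q (insert q (insert p \<tau>)) * face_sign p (insert p \<tau>)
          = - (face_sign p ?\<sigma> * face_sign q (insert q \<tau>))" by simp
      then have "face_sign p (insert p \<tau>) * face_sign q (insert q (insert p \<tau>)) * v ?\<sigma>
          = - (face_sign q (insert q \<tau>) * face_sign p ?\<sigma> * v ?\<sigma>)"
        by (simp add: mult.commute)
      with \<open>insert q (insert p \<tau>) = ?\<sigma>\<close> show "?f p q = - ?f q p" by (simp add: mult.assoc)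
    qed (simp add: finG)
    finally show ?thesis .
  next
    case False
    then show ?thesis by (subst boundary_def) simp
  qed
qed

text \<open>The contracting homotopy that adds the vertex \<open>g\<close>.\<close>

definition cone :: "'v monomial \<Rightarrow> ('v monomial set \<Rightarrow> 'k) \<Rightarrow> 'v monomial set \<Rightarrow> 'k" where
  "cone g v \<sigma> = (if g \<in> \<sigma> \<and> \<sigma> \<subseteq> G then face_sign g \<sigma> * v (\<sigma> - {g}) else 0)"

lemma cone_chains:
  assumes "v \<in> chains r c" "g \<in> G" "g \<le> c"
  shows "cone g v \<in> chains (Suc r) c"
  unfolding chains_def mem_Collect_eq
proof (intro allI impI)
  fix \<sigma> assume "cone g v \<sigma> \<noteq> 0"
  then have g: "g \<in> \<sigma>" "\<sigma> \<subseteq> G" and "v (\<sigma> - {g}) \<noteq> 0"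
    by (auto simp: cone_def split: if_splits)
  with chainsD[OF assms(1)] have *: "card (\<sigma> - {g}) = r" "mlcm (\<sigma> - {g}) \<le> c" by auto
  have fin: "finite \<sigma>" by (rule finite_cell[OF g(2)])
  have "\<forall>m\<in>\<sigma>. m \<le> c" using *(2) fin assms(3) by (auto simp: mlcm_le_iff)
  then show "\<sigma> \<subseteq> G \<and> card \<sigma> = Suc r \<and> mlcm \<sigma> \<le> c"
    using card_Suc_Diff1[OF fin g(1)] *(1) g(2) mlcm_le_iff[OF fin] by simp
qed

lemma boundary_cone:
  assumes v: "\<And>\<sigma>. v \<sigma> \<noteq> 0 \<Longrightarrow> \<sigma> \<subseteq> G" and g: "g \<in> G" and cyc: "boundary v = (\<lambda>_. 0)"
  shows "boundary (cone g v) = v"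
proof
  fix \<tau>
  show "boundary (cone g v) \<tau> = v \<tau>"
  proof (cases "\<tau> \<subseteq> G")
    case False
    with v show ?thesis by (auto simp: boundary_def)
  next
    case sub: True
    show ?thesis
    proof (cases "g \<in> \<tau>")
      case False
      have "boundary (cone g v) \<tau> = (\<Sum>q\<in>G - \<tau>. if q = g then v \<tau> else 0)"
        unfolding boundary_def using sub False g
        by (auto simp: cone_def face_sign_square mult.assoc[symmetric] intro!: sum.cong)
      then show ?thesis using False g finG by simp
    next
      case True
      let ?\<rho> = "\<tau> - {g}"
      have \<rho>: "insert g ?\<rho> = \<tau>" using True by auto
      have "0 = boundary v ?\<rho>" by (simp add: cyc)
      also have "\<dots> = (\<Sum>q\<in>insert g (G - \<tau>). face_sign q (insert q ?\<rho>) * v (insert q ?\<rho>))"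
      proof -
        have "G - ?\<rho> = insert g (G - \<tau>)" using g by auto
        then show ?thesis using sub by (auto simp: boundary_def)
      qed
      also have "\<dots> = face_sign g \<tau> * v \<tau> + (\<Sum>q\<in>G - \<tau>. face_sign q (insert q ?\<rho>) * v (insert q ?\<rho>))"
        using finG True \<rho> by simp
      finally have "face_sign g \<tau> * v \<tau>
          = - (\<Sum>q\<in>G - \<tau>. face_sign q (insert q ?\<rho>) * v (insert q ?\<rho>))"
        unfolding eq_neg_iff_add_eq_0 by (rule sym)
      then have "face_sign g \<tau> * (face_sign g \<tau> * v \<tau>)
          = - face_sign g \<tau> * (\<Sum>q\<in>G - \<tau>. face_sign q (insert q ?\<rho>) * v (insert q ?\<rho>))"
        by simp
      then have "v \<tau> = (\<Sum>q\<in>G - \<tau>. - face_sign g \<tau> * (face_sign q (insert q ?\<rho>) * v (insert q ?\<rho>)))"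
        by (simp add: sum_distrib_left face_sign_square mult.assoc[symmetric])
      also have "\<dots> = (\<Sum>q\<in>G - \<tau>. face_sign q (insert q \<tau>) * cone g v (insert q \<tau>))"
      proof (rule sum.cong)
        fix q assume q: "q \<in> G - \<tau>"
        let ?\<sigma> = "insert q \<tau>"
        have "face_sign g ?\<sigma> * face_sign q (?\<sigma> - {g}) = - (face_sign q ?\<sigma> * face_sign g (?\<sigma> - {q}))"
          by (rule face_sign_swap) (use q True sub in auto)
        moreover have e: "?\<sigma> - {g} = insert q ?\<rho>" "?\<sigma> - {q} = \<tau>" using q True by auto
        ultimately have s: "face_sign g ?\<sigma> * face_sign q (insert q ?\<rho>) = - (face_sign q ?\<sigma> * face_sign g \<tau>)" by simp
        have c: "face_sign q ?\<sigma> * (face_sign g ?\<sigma> * face_sign q (insert q ?\<rho>)) = - face_sign g \<tau>"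
          unfolding s by (simp add: face_sign_square mult.assoc[symmetric])
        have "face_sign q ?\<sigma> * face_sign g ?\<sigma> * (face_sign q (insert q ?\<rho>) * face_sign q (insert q ?\<rho>))
            = face_sign q ?\<sigma> * (face_sign g ?\<sigma> * face_sign q (insert q ?\<rho>)) * face_sign q (insert q ?\<rho>)"
          by (simp only: mult.assoc)
        then have "face_sign q ?\<sigma> * face_sign g ?\<sigma> = - face_sign g \<tau> * face_sign q (insert q ?\<rho>)"
          unfolding c face_sign_square by simp
        then show "- face_sign g \<tau> * (face_sign q (insert q ?\<rho>) * v (insert q ?\<rho>)) = face_sign q ?\<sigma> * cone g v ?\<sigma>"
          using q True sub by (simp add: cone_def e(1) mult.assoc[symmetric])
      qed simp
      finally show ?thesis using sub by (simp add: boundary_def)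
    qed
  qed
qed

definition taylor_cycle :: "nat \<Rightarrow> 'v monomial \<Rightarrow> ('v monomial set \<Rightarrow> 'k) \<Rightarrow> bool" where
  "taylor_cycle r c v = (if r = 0 then c \<in> multiples G \<or> v {} = 0 else boundary v = (\<lambda>_. 0))"

text \<open>If some generator \<open>g\<close> divides \<open>x\<^sup>c\<close>, the simplex on the generators dividing \<open>x\<^sup>c\<close> is a cone with apex \<open>g\<close> and
  is acyclic.  Otherwise the empty set is the only subset in this multidegree and maps isomorphically to \<open>R/I\<close>.\<close>

lemma taylor_exact:
  assumes v: "v \<in> chains r c"
  shows "taylor_cycle r c v \<longleftrightarrow> (\<exists>u\<in>chains (Suc r) c. v = boundary u)"
proof
  assume cyc: "taylor_cycle r c v"
  show "\<exists>u\<in>chains (Suc r) c. v = boundary u"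
  proof (cases "c \<in> multiples G")
    case True
    then obtain g where g: "g \<in> G" "g \<le> c" by (auto simp: multiples_def)
    have "boundary v = (\<lambda>_. 0)"
      using cyc v boundary_chains_0 by (cases "r = 0") (auto simp: taylor_cycle_def)
    then have "boundary (cone g v) = v" using boundary_cone[OF _ g(1)] chainsD[OF v] by blast
    with cone_chains[OF v g] show ?thesis by metis
  next
    case False
    have "v \<sigma> = 0" for \<sigma>
    proof (rule ccontr)
      assume nz: "v \<sigma> \<noteq> 0"
      with chainsD[OF v nz] have \<sigma>: "\<sigma> \<subseteq> G" "card \<sigma> = r" "mlcm \<sigma> \<le> c" by auto
      then have "\<sigma> = {}"
        using False finite_cell[OF \<sigma>(1)] by (auto simp: mlcm_le_iff multiples_def)
      with \<sigma>(2) cyc nz False show False by (auto simp: taylor_cycle_def)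
    qed
    then have "v = boundary (\<lambda>_. 0)" by auto
    then show ?thesis using zero_chains by blast
  qed
next
  assume "\<exists>u\<in>chains (Suc r) c. v = boundary u"
  then obtain u where u: "u \<in> chains (Suc r) c" "v = boundary u" by blast
  show "taylor_cycle r c v"
  proof (cases "r = 0 \<and> c \<notin> multiples G")
    case True
    have "v {} = 0"
    proof (rule ccontr)
      assume "v {} \<noteq> 0"
      then obtain q where q: "q \<in> G" "u {q} \<noteq> 0"
        using u(2) boundary_nonzeroD[of u "{}"] by metis
      with chainsD[OF u(1) q(2)] True show False
        by (auto simp: mlcm_le_iff multiples_def)
    qed
    with True show ?thesis by (simp add: taylor_cycle_def)
  qed (auto simp: taylor_cycle_def u(2) boundary_bd)
qed

end

section \<open>Morse reduction of the Taylor complex\<close>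

locale morse = taylor G num ty
  for G :: "'v monomial set" and num :: "'v monomial \<Rightarrow> nat" and ty :: "'k::field itself" +
  fixes A :: "('v monomial set \<times> 'v monomial set) set"
  assumes matching: "lcm_homogeneous_acyclic_matching G A"
begin

lemma finite_targets: "finite (snd ` A)"
proof -
  have "A \<subseteq> Pow G \<times> Pow G"
    using matching by (auto simp: lcm_homogeneous_acyclic_matching_def subset_edges_def)
  then have "finite A" by (rule finite_subset) (simp add: finG)
  then show ?thesis by simp
qed

text \<open>Reachability by at least one step in the graph \<open>G\<^sup>A\<close> of subsets.  As this graph is finite and acyclic, this relation and its converse admit
  induction.\<close>

definition flow :: "('v monomial set \<times> 'v monomial set) set" where
  "flow = ((subset_edges G - A) \<union> A\<inverse>)\<^sup>+"

lemma matching_facts: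
  shows "A \<subseteq> subset_edges G"
    and "\<lbrakk>e \<in> A; e' \<in> A; {fst e, snd e} \<inter> {fst e', snd e'} \<noteq> {}\<rbrakk> \<Longrightarrow> e = e'"
    and "(\<sigma>, \<tau>) \<in> A \<Longrightarrow> mlcm \<sigma> = mlcm \<tau>"
  using matching unfolding lcm_homogeneous_acyclic_matching_def by blast+

lemma subset_edgeE:
  assumes "(\<sigma>, \<tau>) \<in> subset_edges G"
  obtains q where "q \<in> G" "q \<notin> \<tau>" "\<sigma> = insert q \<tau>" "\<tau> \<subseteq> G"
proof -
  from assms have *: "\<sigma> \<subseteq> G" "\<tau> \<subseteq> \<sigma>" "card \<sigma> = card \<tau> + 1" by (auto simp: subset_edges_def)
  then have "finite \<sigma>" "finite \<tau>" using finite_cell by blast+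
  then have "card (\<sigma> - \<tau>) = 1" using * by (simp add: card_Diff_subset)
  then obtain q where "\<sigma> - \<tau> = {q}" by (auto simp: card_1_singleton_iff)
  with * that[of q] show ?thesis by blast
qed

lemma insert_subset_edge:
  "\<tau> \<subseteq> G \<Longrightarrow> q \<in> G \<Longrightarrow> q \<notin> \<tau> \<Longrightarrow> (insert q \<tau>, \<tau>) \<in> subset_edges G"
  using finite_cell by (auto simp: subset_edges_def)

lemma wf_flow: "wf flow" "wf (flow\<inverse>)"
proof -
  let ?R = "(subset_edges G - A) \<union> A\<inverse>"
  have "?R \<subseteq> Pow G \<times> Pow G"
    using matching_facts(1) by (auto simp: subset_edges_def)
  then have fin: "finite ?R" by (rule finite_subset) (simp add: finG)
  have acyc: "acyclic ?R"
    using matching by (simp add: lcm_homogeneous_acyclic_matching_def)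
  show "wf flow"
    unfolding flow_def by (rule wf_trancl[OF finite_acyclic_wf[OF fin acyc]])
  show "wf (flow\<inverse>)"
    unfolding flow_def trancl_converse[symmetric]
    by (rule wf_trancl[OF finite_acyclic_wf_converse[OF fin acyc]])
qed

lemma flow_step:
  assumes "(\<sigma>, \<tau>) \<in> A" "(\<sigma>, \<tau>') \<in> subset_edges G" "\<tau>' \<noteq> \<tau>"
  shows "(\<tau>, \<tau>') \<in> flow"
proof -
  have "(\<sigma>, \<tau>') \<notin> A" using matching_facts(2)[OF assms(1), of "(\<sigma>, \<tau>')"] assms(3) by auto
  with assms have "(\<tau>, \<sigma>) \<in> (subset_edges G - A) \<union> A\<inverse>" "(\<sigma>, \<tau>') \<in> (subset_edges G - A) \<union> A\<inverse>"
    by auto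
  then show ?thesis unfolding flow_def by (meson trancl.intros)
qed

lemma flow_step':
  assumes "(\<sigma>, \<tau>) \<in> A" "(\<sigma>', \<tau>) \<in> subset_edges G" "\<sigma>' \<noteq> \<sigma>"
  shows "(\<sigma>', \<sigma>) \<in> flow"
proof -
  have "(\<sigma>', \<tau>) \<notin> A" using matching_facts(2)[OF assms(1), of "(\<sigma>', \<tau>)"] assms(3) by auto
  with assms have "(\<tau>, \<sigma>) \<in> (subset_edges G - A) \<union> A\<inverse>" "(\<sigma>', \<tau>) \<in> (subset_edges G - A) \<union> A\<inverse>"
    by auto
  then show ?thesis unfolding flow_def by (meson trancl.intros)
qed

lemma boundary_match:
  assumes "(\<sigma>, \<tau>) \<in> A" and "\<And>\<sigma>'. (\<sigma>', \<tau>) \<in> subset_edges G \<Longrightarrow> \<sigma>' \<noteq> \<sigma> \<Longrightarrow> v \<sigma>' = 0"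
  obtains q where "boundary v \<tau> = face_sign q \<sigma> * v \<sigma>"
proof -
  obtain q where q: "q \<in> G" "q \<notin> \<tau>" "\<sigma> = insert q \<tau>" "\<tau> \<subseteq> G"
    using subset_edgeE assms(1) matching_facts(1) by (metis subsetD)
  have "face_sign p (insert p \<tau>) * v (insert p \<tau>) = (if p = q then face_sign q \<sigma> * v \<sigma> else 0)" if "p \<in> G - \<tau>" for p
  proof (cases "p = q")
    case False
    then have "insert p \<tau> \<noteq> \<sigma>" using that q by auto
    with assms(2)[OF insert_subset_edge[OF q(4)]] that False show ?thesis by simp
  qed (simp add: q(3))
  then have "boundary v \<tau> = (\<Sum>p\<in>G - \<tau>. if p = q then face_sign q \<sigma> * v \<sigma> else 0)"
    using q(4) by (simp add: boundary_def)
  then have "boundary v \<tau> = face_sign q \<sigma> * v \<sigma>" using q finG by simp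
  then show ?thesis using that by blast
qed

text \<open>The part of the boundary that leads from sources to targets of the matching is triangular with respect to the
  flow, with signs on the diagonal.  Concretely, for a source \<open>\<sigma>\<close> that is minimal in the support of \<open>w\<close>, the coefficient of
  \<open>\<partial>w\<close> at the partner of \<open>\<sigma>\<close> comes from \<open>\<sigma>\<close> alone.\<close>

lemma matched_boundary_injective:
  assumes supp: "\<And>\<sigma>. w \<sigma> \<noteq> 0 \<Longrightarrow> \<sigma> \<in> fst ` A"
    and zero: "\<And>\<tau>. \<tau> \<in> snd ` A \<Longrightarrow> boundary w \<tau> = 0"
  shows "w = (\<lambda>_. 0)"
proof (rule ccontr)
  assume "w \<noteq> (\<lambda>_. 0)"
  then obtain \<rho> where "w \<rho> \<noteq> 0" by auto
  then obtain \<sigma> where \<sigma>: "w \<sigma> \<noteq> 0" "\<And>\<sigma>'. (\<sigma>', \<sigma>) \<in> flow \<Longrightarrow> w \<sigma>' = 0"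
    using wfE_min[OF wf_flow(1), of \<rho> "{\<sigma>. w \<sigma> \<noteq> 0}"] by auto
  from supp[OF \<sigma>(1)] obtain \<tau> where \<tau>: "(\<sigma>, \<tau>) \<in> A" by auto
  obtain q where "boundary w \<tau> = face_sign q \<sigma> * w \<sigma>"
    using boundary_match[OF \<tau>, of w] flow_step'[OF \<tau>] \<sigma>(2) by blast
  moreover have "boundary w \<tau> = 0" using zero \<tau> by force
  ultimately have "face_sign q \<sigma> * (face_sign q \<sigma> * w \<sigma>) = 0" by simp
  then show False using \<sigma>(1) by (simp add: mult.assoc[symmetric] face_sign_square)
qed

definition delta :: "'v monomial set \<Rightarrow> 'v monomial set \<Rightarrow> 'k" where
  "delta \<sigma> \<rho> = (if \<rho> = \<sigma> then 1 else 0)"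

lemma delta_chains: "\<sigma> \<subseteq> G \<Longrightarrow> delta \<sigma> \<in> chains (card \<sigma>) (mlcm \<sigma>)"
  by (simp add: delta_def chains_def)

text \<open>The inverse of the triangular matrix above, column by column.\<close>

definition is_preimage :: "'v monomial set \<Rightarrow> ('v monomial set \<Rightarrow> 'k) \<Rightarrow> bool" where
  "is_preimage \<tau> w \<longleftrightarrow> w \<in> chains (Suc (card \<tau>)) (mlcm \<tau>) \<and> (\<forall>\<sigma>. w \<sigma> \<noteq> 0 \<longrightarrow> \<sigma> \<in> fst ` A) \<and>
    (\<forall>\<tau>'\<in>snd ` A. boundary w \<tau>' = (if \<tau>' = \<tau> then 1 else 0))"

definition preimage :: "'v monomial set \<Rightarrow> 'v monomial set \<Rightarrow> 'k" where
  "preimage \<tau> = (SOME w. is_preimage \<tau> w)"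

text \<open>Start with the partner \<open>\<sigma>\<close> of \<open>\<tau>\<close>; its boundary meets the targets in \<open>\<tau>\<close> and in sets further down
  the flow, which are cancelled by induction.  The lcm does not grow on the way, so the multidegree is kept.\<close>

lemma matched_boundary_surjective_basis:
  assumes "\<tau> \<in> snd ` A"
  shows "\<exists>w. is_preimage \<tau> w"
  using assms
proof (induction \<tau> rule: wf_induct_rule[OF wf_flow(2)])
  case (1 \<tau>)
  from 1(2) obtain \<sigma> where \<sigma>: "(\<sigma>, \<tau>) \<in> A" by auto
  obtain q where q: "q \<in> G" "q \<notin> \<tau>" "\<sigma> = insert q \<tau>" "\<tau> \<subseteq> G"
    using subset_edgeE \<sigma> matching_facts(1) by (metis subsetD)
  have \<sigma>G: "\<sigma> \<subseteq> G" and card\<sigma>: "card \<sigma> = Suc (card \<tau>)" and lcm\<sigma>: "mlcm \<sigma> = mlcm \<tau>"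
    using q finite_cell[OF q(4)] matching_facts(3)[OF \<sigma>] by auto
  define X where "X = {\<tau>' \<in> snd ` A. \<tau>' \<noteq> \<tau> \<and> boundary (delta \<sigma>) \<tau>' \<noteq> 0}"
  have X: "(\<sigma>, \<tau>') \<in> subset_edges G" if nz: "boundary (delta \<sigma>) \<tau>' \<noteq> 0" for \<tau>'
  proof -
    obtain p where "\<tau>' \<subseteq> G" "p \<in> G" "p \<notin> \<tau>'" "delta \<sigma> (insert p \<tau>') \<noteq> 0"
      using boundary_nonzeroD[OF nz] by blast
    then show ?thesis using insert_subset_edge[of \<tau>' p] by (auto simp: delta_def split: if_splits)
  qed
  define W where "W = preimage"
  have pre: "is_preimage \<tau>' (W \<tau>') \<and> W \<tau>' \<in> chains (Suc (card \<tau>)) (mlcm \<tau>)" if "\<tau>' \<in> X" for \<tau>'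
  proof -
    from that have \<tau>': "\<tau>' \<in> snd ` A" "\<tau>' \<noteq> \<tau>" "(\<sigma>, \<tau>') \<in> subset_edges G"
      using X by (auto simp: X_def)
    have "(\<tau>, \<tau>') \<in> flow" using flow_step[OF \<sigma> \<tau>'(3,2)] .
    then have w: "is_preimage \<tau>' (W \<tau>')"
      unfolding W_def preimage_def using 1(1)[of \<tau>'] \<tau>'(1) by (metis (full_types) someI_ex converseI)
    have cards: "card \<tau>' = card \<tau>" and "\<tau>' \<subseteq> \<sigma>" using \<tau>'(3) card\<sigma> by (auto simp: subset_edges_def)
    have "mlcm \<tau>' \<le> mlcm \<tau>"
      using mlcm_mono[OF finite_cell[OF \<sigma>G] \<open>\<tau>' \<subseteq> \<sigma>\<close>] lcm\<sigma> by simp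
    from chains_mono[OF _ this] w have "W \<tau>' \<in> chains (Suc (card \<tau>)) (mlcm \<tau>)"
      by (metis cards is_preimage_def)
    with w show ?thesis by blast
  qed
  have W: "\<And>\<tau>'. \<tau>' \<in> X \<Longrightarrow> W \<tau>' \<in> chains (Suc (card \<tau>)) (mlcm \<tau>)"
    "\<And>\<tau>' \<sigma>. \<tau>' \<in> X \<Longrightarrow> W \<tau>' \<sigma> \<noteq> 0 \<Longrightarrow> \<sigma> \<in> fst ` A"
    "\<And>\<tau>' \<tau>''. \<tau>' \<in> X \<Longrightarrow> \<tau>'' \<in> snd ` A \<Longrightarrow> boundary (W \<tau>') \<tau>'' = (if \<tau>'' = \<tau>' then 1 else 0)"
    using pre unfolding is_preimage_def by blast+
  have finX: "finite X"
    by (rule finite_subset[OF _ finite_targets]) (auto simp: X_def)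
  \<comment> \<open>The coefficient of \<open>\<partial>\<sigma>\<close> at \<open>\<tau>\<close> is a sign and therefore its own inverse.\<close>
  obtain p where p: "boundary (delta \<sigma>) \<tau> = face_sign p \<sigma> * delta \<sigma> \<sigma>"
    by (rule boundary_match[OF \<sigma>, of "delta \<sigma>"]) (auto simp: delta_def)
  have \<delta>\<sigma>: "delta \<sigma> \<sigma> = 1" by (simp add: delta_def)
  define y where "y = (\<lambda>\<rho>. delta \<sigma> \<rho> - (\<Sum>\<tau>'\<in>X. boundary (delta \<sigma>) \<tau>' * W \<tau>' \<rho>))"
  have y_chain: "y \<in> chains (Suc (card \<tau>)) (mlcm \<tau>)"
    unfolding y_def
    using delta_chains[OF \<sigma>G] card\<sigma> lcm\<sigma> W(1) by (intro chains_diff chains_sum) auto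
  have y_supp: "\<rho> \<in> fst ` A" if "y \<rho> \<noteq> 0" for \<rho>
  proof (cases "\<rho> = \<sigma>")
    case True
    then show ?thesis using \<sigma> by force
  next
    case False
    with that have "(\<Sum>\<tau>'\<in>X. boundary (delta \<sigma>) \<tau>' * W \<tau>' \<rho>) \<noteq> 0" by (simp add: y_def delta_def)
    then obtain \<tau>' where "\<tau>' \<in> X" "boundary (delta \<sigma>) \<tau>' * W \<tau>' \<rho> \<noteq> 0" by (meson sum.neutral)
    then have "W \<tau>' \<rho> \<noteq> 0" by simp
    with W(2) \<open>\<tau>' \<in> X\<close> show ?thesis by blast
  qed
  have y_bd: "boundary y \<rho> = (if \<rho> = \<tau> then face_sign p \<sigma> else 0)" if \<rho>: "\<rho> \<in> snd ` A" for \<rho>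
  proof -
    have "boundary y \<rho> = boundary (delta \<sigma>) \<rho> - (\<Sum>\<tau>'\<in>X. boundary (delta \<sigma>) \<tau>' * boundary (W \<tau>') \<rho>)"
      by (simp add: y_def boundary_diff boundary_sum)
    also have "(\<Sum>\<tau>'\<in>X. boundary (delta \<sigma>) \<tau>' * boundary (W \<tau>') \<rho>)
        = (\<Sum>\<tau>'\<in>X. if \<rho> = \<tau>' then boundary (delta \<sigma>) \<rho> else 0)"
      using W(3)[OF _ \<rho>] by (intro sum.cong) auto
    also have "\<dots> = (if \<rho> \<in> X then boundary (delta \<sigma>) \<rho> else 0)" using finX by simp
    finally show ?thesis using \<rho> p \<delta>\<sigma> by (simp add: X_def split: if_splits)
  qed
  let ?w = "\<lambda>\<rho>. face_sign p \<sigma> * y \<rho>"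
  have scale: "?w = (\<lambda>\<rho>. \<Sum>i\<in>{()}. face_sign p \<sigma> * y \<rho>)" by simp
  have "?w \<in> chains (Suc (card \<tau>)) (mlcm \<tau>)"
    unfolding scale by (rule chains_sum) (rule y_chain)
  moreover have "boundary ?w = (\<lambda>\<rho>. face_sign p \<sigma> * boundary y \<rho>)"
    unfolding scale boundary_sum by simp
  ultimately show ?case
    using y_supp y_bd by (intro exI[of _ ?w]) (auto simp: is_preimage_def face_sign_square)
qed

lemma is_preimage_preimage:
  assumes "\<tau> \<in> snd ` A" shows "is_preimage \<tau> (preimage \<tau>)"
  unfolding preimage_def by (rule someI_ex[OF matched_boundary_surjective_basis[OF assms]])

lemma matched_boundary_surjective:
  assumes y: "y \<in> chains r c"
  obtains w where "w \<in> chains (Suc r) c" "\<And>\<sigma>. w \<sigma> \<noteq> 0 \<Longrightarrow> \<sigma> \<in> fst ` A"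
    "\<And>\<tau>. \<tau> \<in> snd ` A \<Longrightarrow> boundary w \<tau> = y \<tau>"
proof -
  define W where "W = preimage"
  have W: "\<And>\<tau>. \<tau> \<in> snd ` A \<Longrightarrow> W \<tau> \<in> chains (Suc (card \<tau>)) (mlcm \<tau>)"
    "\<And>\<tau> \<sigma>. \<tau> \<in> snd ` A \<Longrightarrow> W \<tau> \<sigma> \<noteq> 0 \<Longrightarrow> \<sigma> \<in> fst ` A"
    "\<And>\<tau> \<tau>'. \<tau> \<in> snd ` A \<Longrightarrow> \<tau>' \<in> snd ` A \<Longrightarrow> boundary (W \<tau>) \<tau>' = (if \<tau>' = \<tau> then 1 else 0)"
    using is_preimage_preimage unfolding W_def is_preimage_def by blast+
  define w where "w = (\<lambda>\<sigma>. \<Sum>\<tau>\<in>snd ` A. y \<tau> * W \<tau> \<sigma>)"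
  show ?thesis
  proof
    show "w \<in> chains (Suc r) c"
      unfolding w_def
    proof (rule chains_sum)
      fix \<tau> assume \<tau>: "\<tau> \<in> snd ` A" "y \<tau> \<noteq> 0"
      from chainsD[OF y \<tau>(2)] have "card \<tau> = r" "mlcm \<tau> \<le> c" by auto
      with chains_mono[OF W(1)[OF \<tau>(1)], of c] show "W \<tau> \<in> chains (Suc r) c" by simp
    qed
    show "\<sigma> \<in> fst ` A" if nz: "w \<sigma> \<noteq> 0" for \<sigma>
    proof -
      obtain \<tau> where "\<tau> \<in> snd ` A" "y \<tau> * W \<tau> \<sigma> \<noteq> 0"
        using sum.not_neutral_contains_not_neutral[OF nz[unfolded w_def]] by blast
      then have "W \<tau> \<sigma> \<noteq> 0" by simp
      with W(2) \<open>\<tau> \<in> snd ` A\<close> show ?thesis by blast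
    qed
    fix \<tau> assume \<tau>: "\<tau> \<in> snd ` A"
    have "boundary w \<tau> = (\<Sum>\<tau>'\<in>snd ` A. y \<tau>' * boundary (W \<tau>') \<tau>)" by (simp add: w_def boundary_sum)
    also have "\<dots> = (\<Sum>\<tau>'\<in>snd ` A. if \<tau> = \<tau>' then y \<tau> else 0)"
      using W(3)[OF _ \<tau>] by (intro sum.cong) auto
    also have "\<dots> = y \<tau>" using finite_targets \<tau> by simp
    finally show "boundary w \<tau> = y \<tau>" .
  qed
qed

text \<open>Chains supported on the sources and critical sets whose boundary is supported there too.  They form a subcomplex, and by
  the triangularity above they have exactly one basis element for each critical set.\<close>

definition reduced :: "nat \<Rightarrow> 'v monomial \<Rightarrow> ('v monomial set \<Rightarrow> 'k) set" where
  "reduced r c = {v \<in> chains r c. \<forall>\<tau>\<in>snd ` A. v \<tau> = 0 \<and> boundary v \<tau> = 0}"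

lemma reducedD:
  assumes "v \<in> reduced r c" "\<tau> \<in> snd ` A" shows "v \<tau> = 0" "boundary v \<tau> = 0"
  using assms by (auto simp: reduced_def)

lemma reduced_sum:
  assumes "\<And>i. i \<in> I \<Longrightarrow> a i \<noteq> 0 \<Longrightarrow> f i \<in> reduced r c"
  shows "(\<lambda>\<sigma>. \<Sum>i\<in>I. a i * f i \<sigma>) \<in> reduced r c"
proof -
  have "(\<lambda>\<sigma>. \<Sum>i\<in>I. a i * f i \<sigma>) \<in> chains r c"
    using assms by (intro chains_sum) (simp add: reduced_def)
  moreover have "a i * f i \<tau> = 0 \<and> a i * boundary (f i) \<tau> = 0" if "i \<in> I" "\<tau> \<in> snd ` A" for i \<tau>
    using assms[OF that(1)] that(2) by (cases "a i = 0") (auto simp: reduced_def)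
  ultimately show ?thesis by (auto simp: reduced_def boundary_sum)
qed

lemma reduced_mono: "v \<in> reduced r b \<Longrightarrow> b \<le> c \<Longrightarrow> v \<in> reduced r c"
  using chains_mono by (auto simp: reduced_def)

lemma boundary_reduced: "v \<in> reduced (Suc r) c \<Longrightarrow> boundary v \<in> reduced r c"
  using boundary_chains by (auto simp: reduced_def boundary_bd)

lemma critical_iff: "critical G A \<sigma> \<longleftrightarrow> \<sigma> \<subseteq> G \<and> \<sigma> \<notin> fst ` A \<and> \<sigma> \<notin> snd ` A"
  by (auto simp: critical_def)

text \<open>The difference of two such chains is supported on sources and has no boundary at targets.\<close>

lemma reduced_eqI:
  assumes v: "v \<in> reduced r c" and w: "w \<in> reduced r c"
    and eq: "\<And>\<kappa>. critical G A \<kappa> \<Longrightarrow> card \<kappa> = r \<Longrightarrow> v \<kappa> = w \<kappa>"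
  shows "v = w"
proof -
  have "(\<lambda>\<sigma>. v \<sigma> - w \<sigma>) = (\<lambda>_. 0)"
  proof (rule matched_boundary_injective)
    fix \<sigma> assume nz: "v \<sigma> - w \<sigma> \<noteq> 0"
    then have "\<sigma> \<subseteq> G \<and> card \<sigma> = r"
      using v w chainsD[of v r c \<sigma>] chainsD[of w r c \<sigma>] by (cases "v \<sigma> = 0") (auto simp: reduced_def)
    moreover have "\<sigma> \<notin> snd ` A" using nz reducedD(1)[OF v, of \<sigma>] reducedD(1)[OF w, of \<sigma>] by (metis diff_self)
    ultimately show "\<sigma> \<in> fst ` A" using eq[of \<sigma>] nz by (auto simp: critical_iff)
  next
    fix \<tau> assume "\<tau> \<in> snd ` A"
    then show "boundary (\<lambda>\<sigma>. v \<sigma> - w \<sigma>) \<tau> = 0"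
      unfolding boundary_diff using reducedD(2)[OF v] reducedD(2)[OF w] by (metis diff_self)
  qed
  then show ?thesis by (auto simp: fun_eq_iff)
qed

text \<open>A critical set is corrected by a combination of sources that cancels the targets in its boundary.\<close>

lemma critical_lift_exists:
  assumes \<kappa>: "critical G A \<kappa>"
  shows "\<exists>v\<in>reduced (card \<kappa>) (mlcm \<kappa>). \<forall>\<kappa>'. critical G A \<kappa>' \<longrightarrow> v \<kappa>' = (if \<kappa>' = \<kappa> then 1 else 0)"
proof -
  have \<kappa>G: "\<kappa> \<subseteq> G" and U: "\<kappa> \<notin> snd ` A" using \<kappa> by (auto simp: critical_iff)
  note \<delta> = delta_chains[OF \<kappa>G]
  obtain w where w: "w \<in> chains (card \<kappa>) (mlcm \<kappa>)" "\<And>\<sigma>. w \<sigma> \<noteq> 0 \<Longrightarrow> \<sigma> \<in> fst ` A"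
    "\<And>\<tau>. \<tau> \<in> snd ` A \<Longrightarrow> boundary w \<tau> = boundary (delta \<kappa>) \<tau>"
  proof (cases "card \<kappa>")
    case 0
    then have "boundary (delta \<kappa>) = (\<lambda>_. 0)" using \<delta> boundary_chains_0 by metis
    with that[of "\<lambda>_. 0"] show ?thesis by simp
  next
    case (Suc r)
    then have "boundary (delta \<kappa>) \<in> chains r (mlcm \<kappa>)" using \<delta> boundary_chains by simp
    from matched_boundary_surjective[OF this] that Suc show ?thesis by metis
  qed
  let ?v = "\<lambda>\<sigma>. delta \<kappa> \<sigma> - w \<sigma>"
  have "w \<tau> = 0" if \<tau>: "\<tau> \<in> snd ` A" for \<tau>
  proof (rule ccontr)
    assume "w \<tau> \<noteq> 0"
    with w(2) obtain \<rho> where "(\<tau>, \<rho>) \<in> A" by force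
    moreover obtain \<sigma> where "(\<sigma>, \<tau>) \<in> A" using \<tau> by auto
    ultimately have "(\<tau>, \<rho>) = (\<sigma>, \<tau>)" using matching_facts(2)[of "(\<tau>, \<rho>)" "(\<sigma>, \<tau>)"] by simp
    with \<open>(\<tau>, \<rho>) \<in> A\<close> matching_facts(1) show False by (auto simp: subset_edges_def)
  qed
  moreover have "delta \<kappa> \<tau> = 0" if "\<tau> \<in> snd ` A" for \<tau> using U that by (auto simp: delta_def)
  ultimately have z: "delta \<kappa> \<tau> - w \<tau> = 0 \<and> boundary (delta \<kappa>) \<tau> - boundary w \<tau> = 0" if "\<tau> \<in> snd ` A" for \<tau>
    using that w(3) by (metis diff_self)
  have v1: "?v \<in> reduced (card \<kappa>) (mlcm \<kappa>)"
    unfolding reduced_def boundary_diff mem_Collect_eq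
    by (rule conjI[OF chains_diff[OF \<delta> w(1)] ballI[OF z]])
  have v2: "?v \<kappa>' = (if \<kappa>' = \<kappa> then 1 else 0)" if "critical G A \<kappa>'" for \<kappa>'
  proof -
    have "w \<kappa>' = 0" using that w(2) critical_iff by blast
    then show ?thesis by (simp add: delta_def)
  qed
  show ?thesis by (rule bexI[OF _ v1]) (intro allI impI v2)
qed

text \<open>A preimage in the Taylor complex can be moved into the reduced complex by subtracting a boundary that
  agrees with it on the targets.\<close>

lemma reduced_exact:
  assumes v: "v \<in> reduced r c"
  shows "taylor_cycle r c v \<longleftrightarrow> (\<exists>u\<in>reduced (Suc r) c. v = boundary u)"
proof
  have vc: "v \<in> chains r c" using v by (simp add: reduced_def)
  assume "taylor_cycle r c v"
  then obtain u where u: "u \<in> chains (Suc r) c" "v = boundary u"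
    using taylor_exact[OF vc] by blast
  obtain w where w: "w \<in> chains (Suc (Suc r)) c" "\<And>\<tau>. \<tau> \<in> snd ` A \<Longrightarrow> boundary w \<tau> = u \<tau>"
    using matched_boundary_surjective[OF u(1)] by metis
  let ?u = "\<lambda>\<sigma>. u \<sigma> - boundary w \<sigma>"
  have boundary_u: "boundary ?u = v" by (simp add: boundary_diff boundary_bd u(2))
  have "?u \<in> reduced (Suc r) c"
    using v w chains_diff[OF u(1) boundary_chains[OF w(1)]] by (simp add: reduced_def boundary_u)
  with boundary_u show "\<exists>u\<in>reduced (Suc r) c. v = boundary u" by metis
next
  have vc: "v \<in> chains r c" using v by (simp add: reduced_def)
  assume "\<exists>u\<in>reduced (Suc r) c. v = boundary u"
  then show "taylor_cycle r c v" using taylor_exact[OF vc] by (auto simp: reduced_def)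
qed

definition lift :: "'v monomial set \<Rightarrow> 'v monomial set \<Rightarrow> 'k" where
  "lift \<kappa> = (SOME v. v \<in> reduced (card \<kappa>) (mlcm \<kappa>) \<and>
     (\<forall>\<kappa>'. critical G A \<kappa>' \<longrightarrow> v \<kappa>' = (if \<kappa>' = \<kappa> then 1 else 0)))"

lemma lift:
  assumes "critical G A \<kappa>"
  shows "lift \<kappa> \<in> reduced (card \<kappa>) (mlcm \<kappa>)"
    and "critical G A \<kappa>' \<Longrightarrow> lift \<kappa> \<kappa>' = (if \<kappa>' = \<kappa> then 1 else 0)"
proof -
  have "\<exists>v. v \<in> reduced (card \<kappa>) (mlcm \<kappa>) \<and>
     (\<forall>\<kappa>'. critical G A \<kappa>' \<longrightarrow> v \<kappa>' = (if \<kappa>' = \<kappa> then 1 else 0))"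
    using critical_lift_exists[OF assms] by blast
  from someI_ex[OF this] show "lift \<kappa> \<in> reduced (card \<kappa>) (mlcm \<kappa>)"
    "critical G A \<kappa>' \<Longrightarrow> lift \<kappa> \<kappa>' = (if \<kappa>' = \<kappa> then 1 else 0)"
    unfolding lift_def by blast+
qed

definition cells :: "nat \<Rightarrow> 'v monomial set list" where
  "cells r = (SOME xs. distinct xs \<and> set xs = {\<sigma>. critical G A \<sigma> \<and> card \<sigma> = r})"

lemma cells: "distinct (cells r)" "set (cells r) = {\<sigma>. critical G A \<sigma> \<and> card \<sigma> = r}"
proof -
  have "finite {\<sigma>. critical G A \<sigma> \<and> card \<sigma> = r}"
    by (rule finite_subset[of _ "Pow G"]) (auto simp: critical_def finG)
  then have "\<exists>xs. distinct xs \<and> set xs = {\<sigma>. critical G A \<sigma> \<and> card \<sigma> = r}"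
    using finite_distinct_list by blast
  from someI_ex[OF this] show "distinct (cells r)" "set (cells r) = {\<sigma>. critical G A \<sigma> \<and> card \<sigma> = r}"
    unfolding cells_def by blast+
qed

lemma cells_nth: "i < length (cells r) \<Longrightarrow> critical G A (cells r ! i) \<and> card (cells r ! i) = r"
  using cells(2) nth_mem by blast

lemma critical_cellE:
  assumes "critical G A \<kappa>" "card \<kappa> = r"
  obtains i where "i < length (cells r)" "\<kappa> = cells r ! i"
  using assms cells(2)[of r] by (metis (mono_tags, lifting) in_set_conv_nth mem_Collect_eq)

abbreviation shifts :: "nat \<Rightarrow> 'v monomial list" where
  "shifts r \<equiv> map mlcm (cells r)"

definition coeff :: "nat \<Rightarrow> nat \<Rightarrow> nat \<Rightarrow> 'k" where
  "coeff r i j = (if i < length (cells r) \<and> j < length (cells (Suc r))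
     then boundary (lift (cells (Suc r) ! j)) (cells r ! i) else 0)"

definition aug_coeff :: "nat \<Rightarrow> 'k" where
  "aug_coeff j = (if j < length (cells 0) then lift (cells 0 ! j) {} else 0)"

text \<open>The isomorphism from coordinates with respect to the lifted critical sets to reduced chains.\<close>

definition realize :: "nat \<Rightarrow> (nat \<Rightarrow> 'k) \<Rightarrow> 'v monomial set \<Rightarrow> 'k" where
  "realize r u = (\<lambda>\<sigma>. \<Sum>j<length (cells r). u j * lift (cells r ! j) \<sigma>)"

lemma realize_reduced:
  assumes "u \<in> strand (shifts r) c" shows "realize r u \<in> reduced r c"
  unfolding realize_def
proof (rule reduced_sum)
  fix j assume j: "j \<in> {..<length (cells r)}" "u j \<noteq> 0"
  then have "mlcm (cells r ! j) \<le> c" using assms by (auto simp: strand_def)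
  moreover have "lift (cells r ! j) \<in> reduced r (mlcm (cells r ! j))"
    using lift(1)[of "cells r ! j"] cells_nth[of j r] j by simp
  ultimately show "lift (cells r ! j) \<in> reduced r c" by (rule reduced_mono[rotated])
qed

lemma realize_nth:
  assumes i: "i < length (cells r)" shows "realize r u (cells r ! i) = u i"
proof -
  have "realize r u (cells r ! i) = (\<Sum>j<length (cells r). if i = j then u i else 0)"
    unfolding realize_def
  proof (rule sum.cong)
    fix j assume j: "j \<in> {..<length (cells r)}"
    have "cells r ! i = cells r ! j \<longleftrightarrow> i = j"
      using i j cells(1) by (simp add: nth_eq_iff_index_eq)
    with lift(2)[of "cells r ! j" "cells r ! i"] cells_nth[of _ r] i j
    show "u j * lift (cells r ! j) (cells r ! i) = (if i = j then u i else 0)" by auto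
  qed simp
  then show ?thesis using i by simp
qed

lemma reduced_eqI_nth:
  assumes "v \<in> reduced r c" "w \<in> reduced r c"
    and "\<And>i. i < length (cells r) \<Longrightarrow> v (cells r ! i) = w (cells r ! i)"
  shows "v = w"
  using reduced_eqI[OF assms(1,2)] assms(3) critical_cellE by metis

lemma realize_surj:
  assumes v: "v \<in> reduced r c"
  obtains u where "u \<in> strand (shifts r) c" "realize r u = v"
proof -
  define u where "u = (\<lambda>j. if j < length (cells r) then v (cells r ! j) else 0)"
  have u: "u \<in> strand (shifts r) c"
    using v chainsD[of v r c] by (auto simp: u_def strand_def reduced_def)
  moreover have "realize r u = v"
    by (rule reduced_eqI_nth[OF realize_reduced[OF u] v]) (simp add: realize_nth, simp add: u_def)
  ultimately show ?thesis using that by blast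
qed

lemma realize_inj:
  assumes "u \<in> strand (shifts r) c" "u' \<in> strand (shifts r) c" "realize r u = realize r u'"
  shows "u = u'"
proof
  fix i show "u i = u' i"
  proof (cases "i < length (cells r)")
    case True
    then show ?thesis using assms(3) realize_nth by metis
  next
    case False
    then have "u i = 0" "u' i = 0" using assms(1,2) by (auto simp: strand_def)
    then show ?thesis by simp
  qed
qed

lemma compatible_coeff: "compatible (shifts r) (shifts (Suc r)) (coeff r)"
  unfolding compatible_def
proof (intro allI impI)
  fix i j assume nz: "coeff r i j \<noteq> 0"
  then have ij: "i < length (cells r)" "j < length (cells (Suc r))"
    "boundary (lift (cells (Suc r) ! j)) (cells r ! i) \<noteq> 0"
    by (auto simp: coeff_def split: if_splits)
  have "lift (cells (Suc r) ! j) \<in> chains (Suc r) (mlcm (cells (Suc r) ! j))"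
    using lift(1)[of "cells (Suc r) ! j"] cells_nth[OF ij(2)] by (simp add: reduced_def)
  from chainsD[OF boundary_chains[OF this] ij(3)] ij
  show "i < length (shifts r) \<and> j < length (shifts (Suc r)) \<and> shifts r ! i \<le> shifts (Suc r) ! j"
    by simp
qed

lemma realize_coeff:
  assumes u: "u \<in> strand (shifts (Suc r)) c"
  shows "realize r (apply_mat (length (shifts (Suc r))) (coeff r) u) = boundary (realize (Suc r) u)"
proof (rule reduced_eqI_nth)
  show "realize r (apply_mat (length (shifts (Suc r))) (coeff r) u) \<in> reduced r c"
    by (rule realize_reduced[OF apply_mat_strand[OF compatible_coeff u]])
  show "boundary (realize (Suc r) u) \<in> reduced r c"
    by (rule boundary_reduced[OF realize_reduced[OF u]])
  fix i assume i: "i < length (cells r)"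
  have "boundary (realize (Suc r) u) (cells r ! i)
      = (\<Sum>j<length (cells (Suc r)). u j * boundary (lift (cells (Suc r) ! j)) (cells r ! i))"
    by (simp add: realize_def boundary_sum)
  with i show "realize r (apply_mat (length (shifts (Suc r))) (coeff r) u) (cells r ! i)
      = boundary (realize (Suc r) u) (cells r ! i)"
    by (simp add: realize_nth apply_mat_def coeff_def mult.commute)
qed

lemma strand_cycle_realize:
  assumes u: "u \<in> strand (shifts r) c"
  shows "strand_cycle (multiples G) shifts coeff aug_coeff r c u \<longleftrightarrow> taylor_cycle r c (realize r u)"
proof (cases r)
  case 0
  have "augment (length (cells 0)) aug_coeff u = realize 0 u {}"
    by (simp add: augment_def realize_def aug_coeff_def mult.commute)
  then show ?thesis by (simp add: 0 strand_cycle_0 taylor_cycle_def)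
next
  case (Suc s)
  let ?y = "apply_mat (length (shifts (Suc s))) (coeff s) u"
  have u': "u \<in> strand (shifts (Suc s)) c" using u Suc by simp
  have y: "?y \<in> strand (shifts s) c" by (rule apply_mat_strand[OF compatible_coeff u'])
  have "realize s (\<lambda>_. 0) = (\<lambda>_. 0)" by (simp add: realize_def)
  then have "?y = (\<lambda>_. 0) \<longleftrightarrow> boundary (realize (Suc s) u) = (\<lambda>_. 0)"
    using realize_coeff[OF u'] realize_inj[OF y strand_zero] by metis
  then show ?thesis by (simp add: Suc strand_cycle_Suc taylor_cycle_def)
qed

text \<open>A partner of the empty set would be a single generator equal to \<open>1\<close>, and then every monomial would lie
  in the ideal.\<close>

lemma critical_empty:
  assumes "c \<notin> multiples G" shows "critical G A {}"
proof -
  have "{} \<notin> fst ` A" using matching_facts(1) by (auto simp: subset_edges_def)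
  moreover have "{} \<notin> snd ` A"
  proof
    assume "{} \<in> snd ` A"
    then obtain \<sigma> where \<sigma>: "(\<sigma>, {}) \<in> A" by auto
    with subset_edgeE matching_facts(1) obtain q where q: "q \<in> G" "\<sigma> = {q}" by (metis subsetD)
    have "mlcm {q} = (\<lambda>_. 0)" using matching_facts(3)[OF \<sigma>] q by simp
    with le_mlcm[of "{q}" q] have "q \<le> (\<lambda>_. 0)" by simp
    then have "q \<le> c" by (simp add: le_fun_def)
    with q(1) assms show False by (auto simp: multiples_def)
  qed
  ultimately show ?thesis by (simp add: critical_iff)
qed

theorem morse_strand_resolution: "strand_resolution (multiples G) shifts coeff aug_coeff"
  unfolding strand_resolution_def
proof (intro conjI allI impI ballI)
  show "compatible (shifts r) (shifts (Suc r)) (coeff r)" for r by (rule compatible_coeff)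
next
  fix c assume "c \<notin> multiples G"
  then have crit: "critical G A {}" by (rule critical_empty)
  obtain j where j: "j < length (cells 0)" "{} = cells 0 ! j"
    using critical_cellE[OF crit, of 0] by auto
  then have "aug_coeff j = 1" using lift(2)[OF crit crit] by (simp add: aug_coeff_def)
  moreover have "shifts 0 ! j \<le> c" using j by (simp flip: j(2) add: le_fun_def)
  ultimately show "\<exists>j<length (shifts 0). shifts 0 ! j \<le> c \<and> aug_coeff j \<noteq> 0"
    using j by auto
next
  fix r c and u :: "nat \<Rightarrow> 'k" assume u: "u \<in> strand (shifts r) c"
  have "(\<exists>t\<in>strand (shifts (Suc r)) c. u = apply_mat (length (shifts (Suc r))) (coeff r) t) \<longleftrightarrow>
      (\<exists>v\<in>reduced (Suc r) c. realize r u = boundary v)"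
  proof
    assume "\<exists>t\<in>strand (shifts (Suc r)) c. u = apply_mat (length (shifts (Suc r))) (coeff r) t"
    then show "\<exists>v\<in>reduced (Suc r) c. realize r u = boundary v"
      using realize_coeff realize_reduced by metis
  next
    assume "\<exists>v\<in>reduced (Suc r) c. realize r u = boundary v"
    then obtain v where v: "v \<in> reduced (Suc r) c" "realize r u = boundary v" by blast
    obtain t where t: "t \<in> strand (shifts (Suc r)) c" "realize (Suc r) t = v"
      using realize_surj[OF v(1)] by blast
    have "u = apply_mat (length (shifts (Suc r))) (coeff r) t"
      using realize_inj[OF u apply_mat_strand[OF compatible_coeff t(1)]] realize_coeff[OF t(1)] t(2) v(2) by simp
    with t(1) show "\<exists>t\<in>strand (shifts (Suc r)) c. u = apply_mat (length (shifts (Suc r))) (coeff r) t" by blast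
  qed
  then show "strand_cycle (multiples G) shifts coeff aug_coeff r c u \<longleftrightarrow>
      (\<exists>t\<in>strand (shifts (Suc r)) c. u = apply_mat (length (shifts (Suc r))) (coeff r) t)"
    using strand_cycle_realize[OF u] reduced_exact[OF realize_reduced[OF u]] by simp
qed

end

section \<open>Betti numbers from a Batzies-Welker matching\<close>

lemma minimal_resolution_strands:
  fixes \<epsilon> :: "('v, 'k::field) polyring vec"
  assumes "minimal_graded_free_resolution (ideal_gen (mono_poly ` G)) D d \<epsilon>"
  shows "strand_resolution (multiples G) D (\<lambda>r. scalar_entries (D r) (D (Suc r)) (d r)) (aug_entries (D 0) \<epsilon>)"
    and "\<lbrakk>i < length (D r); j < length (D (Suc r)); D r ! i = D (Suc r) ! j\<rbrakk>
      \<Longrightarrow> scalar_entries (D r) (D (Suc r)) (d r) i j = 0"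
proof -
  have res: "graded_free_resolution (ideal_gen (mono_poly ` G)) D d \<epsilon>"
    and min: "\<And>r i j. i < length (D r) \<Longrightarrow> j < length (D (Suc r)) \<Longrightarrow>
      Poly_Mapping.lookup (d r $$ (i, j)) 0 = 0"
    using assms by (auto simp: minimal_graded_free_resolution_def)
  show "strand_resolution (multiples G) D (\<lambda>r. scalar_entries (D r) (D (Suc r)) (d r)) (aug_entries (D 0) \<epsilon>)"
    using res by (simp add: graded_free_resolution_iff_strands)
  assume ij: "i < length (D r)" "j < length (D (Suc r))" "D r ! i = D (Suc r) ! j"
  have "D (Suc r) ! j - D (Suc r) ! j = 0" by (simp add: fun_eq_iff)
  with min[OF ij(1,2)] ij show "scalar_entries (D r) (D (Suc r)) (d r) i j = 0" by (simp add: scalar_entries_def)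
qed

text \<open>Any two minimal resolutions have the same shifts, by the comparison inequality in both
  directions; this makes the description of the Betti number definite.\<close>

lemma betti_eq_count_list:
  assumes min: "minimal_graded_free_resolution (ideal_gen (mono_poly ` G) :: ('v, 'k::field) polyring set) D d \<epsilon>"
  shows "betti (ideal_gen (mono_poly ` G) :: ('v, 'k) polyring set) r a = count_list (D r) a"
  unfolding betti_def
proof (rule the_equality)
  have up: "\<forall>a\<in>multiples G. \<forall>b. a \<le> b \<longrightarrow> b \<in> multiples G"
    using multiples_upward by blast
  fix b assume "\<exists>D d \<epsilon>. minimal_graded_free_resolution
    (ideal_gen (mono_poly ` G) :: ('v, 'k) polyring set) D d \<epsilon> \<and> b = count_list (D r) a"
  then obtain D' d' and \<epsilon>' :: "('v, 'k) polyring vec"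
    where min': "minimal_graded_free_resolution (ideal_gen (mono_poly ` G)) D' d' \<epsilon>'"
      and b: "b = count_list (D' r) a" by blast
  note F = minimal_resolution_strands[OF min] and G = minimal_resolution_strands[OF min']
  have "count_list (D r) a \<le> count_list (D' r) a"
    by (rule count_list_le_of_minimal[OF up F(1) G(1)]) (rule F(2))
  moreover have "count_list (D' r) a \<le> count_list (D r) a"
    by (rule count_list_le_of_minimal[OF up G(1) F(1)]) (rule G(2))
  ultimately show "b = count_list (D r) a" using b by simp
qed (use min in blast)

text \<open>The reduced complex is minimal: a constant entry would join two critical sets with the same lcm but with
  different cardinalities.\<close>

theorem betti_BW_matching:
  fixes G :: "'v monomial set"
  assumes fin: "finite G" and BW: "BW_matching G A"
  shows "betti (ideal_gen (mono_poly ` G) :: ('v, 'k::field) polyring set) r a =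
    card {\<sigma>. critical G A \<sigma> \<and> card \<sigma> = r \<and> mlcm \<sigma> = a}"
proof -
  obtain num :: "'v monomial \<Rightarrow> nat" where "inj_on num G"
    using finite_imp_inj_to_nat_seg[OF fin] by blast
  then interpret morse G num "TYPE('k)" A
    using fin BW by unfold_locales (simp_all add: BW_matching_def)
  define d where "d = (\<lambda>r. mat (length (shifts r)) (length (shifts (Suc r))) (\<lambda>(i, j).
    if shifts r ! i \<le> shifts (Suc r) ! j
    then Poly_Mapping.single (shifts (Suc r) ! j - shifts r ! i) (coeff r i j) else 0))"
  define \<epsilon> where "\<epsilon> = vec (length (shifts 0)) (\<lambda>j. Poly_Mapping.single (shifts 0 ! j) (aug_coeff j))"
  have graded: "graded_matrix (shifts r) (shifts (Suc r)) (d r)" for r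
    by (simp add: graded_matrix_def d_def homogeneous_of_degree_def)
  have "scalar_entries (shifts r) (shifts (Suc r)) (d r) = coeff r" for r
  proof (intro ext)
    fix i j
    show "scalar_entries (shifts r) (shifts (Suc r)) (d r) i j = coeff r i j"
    proof (cases "coeff r i j = 0")
      case False
      with compatible_coeff[of r] have "i < length (shifts r) \<and> j < length (shifts (Suc r)) \<and>
          shifts r ! i \<le> shifts (Suc r) ! j"
        unfolding compatible_def by blast
      then show ?thesis by (auto simp: scalar_entries_def d_def)
    qed (simp add: scalar_entries_def d_def)
  qed
  moreover have "aug_entries (shifts 0) \<epsilon> = aug_coeff"
    by (auto simp: aug_entries_def \<epsilon>_def aug_coeff_def)
  ultimately have "graded_free_resolution (ideal_gen (mono_poly ` G)) shifts d \<epsilon>"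
    using morse_strand_resolution graded
    by (simp add: graded_free_resolution_iff_strands \<epsilon>_def homogeneous_of_degree_def)
  moreover have "Poly_Mapping.lookup (d r $$ (i, j)) 0 = 0"
    if ij: "i < length (shifts r)" "j < length (shifts (Suc r))" for r i j
  proof -
    have i: "critical G A (cells r ! i)" "card (cells r ! i) = r"
      and j: "critical G A (cells (Suc r) ! j)" "card (cells (Suc r) ! j) = Suc r"
      using ij cells_nth by auto
    then have "mlcm (cells r ! i) \<noteq> mlcm (cells (Suc r) ! j)"
      using BW by (fastforce simp: BW_matching_def)
    then have "shifts (Suc r) ! j - shifts r ! i \<noteq> 0" if "shifts r ! i \<le> shifts (Suc r) ! j"
      using monomial_diff_add[OF that] ij by (metis add.right_neutral length_map nth_map)
    then show ?thesis using ij by (auto simp: d_def lookup_single when_def)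
  qed
  ultimately have "minimal_graded_free_resolution (ideal_gen (mono_poly ` G)) shifts d \<epsilon>"
    by (simp add: minimal_graded_free_resolution_def)
  then have "betti (ideal_gen (mono_poly ` G) :: ('v, 'k) polyring set) r a = count_list (shifts r) a"
    by (rule betti_eq_count_list)
  also have "\<dots> = length (filter (\<lambda>\<sigma>. mlcm \<sigma> = a) (cells r))"
    by (simp add: count_list_eq_length_filter filter_map o_def eq_commute)
  also have "\<dots> = card (set (filter (\<lambda>\<sigma>. mlcm \<sigma> = a) (cells r)))"
    by (rule distinct_card[symmetric]) (simp add: cells(1))
  also have "set (filter (\<lambda>\<sigma>. mlcm \<sigma> = a) (cells r)) = {\<sigma>. critical G A \<sigma> \<and> card \<sigma> = r \<and> mlcm \<sigma> = a}"
    using cells(2) by auto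
  finally show ?thesis .
qed

corollary betti_BW_matching_0_1:
  fixes G :: "'v monomial set"
  assumes fin: "finite G" and BW: "BW_matching G A"
  shows "betti (ideal_gen (mono_poly ` G) :: ('v, 'k::field) polyring set) r a =
    (if \<exists>\<sigma>. critical G A \<sigma> \<and> card \<sigma> = r \<and> mlcm \<sigma> = a then 1 else 0)"
proof (cases "\<exists>\<sigma>. critical G A \<sigma> \<and> card \<sigma> = r \<and> mlcm \<sigma> = a")
  case True
  then obtain \<sigma> where \<sigma>: "critical G A \<sigma>" "card \<sigma> = r" "mlcm \<sigma> = a" by blast
  then have "{\<sigma>. critical G A \<sigma> \<and> card \<sigma> = r \<and> mlcm \<sigma> = a} = {\<sigma>}"
    using BW by (auto simp: BW_matching_def)
  with True show ?thesis by (simp add: betti_BW_matching[OF assms])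
next
  case False
  then have "{\<sigma>. critical G A \<sigma> \<and> card \<sigma> = r \<and> mlcm \<sigma> = a} = {}" by blast
  with False show ?thesis
    unfolding betti_BW_matching[OF assms] by (simp only: card.empty if_False)
qed

section \<open>Bridges and gaps in a cycle\<close>

lemma le_mlcm_pointwise:
  assumes "finite \<sigma>" "0 < t"
  shows "t \<le> mlcm \<sigma> v \<longleftrightarrow> (\<exists>m\<in>\<sigma>. t \<le> m v)"
  using assms by (auto simp: mlcm_def Max_ge_iff)

lemma mlcm_insert_eq_iff:
  assumes "finite \<sigma>" shows "mlcm (insert m \<sigma>) = mlcm \<sigma> \<longleftrightarrow> m \<le> mlcm \<sigma>"
proof
  assume "mlcm (insert m \<sigma>) = mlcm \<sigma>"
  with le_mlcm[of "insert m \<sigma>" m] assms show "m \<le> mlcm \<sigma>" by simp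
next
  assume "m \<le> mlcm \<sigma>"
  then have "mlcm (insert m \<sigma>) \<le> mlcm \<sigma>" using assms by (simp add: mlcm_le_iff le_mlcm)
  moreover have "mlcm \<sigma> \<le> mlcm (insert m \<sigma>)" using assms by (intro mlcm_mono) auto
  ultimately show "mlcm (insert m \<sigma>) = mlcm \<sigma>" by (rule order_antisym)
qed

lemma is_bridge_iff: "finite \<sigma> \<Longrightarrow> is_bridge m \<sigma> \<longleftrightarrow> m \<in> \<sigma> \<and> m \<le> mlcm (\<sigma> - {m})"
  unfolding is_bridge_def using mlcm_insert_eq_iff[of "\<sigma> - {m}" m]
  by (auto simp: insert_absorb eq_commute)

lemma is_gap_iff: "finite \<sigma> \<Longrightarrow> is_gap G m \<sigma> \<longleftrightarrow> m \<in> G \<and> m \<notin> \<sigma> \<and> m \<le> mlcm \<sigma>"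
  by (simp add: is_gap_def mlcm_insert_eq_iff)

locale blockend_cycle =
  fixes n :: nat and x :: "nat \<Rightarrow> 'v::finite" and E :: "('v \<times> 'v) set" and w :: "'v \<Rightarrow> nat"
  assumes cycle: "weighted_oriented_cycle n x E w" and blockend_n: "blockend n x E w n"
begin

abbreviation m :: "nat \<Rightarrow> 'v monomial" where "m \<equiv> cycle_gen n x E w"

abbreviation G :: "'v monomial set" where "G \<equiv> m ` {1..n}"

abbreviation non_blockend :: "nat \<Rightarrow> bool" where "non_blockend i \<equiv> \<not> blockend n x E w i"

lemma n3: "n \<ge> 3" and bij_x: "bij_betw x {1..n} UNIV" and w_pos: "w v > 0" and asym_E: "asym E"
  using cycle by (auto simp: weighted_oriented_cycle_def weighted_oriented_graph_def)

lemma x_eq_iff: "i \<in> {1..n} \<Longrightarrow> j \<in> {1..n} \<Longrightarrow> x i = x j \<longleftrightarrow> i = j"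
  by (rule inj_on_eq_iff[OF bij_betw_imp_inj_on[OF bij_x]])

lemma cnext_range: "i \<in> {1..n} \<Longrightarrow> cnext n i \<in> {1..n}"
  and cprev_range: "i \<in> {1..n} \<Longrightarrow> cprev n i \<in> {1..n}"
  using n3 by (auto simp: cnext_def cprev_def)

lemma m_pos_iff: "m i v > 0 \<longleftrightarrow> v = x i \<or> v = x (cnext n i)"
  using w_pos by (auto simp: cycle_gen_def Let_def edge_monomial_def)

lemma m_le_imp_eq:
  assumes i: "i \<in> {1..n}" and j: "j \<in> {1..n}" and le: "m i \<le> m j"
  shows "i = j"
proof -
  have "m j v > 0" if "m i v > 0" for v
    using le that by (metis le_fun_def less_le_trans)
  then have "x i = x j \<or> x i = x (cnext n j)" "x (cnext n i) = x j \<or> x (cnext n i) = x (cnext n j)"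
    using m_pos_iff by blast+
  then have "i = j \<or> i = cnext n j" "cnext n i = j \<or> cnext n i = cnext n j"
    using i j cnext_range x_eq_iff by auto
  then show ?thesis using i j n3 by (auto simp: cnext_def split: if_splits)
qed

lemma m_eq_iff: "i \<in> {1..n} \<Longrightarrow> j \<in> {1..n} \<Longrightarrow> m i = m j \<longleftrightarrow> i = j"
  using m_le_imp_eq by (metis order_refl)

lemma finite_subset_G: "\<sigma> \<subseteq> G \<Longrightarrow> finite \<sigma>"
  using finite_subset by blast

lemma edge_ideal_eq: "(edge_ideal E w :: ('v, 'k::field) polyring set) = ideal_gen (mono_poly ` G)"
proof -
  have sets: "{{u, v} | u v. (u, v) \<in> E} = {{x i, x (cnext n i)} | i. i \<in> {1..n}}"
    using cycle by (simp add: weighted_oriented_cycle_def)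
  have "{edge_monomial w u v | u v. (u, v) \<in> E} = G"
  proof (intro subset_antisym subsetI)
    fix a assume "a \<in> {edge_monomial w u v | u v. (u, v) \<in> E}"
    then obtain u v where uv: "(u, v) \<in> E" "a = edge_monomial w u v" by blast
    then have "{u, v} \<in> {{x i, x (cnext n i)} | i. i \<in> {1..n}}" using sets by blast
    then obtain i where i: "i \<in> {1..n}" "{u, v} = {x i, x (cnext n i)}" by blast
    have "(v, u) \<notin> E" using uv(1) asym_E by (auto dest: asymD)
    with i(2) uv have "a = m i"
      by (auto simp: cycle_gen_def Let_def doubleton_eq_iff)
    with i(1) show "a \<in> G" by blast
  next
    fix a assume "a \<in> G"
    then obtain i where i: "i \<in> {1..n}" "a = m i" by blast
    then have "{x i, x (cnext n i)} \<in> {{u, v} | u v. (u, v) \<in> E}" using sets by blast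
    then obtain u v where "(u, v) \<in> E" "{x i, x (cnext n i)} = {u, v}" by blast
    then have "(x i, x (cnext n i)) \<in> E \<or> (x (cnext n i), x i) \<in> E"
      by (auto simp: doubleton_eq_iff)
    with i(2) show "a \<in> {edge_monomial w u v | u v. (u, v) \<in> E}"
      by (auto simp: cycle_gen_def Let_def)
  qed
  moreover have "{mono_poly (edge_monomial w u v) | u v. (u, v) \<in> E}
      = (mono_poly ` {edge_monomial w u v | u v. (u, v) \<in> E} :: ('v, 'k) polyring set)"
    by blast
  ultimately show ?thesis by (simp add: edge_ideal_def)
qed

lemma min_gens_eq: "min_gens (edge_ideal E w :: ('v, 'k::field) polyring set) = G"
  unfolding edge_ideal_eq
proof (rule min_gens_antichain)
  fix a b assume "a \<in> G" "b \<in> G" and le: "a \<le> b"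
  then obtain i j where ij: "i \<in> {1..n}" "a = m i" "j \<in> {1..n}" "b = m j" by blast
  with m_le_imp_eq[OF ij(1,3)] le show "a = b" by simp
qed

text \<open>Only \<open>m\<^sub>i\<^sub>-\<^sub>1\<close> and \<open>m\<^sub>i\<close> involve \<open>x\<^sub>i\<close>, and only \<open>m\<^sub>i\<close> and \<open>m\<^sub>i\<^sub>+\<^sub>1\<close> involve \<open>x\<^sub>i\<^sub>+\<^sub>1\<close>, so both neighbours are needed to
  cover \<open>m\<^sub>i\<close>, and with both present nothing else matters.\<close>

lemma le_mlcm_other_iff:
  assumes \<sigma>: "\<sigma> \<subseteq> G" and i: "i \<in> {1..n}"
  shows "m i \<le> mlcm (\<sigma> - {m i}) \<longleftrightarrow> non_blockend i \<and> m (cprev n i) \<in> \<sigma> \<and> m (cnext n i) \<in> \<sigma>"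
proof
  have fin: "finite (\<sigma> - {m i})" using finite_subset_G[OF \<sigma>] by simp
  let ?p = "cprev n i" and ?s = "cnext n i"
  have ps: "?p \<in> {1..n}" "?s \<in> {1..n}" "?p \<noteq> i" "?s \<noteq> i" "cnext n ?p = i" 
    using i n3 by (auto simp: cnext_def cprev_def)
  {
    assume le: "m i \<le> mlcm (\<sigma> - {m i})"
    have ex: "\<exists>j\<in>{1..n}. m j \<in> \<sigma> \<and> j \<noteq> i \<and> m i v \<le> m j v \<and> (v = x j \<or> v = x (cnext n j))"
      if v: "v = x i \<or> v = x ?s" for v
    proof -
      have pos: "m i v > 0" using v m_pos_iff by blast
      moreover have "m i v \<le> mlcm (\<sigma> - {m i}) v" using le by (simp add: le_fun_def)
      ultimately obtain g where g: "g \<in> \<sigma> - {m i}" "m i v \<le> g v"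
        using le_mlcm_pointwise[OF fin] by blast
      with \<sigma> obtain j where "j \<in> {1..n}" "g = m j" by blast
      moreover have "m j v > 0" using g(2) pos \<open>g = m j\<close> by simp
      ultimately show ?thesis using g m_pos_iff by blast
    qed
    obtain j where j: "j \<in> {1..n}" "m j \<in> \<sigma>" "j \<noteq> i" "m i (x i) \<le> m j (x i)"
      "x i = x j \<or> x i = x (cnext n j)" using ex[of "x i"] by blast
    then have "cnext n j = i" using i cnext_range[OF j(1)] by (auto simp: x_eq_iff)
    then have jp: "j = ?p" using i j(1) by (auto simp: cnext_def cprev_def split: if_splits)
    obtain k where k: "k \<in> {1..n}" "m k \<in> \<sigma>" "k \<noteq> i" "m i (x ?s) \<le> m k (x ?s)"
      "x ?s = x k \<or> x ?s = x (cnext n k)" using ex[of "x ?s"] by blast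
    then have "?s = k \<or> ?s = cnext n k" using ps cnext_range[OF k(1)] by (auto simp: x_eq_iff)
    then have ks: "k = ?s" using i k(1,3) by (auto simp: cnext_def split: if_splits)
    have "m i v \<le> mlcm {m ?p, m ?s} v" for v
    proof (cases "m i v > 0")
      case True
      then have "m i v \<le> m ?p v \<or> m i v \<le> m ?s v"
        using m_pos_iff[of i v] j(4) k(4) jp ks by auto
      with True show ?thesis by (auto simp: le_mlcm_pointwise)
    qed simp
    then have "m i \<le> mlcm {m ?p, m ?s}" by (simp add: le_fun_def)
    with j k jp ks show "non_blockend i \<and> m ?p \<in> \<sigma> \<and> m ?s \<in> \<sigma>" by (simp add: blockend_def)
  }
  assume *: "non_blockend i \<and> m ?p \<in> \<sigma> \<and> m ?s \<in> \<sigma>"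
  then have "{m ?p, m ?s} \<subseteq> \<sigma> - {m i}" using ps i by (auto simp: m_eq_iff)
  from mlcm_mono[OF fin this] * show "m i \<le> mlcm (\<sigma> - {m i})"
    unfolding blockend_def using order_trans by blast
qed

text \<open>Position \<open>0\<close> is a second copy of position \<open>n\<close>; this turns the cyclic neighbours of the positions \<open>1, \<dots>, n - 1\<close> into
  ordinary predecessors and successors.\<close>

definition bit :: "'v monomial set \<Rightarrow> nat \<Rightarrow> bool" where
  "bit \<sigma> j \<longleftrightarrow> m (if j = 0 then n else j) \<in> \<sigma>"

lemma bit_iff: "0 < j \<Longrightarrow> bit \<sigma> j \<longleftrightarrow> m j \<in> \<sigma>"
  by (simp add: bit_def)

lemma neighbours_iff:
  assumes \<sigma>: "\<sigma> \<subseteq> G" and i: "i \<in> {1..n}"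
  shows "m i \<le> mlcm (\<sigma> - {m i}) \<longleftrightarrow> i < n \<and> non_blockend i \<and> bit \<sigma> (i - 1) \<and> bit \<sigma> (i + 1)"
proof (cases "i = n")
  case True
  then show ?thesis using blockend_n le_mlcm_other_iff[OF \<sigma> i] by blast
next
  case False
  then show ?thesis using i
    by (auto simp: le_mlcm_other_iff[OF \<sigma> i] bit_def cnext_def cprev_def)
qed

lemma bridge_iff:
  assumes \<sigma>: "\<sigma> \<subseteq> G" and i: "i \<in> {1..n}"
  shows "is_bridge (m i) \<sigma> \<longleftrightarrow> i < n \<and> non_blockend i \<and> bit \<sigma> (i - 1) \<and> bit \<sigma> i \<and> bit \<sigma> (i + 1)"
  using i by (auto simp: is_bridge_iff[OF finite_subset_G[OF \<sigma>]] neighbours_iff[OF assms] bit_iff)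

lemma gap_iff:
  assumes \<sigma>: "\<sigma> \<subseteq> G" and i: "i \<in> {1..n}"
  shows "is_gap G (m i) \<sigma> \<longleftrightarrow> i < n \<and> non_blockend i \<and> bit \<sigma> (i - 1) \<and> \<not> bit \<sigma> i \<and> bit \<sigma> (i + 1)"
proof -
  have "\<sigma> - {m i} = \<sigma>" if "\<not> bit \<sigma> i" using i that by (auto simp: bit_iff)
  moreover have "bit \<sigma> i \<longleftrightarrow> m i \<in> \<sigma>" using i by (simp add: bit_iff)
  ultimately show ?thesis
    using i neighbours_iff[OF assms] is_gap_iff[OF finite_subset_G[OF \<sigma>], of G "m i"] by auto
qed

lemma bridgeE:
  assumes \<sigma>: "\<sigma> \<subseteq> G" and b: "is_bridge b \<sigma>"
  obtains i where "i \<in> {1..<n}" "b = m i" "non_blockend i" "bit \<sigma> (i - 1)" "bit \<sigma> i" "bit \<sigma> (i + 1)"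
proof -
  have "b \<in> G" using b \<sigma> by (auto simp: is_bridge_def)
  then obtain i where i: "i \<in> {1..n}" "b = m i" by blast
  with b bridge_iff[OF \<sigma> i(1)] that show ?thesis by auto
qed

section \<open>The pivot of a set of generators\<close>

text \<open>The last condition keeps \<open>i + 1\<close> from becoming a bridge when \<open>m\<^sub>i\<close> is added.  None of the conditions refers to the
  bit at \<open>i\<close> itself.\<close>

definition swing :: "'v monomial set \<Rightarrow> nat \<Rightarrow> bool" where
  "swing \<sigma> i \<longleftrightarrow> i \<in> {1..<n} \<and> non_blockend i \<and> bit \<sigma> (i - 1) \<and> bit \<sigma> (i + 1) \<and>
     \<not> (i + 1 < n \<and> non_blockend (i + 1) \<and> bit \<sigma> (i + 2))"

definition pivot :: "'v monomial set \<Rightarrow> nat \<Rightarrow> bool" where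
  "pivot \<sigma> p \<longleftrightarrow> swing \<sigma> p \<and> (\<forall>j>p. \<not> swing \<sigma> j)"

lemma pivot_range: "pivot \<sigma> p \<Longrightarrow> p \<in> {1..<n}"
  by (simp add: pivot_def swing_def)

lemma pivot_unique: "pivot \<sigma> p \<Longrightarrow> pivot \<sigma> q \<Longrightarrow> p = q"
  unfolding pivot_def by (meson linorder_neqE_nat)

lemma swing_imp_pivot:
  assumes "swing \<sigma> i" obtains p where "pivot \<sigma> p" "i \<le> p"
proof -
  let ?S = "{j. swing \<sigma> j}"
  have fin: "finite ?S" by (rule finite_subset[of _ "{1..<n}"]) (auto simp: swing_def)
  with assms have "swing \<sigma> (Max ?S)" "i \<le> Max ?S" using Max_in[OF fin] by auto
  moreover have "\<not> swing \<sigma> j" if "j > Max ?S" for j using Max_ge[OF fin, of j] that by auto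
  ultimately show ?thesis using that by (auto simp: pivot_def)
qed

text \<open>The bridge of largest index swings, because a violation of the last condition would make its successor a bridge.\<close>

lemma bridge_imp_pivot:
  assumes \<sigma>: "\<sigma> \<subseteq> G" and b: "is_bridge (m i) \<sigma>" and i: "i \<in> {1..n}"
  obtains p where "pivot \<sigma> p" "i \<le> p"
proof -
  let ?S = "{j \<in> {1..n}. is_bridge (m j) \<sigma>}"
  have fin: "finite ?S" by simp
  define l where "l = Max ?S"
  have "l \<in> ?S" unfolding l_def by (rule Max_in[OF fin]) (use b i in blast)
  then have l: "l \<in> {1..n}" "is_bridge (m l) \<sigma>" "i \<le> l"
    using Max_ge[OF fin, of i] b i by (auto simp: l_def)
  have max: "\<not> is_bridge (m j) \<sigma>" if "j > l" "j \<in> {1..n}" for j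
  proof
    assume "is_bridge (m j) \<sigma>"
    then have "j \<le> l" unfolding l_def using that(2) by (intro Max_ge[OF fin]) blast
    with that(1) show False by simp
  qed
  have br: "l < n" "non_blockend l" "bit \<sigma> (l - 1)" "bit \<sigma> l" "bit \<sigma> (l + 1)"
    using bridge_iff[OF \<sigma> l(1)] l(2) by auto
  moreover have "\<not> (l + 1 < n \<and> non_blockend (l + 1) \<and> bit \<sigma> (l + 2))"
    using max[of "l + 1"] bridge_iff[OF \<sigma>, of "l + 1"] br by auto
  ultimately have "swing \<sigma> l" using l by (simp add: swing_def)
  with swing_imp_pivot that l(3) show ?thesis by (metis le_trans)
qed

lemma swing_bridge: "\<sigma> \<subseteq> G \<Longrightarrow> swing \<sigma> i \<Longrightarrow> m i \<in> \<sigma> \<Longrightarrow> is_bridge (m i) \<sigma>"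
  using bridge_iff[of \<sigma> i] by (auto simp: swing_def bit_iff)

text \<open>Flipping the bit at the pivot \<open>p\<close> could affect a larger position only at \<open>p + 1\<close>; but if \<open>p + 1\<close> swung after the flip,
  then \<open>p + 1\<close> would be no blockend and the bit at \<open>p + 2\<close> would be set, and \<open>p\<close> could not swing.\<close>

lemma pivot_toggle:
  assumes eq: "\<sigma> - {m p} = \<tau> - {m p}" and p: "pivot \<sigma> p"
  shows "pivot \<tau> p"
proof -
  have pr: "p \<in> {1..<n}" by (rule pivot_range[OF p])
  have bit: "bit \<tau> j \<longleftrightarrow> bit \<sigma> j" if "j \<le> n" "j \<noteq> p" for j
  proof -
    have "m (if j = 0 then n else j) \<noteq> m p" using that pr by (subst m_eq_iff) auto
    then show ?thesis using eq unfolding bit_def by blast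
  qed
  have sp: "swing \<sigma> p" and max: "\<And>j. j > p \<Longrightarrow> \<not> swing \<sigma> j" using p by (auto simp: pivot_def)
  have "swing \<tau> p" using sp bit[of "p - 1"] bit[of "p + 1"] bit[of "p + 2"] pr
    by (auto simp: swing_def)
  moreover have "\<not> swing \<tau> j" if j: "j > p" for j
  proof
    assume s: "swing \<tau> j"
    show False
    proof (cases "j = p + 1")
      case True
      with s sp bit[of "p + 2"] show False by (auto simp: swing_def)
    next
      case False
      then have "swing \<sigma> j"
        using s j bit[of "j - 1"] bit[of "j + 1"] bit[of "j + 2"] by (auto simp: swing_def)
      with max j show False by blast
    qed
  qed
  ultimately show ?thesis by (simp add: pivot_def)
qed

definition pivot_matching :: "('v monomial set \<times> 'v monomial set) set" where
  "pivot_matching = {(\<sigma>, \<sigma> - {m p}) | \<sigma> p. \<sigma> \<subseteq> G \<and> pivot \<sigma> p \<and> m p \<in> \<sigma>}"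

lemma pivot_in_G: "pivot \<sigma> p \<Longrightarrow> m p \<in> G"
  using pivot_range by fastforce

lemma pivot_edge:
  assumes "\<rho> \<subseteq> G" "pivot \<rho> p"
  shows "(insert (m p) \<rho>, \<rho> - {m p}) \<in> pivot_matching"
proof -
  have "pivot (insert (m p) \<rho>) p" by (rule pivot_toggle[OF _ assms(2)]) auto
  moreover have "\<rho> - {m p} = insert (m p) \<rho> - {m p}" by auto
  ultimately show ?thesis
    using assms pivot_in_G[OF assms(2)] unfolding pivot_matching_def by blast
qed

lemma pivot_edgeD:
  assumes "(\<sigma>, \<tau>) \<in> pivot_matching" "\<rho> = \<sigma> \<or> \<rho> = \<tau>"
  obtains p where "pivot \<rho> p" "\<sigma> = insert (m p) \<rho>" "\<tau> = \<rho> - {m p}" "\<rho> \<subseteq> G"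
proof -
  from assms(1) obtain p where p: "\<sigma> \<subseteq> G" "pivot \<sigma> p" "m p \<in> \<sigma>" "\<tau> = \<sigma> - {m p}"
    by (auto simp: pivot_matching_def)
  have "pivot \<tau> p" by (rule pivot_toggle[OF _ p(2)]) (use p in auto)
  moreover have "insert (m p) \<tau> = \<sigma>" "insert (m p) \<sigma> = \<sigma>" "\<tau> - {m p} = \<tau>" "\<tau> \<subseteq> G"
    using p by auto
  ultimately show ?thesis using that[of p] p assms(2) by auto
qed

lemma critical_pivot_iff: "critical G pivot_matching \<sigma> \<longleftrightarrow> \<sigma> \<subseteq> G \<and> (\<nexists>i. swing \<sigma> i)"
proof
  assume c: "critical G pivot_matching \<sigma>"
  then have \<sigma>: "\<sigma> \<subseteq> G" by (simp add: critical_def)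
  moreover have "\<not> swing \<sigma> i" for i
  proof
    assume "swing \<sigma> i"
    then obtain p where p: "pivot \<sigma> p" by (rule swing_imp_pivot)
    note e = pivot_edge[OF \<sigma> p]
    have "\<sigma> = insert (m p) \<sigma> \<or> \<sigma> = \<sigma> - {m p}" by auto
    with e c show False unfolding critical_def by (metis fst_conv snd_conv)
  qed
  ultimately show "\<sigma> \<subseteq> G \<and> (\<nexists>i. swing \<sigma> i)" by blast
next
  assume *: "\<sigma> \<subseteq> G \<and> (\<nexists>i. swing \<sigma> i)"
  show "critical G pivot_matching \<sigma>"
    unfolding critical_def
  proof (intro conjI ballI)
    fix e assume "e \<in> pivot_matching"
    then show "\<sigma> \<noteq> fst e" "\<sigma> \<noteq> snd e"
      using pivot_edgeD[of "fst e" "snd e" \<sigma>] * by (metis pivot_def prod.collapse)+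
  qed (use * in blast)
qed

lemma pivot_matching_matching:
  assumes "e \<in> pivot_matching" "e' \<in> pivot_matching" "{fst e, snd e} \<inter> {fst e', snd e'} \<noteq> {}"
  shows "e = e'"
proof -
  obtain \<sigma> \<tau> \<sigma>' \<tau>' where e: "e = (\<sigma>, \<tau>)" "e' = (\<sigma>', \<tau>')" by (cases e, cases e') auto
  with assms(3) obtain \<rho> where \<rho>: "\<rho> = \<sigma> \<or> \<rho> = \<tau>" "\<rho> = \<sigma>' \<or> \<rho> = \<tau>'" by auto
  obtain p where p: "pivot \<rho> p" "\<sigma> = insert (m p) \<rho>" "\<tau> = \<rho> - {m p}"
    using pivot_edgeD assms(1) e(1) \<rho>(1) by metis
  obtain q where q: "pivot \<rho> q" "\<sigma>' = insert (m q) \<rho>" "\<tau>' = \<rho> - {m q}"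
    using pivot_edgeD assms(2) e(2) \<rho>(2) by metis
  from pivot_unique[OF p(1) q(1)] p q e show ?thesis by simp
qed

lemma pivot_matching_facts:
  assumes "(\<sigma>, \<tau>) \<in> pivot_matching"
  obtains p where "\<sigma> \<subseteq> G" "pivot \<sigma> p" "pivot \<tau> p" "m p \<in> \<sigma>" "\<tau> = \<sigma> - {m p}" "is_bridge (m p) \<sigma>"
    "\<And>j. j \<in> {1..n} \<Longrightarrow> is_bridge (m j) \<sigma> \<Longrightarrow> j \<le> p"
proof -
  from assms obtain p where p: "\<sigma> \<subseteq> G" "pivot \<sigma> p" "m p \<in> \<sigma>" "\<tau> = \<sigma> - {m p}"
    by (auto simp: pivot_matching_def)
  moreover have "pivot \<tau> p" by (rule pivot_toggle[OF _ p(2)]) (use p in auto)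
  moreover have "is_bridge (m p) \<sigma>" using swing_bridge p by (auto simp: pivot_def)
  moreover have "j \<le> p" if "j \<in> {1..n}" "is_bridge (m j) \<sigma>" for j
    using bridge_imp_pivot[OF p(1) that(2,1)] pivot_unique[OF p(2)] by metis
  ultimately show ?thesis using that by blast
qed

end

context blockend_cycle
begin

section \<open>The pivot matching is a Batzies-Welker matching\<close>

lemma lcm_pivot_edge: "(\<sigma>, \<tau>) \<in> pivot_matching \<Longrightarrow> mlcm \<sigma> = mlcm \<tau>"
  using pivot_matching_facts[of \<sigma> \<tau>] by (metis is_bridge_def)

text \<open>The complement of the bit string, read as a binary number: the removal of \<open>m\<^sub>p\<close> outweighs the removal
  of any generator with a smaller index.\<close>

definition gap_weight :: "'v monomial set \<Rightarrow> nat" where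
  "gap_weight \<sigma> = (\<Sum>i\<in>{i \<in> {1..n}. m i \<notin> \<sigma>}. 2 ^ i)"

lemma gap_weight_remove:
  assumes "m p \<in> \<sigma>" "p \<in> {1..n}"
  shows "gap_weight (\<sigma> - {m p}) = gap_weight \<sigma> + 2 ^ p"
proof -
  have "{i \<in> {1..n}. m i \<notin> \<sigma> - {m p}} = insert p {i \<in> {1..n}. m i \<notin> \<sigma>}"
    using assms by (auto simp: m_eq_iff)
  then show ?thesis using assms by (simp add: gap_weight_def)
qed

text \<open>The lower ends of the matching edges, from which the reversed edge leads up.\<close>

definition upward :: "'v monomial set \<Rightarrow> bool" where
  "upward \<sigma> \<longleftrightarrow> (\<exists>p. pivot \<sigma> p \<and> m p \<notin> \<sigma>)"

text \<open>The lower end of the matching edge through \<open>\<sigma>\<close>, or \<open>\<sigma>\<close> itself if it is unmatched; at most one \<open>p\<close>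
  qualifies.\<close>

definition base :: "'v monomial set \<Rightarrow> 'v monomial set" where
  "base \<sigma> = \<sigma> - {m p | p. pivot \<sigma> p}"

lemma base_pivot: "pivot \<sigma> p \<Longrightarrow> base \<sigma> = \<sigma> - {m p}"
  using pivot_unique by (auto simp: base_def)

text \<open>The cardinality of the upper end of the matching edge through \<open>\<sigma>\<close>, or of \<open>\<sigma>\<close> itself if it is unmatched.\<close>

definition level :: "'v monomial set \<Rightarrow> nat" where
  "level \<sigma> = (if upward \<sigma> then card \<sigma> + 1 else card \<sigma>)"

text \<open>A quantity that decreases lexicographically along every edge of \<open>G\<^sup>A\<close>.  The lcm and the level never increase; while both are
  constant, a path alternates between adding the pivot and removing a bridge of smaller index, and the gap weight of
  the lower ends decreases.  The last component accounts for the upward steps, which change nothing else.\<close>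

definition potential :: "'v monomial set \<Rightarrow> nat \<times> nat \<times> nat \<times> nat" where
  "potential \<sigma> = ((\<Sum>v\<in>UNIV. mlcm \<sigma> v), level \<sigma>, gap_weight (base \<sigma>), if upward \<sigma> then 1 else 0)"

abbreviation descent :: "((nat \<times> nat \<times> nat \<times> nat) \<times> (nat \<times> nat \<times> nat \<times> nat)) set" where
  "descent \<equiv> less_than <*lex*> less_than <*lex*> less_than <*lex*> less_than"

lemma sum_lcm_less:
  assumes "a \<le> b" "a \<noteq> (b :: 'v monomial)"
  shows "(\<Sum>v\<in>UNIV. a v) < (\<Sum>v\<in>UNIV. b v)"
proof -
  obtain u where "a u \<noteq> b u" using assms(2) by auto
  with assms(1) have "a u < b u" by (simp add: le_fun_def order_less_le)
  with assms(1) show ?thesis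
    by (intro sum_strict_mono_ex1) (auto simp: le_fun_def)
qed

lemma potential_up:
  assumes "(\<sigma>, \<tau>) \<in> pivot_matching"
  shows "(potential \<sigma>, potential \<tau>) \<in> descent"
proof -
  obtain p where p: "\<sigma> \<subseteq> G" "pivot \<sigma> p" "pivot \<tau> p" "m p \<in> \<sigma>" "\<tau> = \<sigma> - {m p}"
    using pivot_matching_facts[OF assms] by metis
  have "m p \<notin> \<tau>" using p(5) by simp
  with p(3) have up: "upward \<tau>" unfolding upward_def by blast
  have down: "\<not> upward \<sigma>" unfolding upward_def using pivot_unique[OF p(2)] p(4) by blast
  have "card \<sigma> = card \<tau> + 1"
    using card_Suc_Diff1[OF finite_subset_G[OF p(1)] p(4)] p(5) by simp
  moreover have "base \<sigma> = base \<tau>" using base_pivot[OF p(2)] base_pivot[OF p(3)] p(5) by auto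
  ultimately show ?thesis
    using up down lcm_pivot_edge[OF assms] by (simp add: potential_def level_def)
qed

text \<open>If neither the lcm nor the level drops, the step leads from an upper end to a lower end of the matching; the removed
  generator is a bridge, hence has an index smaller than the pivot.\<close>

lemma potential_down:
  assumes edge: "(\<sigma>, \<tau>) \<in> subset_edges G" and not: "(\<sigma>, \<tau>) \<notin> pivot_matching"
  shows "(potential \<tau>, potential \<sigma>) \<in> descent"
proof -
  have \<sigma>: "\<sigma> \<subseteq> G" and sub: "\<tau> \<subseteq> \<sigma>" and card: "card \<sigma> = card \<tau> + 1"
    using edge by (auto simp: subset_edges_def)
  have fin: "finite \<sigma>" by (rule finite_subset_G[OF \<sigma>])
  have "card (\<sigma> - \<tau>) = 1" using sub card fin finite_subset[OF sub fin] by (simp add: card_Diff_subset)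
  then obtain g where g: "\<sigma> - \<tau> = {g}" by (auto simp: card_1_singleton_iff)
  then have "g \<in> G" using \<sigma> by blast
  then obtain q where q: "q \<in> {1..n}" "g = m q" by blast
  have \<tau>: "\<tau> = \<sigma> - {m q}" "m q \<in> \<sigma>" using g q sub by auto
  have le: "mlcm \<tau> \<le> mlcm \<sigma>" by (rule mlcm_mono[OF fin sub])
  show ?thesis
  proof (cases "mlcm \<tau> = mlcm \<sigma>")
    case False
    with sum_lcm_less[OF le] show ?thesis by (simp add: potential_def)
  next
    case True
    then have br: "is_bridge (m q) \<sigma>" using \<tau> by (simp add: is_bridge_def)
    obtain p where p: "pivot \<sigma> p" "q \<le> p" by (rule bridge_imp_pivot[OF \<sigma> br q(1)])
    have pr: "p \<in> {1..n}" using pivot_range[OF p(1)] by auto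
    show ?thesis
    proof (cases "upward \<tau> \<and> \<not> upward \<sigma>")
      case False
      then have "level \<tau> < level \<sigma>" using card by (auto simp: level_def)
      with True show ?thesis by (simp add: potential_def)
    next
      case up: True
      then have "level \<tau> = level \<sigma>" using card by (simp add: level_def)
      moreover have "m p \<in> \<sigma>" using up p(1) by (auto simp: upward_def)
      moreover have "base \<tau> = \<tau>"
        using up base_pivot by (auto simp: upward_def)
      moreover have "q \<noteq> p"
        using not \<tau> p(1) \<sigma> by (auto simp: pivot_matching_def)
      ultimately have "gap_weight (base \<tau>) < gap_weight (base \<sigma>)" "level \<tau> = level \<sigma>"
        using p(2) gap_weight_remove[OF _ pr] gap_weight_remove[OF \<tau>(2) q(1)]
        by (auto simp: base_pivot[OF p(1)] \<tau>(1))
      with True show ?thesis by (simp add: potential_def)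
    qed
  qed
qed

lemma pivot_matching_homogeneous_acyclic: "lcm_homogeneous_acyclic_matching G pivot_matching"
  unfolding lcm_homogeneous_acyclic_matching_def
proof (intro conjI ballI impI)
  show "pivot_matching \<subseteq> subset_edges G"
  proof
    fix e assume e: "e \<in> pivot_matching"
    obtain \<sigma> \<tau> where st: "e = (\<sigma>, \<tau>)" by (cases e)
    obtain p where "\<sigma> \<subseteq> G" "m p \<in> \<sigma>" "\<tau> = \<sigma> - {m p}"
      using pivot_matching_facts e st by metis
    then show "e \<in> subset_edges G"
      using card_Suc_Diff1[OF finite_subset_G[of \<sigma>], of "m p"] by (auto simp: st subset_edges_def)
  qed
  show "{fst e, snd e} \<inter> {fst e', snd e'} = {}"
    if "e \<in> pivot_matching" "e' \<in> pivot_matching" "e \<noteq> e'" for e e'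
    using pivot_matching_matching that by blast
  have "wf (inv_image descent potential)" by (intro wf_inv_image wf_lex_prod wf_less_than)
  then have "acyclic (inv_image descent potential)" by (rule wf_acyclic)
  moreover have "((subset_edges G - pivot_matching) \<union> pivot_matching\<inverse>)\<inverse> \<subseteq> inv_image descent potential"
    using potential_up potential_down by (auto simp del: in_lex_prod)
  ultimately show "acyclic ((subset_edges G - pivot_matching) \<union> pivot_matching\<inverse>)"
    using acyclic_subset acyclic_converse by blast
  show "case e of (\<sigma>, \<tau>) \<Rightarrow> mlcm \<sigma> = mlcm \<tau>" if "e \<in> pivot_matching" for e
    using that lcm_pivot_edge by (cases e) auto
qed

text \<open>Let \<open>i\<close> be the largest position where the sets differ.  The set without \<open>m\<^sub>i\<close> has a gap there that does not
  swing, so \<open>i + 1\<close> is no blockend and the bits \<open>i + 1, i + 2\<close> are set, in both sets by the choice of \<open>i\<close>.  Then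
  \<open>m\<^sub>i\<^sub>+\<^sub>1\<close> is a bridge of the set containing \<open>m\<^sub>i\<close>, which has no swinging position.\<close>

lemma critical_eq_of_lcm_eq:
  assumes \<sigma>: "\<sigma> \<subseteq> G" "\<And>i. \<not> swing \<sigma> i" and \<tau>: "\<tau> \<subseteq> G" "\<And>i. \<not> swing \<tau> i"
    and lcm: "mlcm \<sigma> = mlcm \<tau>"
  shows "\<sigma> = \<tau>"
proof (rule ccontr)
  assume ne: "\<sigma> \<noteq> \<tau>"
  let ?D = "{i \<in> {1..n}. m i \<in> \<sigma> \<longleftrightarrow> m i \<notin> \<tau>}"
  have fin: "finite ?D" by simp
  from ne obtain g where g: "g \<in> \<sigma> \<longleftrightarrow> g \<notin> \<tau>" by blast
  then have "g \<in> G" using \<sigma>(1) \<tau>(1) by blast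
  with g have "?D \<noteq> {}" by blast
  define i where "i = Max ?D"
  have "i \<in> ?D" unfolding i_def by (rule Max_in[OF fin \<open>?D \<noteq> {}\<close>])
  then have i: "i \<in> {1..n}" "m i \<in> \<sigma> \<longleftrightarrow> m i \<notin> \<tau>" by blast+
  have above: "m j \<in> \<sigma> \<longleftrightarrow> m j \<in> \<tau>" if "j > i" "j \<in> {1..n}" for j
  proof (rule ccontr)
    assume "\<not> (m j \<in> \<sigma> \<longleftrightarrow> m j \<in> \<tau>)"
    then have "j \<le> i" unfolding i_def using that(2) by (intro Max_ge[OF fin]) blast
    with that(1) show False by simp
  qed
  have contra: False
    if \<rho>: "\<rho> \<subseteq> G" "\<And>i. \<not> swing \<rho> i" and \<rho>': "\<rho>' \<subseteq> G" "\<And>i. \<not> swing \<rho>' i"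
      and lcm: "mlcm \<rho> = mlcm \<rho>'" and in_out: "m i \<in> \<rho>" "m i \<notin> \<rho>'"
      and above: "\<And>j. j > i \<Longrightarrow> j \<in> {1..n} \<Longrightarrow> m j \<in> \<rho> \<longleftrightarrow> m j \<in> \<rho>'" for \<rho> \<rho>'
  proof -
    have "m i \<le> mlcm \<rho>'" using le_mlcm[OF finite_subset_G[OF \<rho>(1)] in_out(1)] lcm by simp
    then have "is_gap G (m i) \<rho>'"
      using in_out(2) i(1) by (simp add: is_gap_iff[OF finite_subset_G[OF \<rho>'(1)]])
    then have gap: "i < n" "non_blockend i" "bit \<rho>' (i - 1)" "bit \<rho>' (i + 1)"
      using gap_iff[OF \<rho>'(1) i(1)] by auto
    with \<rho>'(2)[of i] i(1) have nx: "i + 1 < n" "non_blockend (i + 1)" "bit \<rho>' (i + 2)"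
      by (auto simp: swing_def)
    have "bit \<rho> (i + 1)" "bit \<rho> (i + 2)"
      using gap nx above[of "i + 1"] above[of "i + 2"] by (auto simp: bit_def)
    moreover have "bit \<rho> i" using in_out(1) i(1) by (auto simp: bit_def)
    ultimately have "is_bridge (m (i + 1)) \<rho>"
      using nx bridge_iff[OF \<rho>(1), of "i + 1"] by simp
    with bridge_imp_pivot[OF \<rho>(1) this] nx(1) \<rho>(2) show False by (auto simp: pivot_def)
  qed
  show False
  proof (cases "m i \<in> \<sigma>")
    case True
    with i contra[OF \<sigma> \<tau> lcm] above show False by blast
  next
    case False
    with i contra[OF \<tau> \<sigma> lcm[symmetric]] above show False by blast
  qed
qed

lemma BW_pivot_matching: "BW_matching G pivot_matching"
  unfolding BW_matching_def critical_pivot_iff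
  using pivot_matching_homogeneous_acyclic critical_eq_of_lcm_eq by blast

end

locale ordered_blockend_cycle = blockend_cycle +
  fixes gt :: "'a monomial \<Rightarrow> 'a monomial \<Rightarrow> bool"
  assumes total: "total_ordering_on G gt"
    and gt_Suc: "\<And>i. i \<in> {1..<n} \<Longrightarrow> gt (m i) (m (i + 1))"
begin

lemma gt_iff:
  assumes "i \<in> {1..n}" "j \<in> {1..n}" shows "gt (m i) (m j) \<longleftrightarrow> i < j"
proof -
  have irr: "\<not> gt a a" if "a \<in> G" for a
    using total that by (auto simp: total_ordering_on_def irreflp_on_def)
  have tr: "gt a c" if "gt a b" "gt b c" "a \<in> G" "b \<in> G" "c \<in> G" for a b c
    using total that unfolding total_ordering_on_def transp_on_def by blast
  have lt: "gt (m i) (m j)" if "i < j" "i \<in> {1..n}" "j \<in> {1..n}" for i j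
    using that
  proof (induction j)
    case (Suc j)
    show ?case
    proof (cases "i = j")
      case True
      with gt_Suc[of j] Suc.prems show ?thesis by auto
    next
      case False
      then have *: "gt (m i) (m j)" "gt (m j) (m (Suc j))" using Suc gt_Suc[of j] by auto
      show ?thesis by (rule tr[OF *]) (use Suc.prems False in auto)
    qed
  qed simp
  show ?thesis
  proof
    assume gt: "gt (m i) (m j)"
    show "i < j"
    proof (rule ccontr)
      assume "\<not> i < j"
      then consider "i = j" | "j < i" by linarith
      then show False
      proof cases
        case 1
        with gt irr[of "m i"] assms show False by simp
      next
        case 2
        with tr[OF gt lt[OF 2]] irr[of "m i"] assms show False by simp
      qed
    qed
  qed (use lt assms in blast)
qed

section \<open>Critical sets and true gaps\<close>

text \<open>Were \<open>i + 1\<close> to become a bridge by adding the true gap \<open>m\<^sub>i\<close>, it would be a bridge smaller than \<open>m\<^sub>i\<close> and so a bridge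
  already before, which requires \<open>m\<^sub>i\<close> to be present.\<close>

lemma true_gap_imp_swing:
  assumes \<sigma>: "\<sigma> \<subseteq> G" and tg: "is_true_gap G gt g \<sigma>"
  obtains i where "swing \<sigma> i"
proof -
  have "g \<in> G" using tg by (auto simp: is_true_gap_def is_gap_def)
  then obtain i where i: "i \<in> {1..n}" "g = m i" by blast
  have gap: "i < n" "non_blockend i" "bit \<sigma> (i - 1)" "\<not> bit \<sigma> i" "bit \<sigma> (i + 1)"
    using tg gap_iff[OF \<sigma> i(1)] by (auto simp: is_true_gap_def i(2))
  have "\<not> (i + 1 < n \<and> non_blockend (i + 1) \<and> bit \<sigma> (i + 2))"
  proof
    assume nx: "i + 1 < n \<and> non_blockend (i + 1) \<and> bit \<sigma> (i + 2)"
    have sub: "insert g \<sigma> \<subseteq> G" using \<sigma> \<open>g \<in> G\<close> by blast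
    have "bit (insert g \<sigma>) i" "bit (insert g \<sigma>) (i + 1)" "bit (insert g \<sigma>) (i + 2)"
      using gap nx i by (auto simp: bit_def)
    with nx have "is_bridge (m (i + 1)) (insert g \<sigma>)"
      using bridge_iff[OF sub, of "i + 1"] by simp
    moreover have "gt g (m (i + 1))" using i gap(1) gt_Suc by simp
    ultimately have "is_bridge (m (i + 1)) \<sigma>" using tg by (simp add: is_true_gap_def)
    with bridge_iff[OF \<sigma>, of "i + 1"] nx gap(4) show False by simp
  qed
  with gap i(1) have "swing \<sigma> i" by (simp add: swing_def)
  then show ?thesis by (rule that)
qed

text \<open>Adding \<open>m\<^sub>i\<close> changes the bridge property only at \<open>i - 1\<close>, \<open>i\<close> and \<open>i + 1\<close>.  The smaller
  generators with respect to \<open>>\<^sub>I\<close> are those of larger index, and \<open>i + 1\<close> is excluded because \<open>i\<close> swings.\<close>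

lemma swing_imp_bridge_or_true_gap:
  assumes \<sigma>: "\<sigma> \<subseteq> G" and s: "swing \<sigma> i"
  shows "is_bridge (m i) \<sigma> \<or> is_true_gap G gt (m i) \<sigma>"
proof (cases "m i \<in> \<sigma>")
  case True
  with swing_bridge[OF \<sigma> s] show ?thesis by blast
next
  case False
  have i: "i \<in> {1..<n}" "i \<in> {1..n}" using s by (auto simp: swing_def)
  have sub: "insert (m i) \<sigma> \<subseteq> G" using \<sigma> i by blast
  have "is_gap G (m i) \<sigma>" using gap_iff[OF \<sigma> i(2)] s False i by (auto simp: swing_def bit_iff)
  moreover have "is_bridge b \<sigma>" if b: "is_bridge b (insert (m i) \<sigma>)" and gt: "gt (m i) b" for b
  proof -
    obtain j where j: "j \<in> {1..<n}" "b = m j" "non_blockend j" "bit (insert (m i) \<sigma>) (j - 1)"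
      "bit (insert (m i) \<sigma>) j" "bit (insert (m i) \<sigma>) (j + 1)"
      using bridgeE[OF sub b] by metis
    have "i < j" using gt gt_iff[OF i(2), of j] j(1,2) by auto
    have same: "bit (insert (m i) \<sigma>) k \<longleftrightarrow> bit \<sigma> k" if "k \<in> {1..n}" "k \<noteq> i" for k
      using that i by (auto simp: bit_iff m_eq_iff)
    have "j \<noteq> i + 1"
      using s j same[of "i + 2"] by (auto simp: swing_def)
    then have "j - 1 \<in> {1..n}" "j - 1 \<noteq> i" using \<open>i < j\<close> i(1) j(1) by auto
    with \<open>i < j\<close> j same[of "j - 1"] same[of j] same[of "j + 1"]
    show ?thesis by (auto simp: bridge_iff[OF \<sigma>])
  qed
  ultimately show ?thesis by (simp add: is_true_gap_def)
qed

lemma critical_iff_no_bridge_no_true_gap: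
  "critical G pivot_matching \<sigma> \<longleftrightarrow>
    \<sigma> \<subseteq> G \<and> (\<nexists>b. is_bridge b \<sigma>) \<and> (\<nexists>g. is_true_gap G gt g \<sigma>)"
proof -
  have "(\<exists>i. swing \<sigma> i) \<longleftrightarrow> (\<exists>b. is_bridge b \<sigma>) \<or> (\<exists>g. is_true_gap G gt g \<sigma>)" if \<sigma>: "\<sigma> \<subseteq> G"
  proof
    assume "\<exists>i. swing \<sigma> i"
    then show "(\<exists>b. is_bridge b \<sigma>) \<or> (\<exists>g. is_true_gap G gt g \<sigma>)"
      using swing_imp_bridge_or_true_gap[OF \<sigma>] by blast
  next
    assume "(\<exists>b. is_bridge b \<sigma>) \<or> (\<exists>g. is_true_gap G gt g \<sigma>)"
    then show "\<exists>i. swing \<sigma> i"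
    proof
      assume "\<exists>b. is_bridge b \<sigma>"
      then obtain b where b: "is_bridge b \<sigma>" by blast
      obtain i where i: "i \<in> {1..<n}" "b = m i" using bridgeE[OF \<sigma> b] by metis
      have "i \<in> {1..n}" using i(1) by simp
      obtain p where "pivot \<sigma> p"
        using bridge_imp_pivot[OF \<sigma> b[unfolded i(2)] \<open>i \<in> {1..n}\<close>] by metis
      then show ?thesis by (auto simp: pivot_def)
    qed (use true_gap_imp_swing[OF \<sigma>] in metis)
  qed
  then show ?thesis unfolding critical_pivot_iff by blast
qed

section \<open>The Barile-Macchia algorithm computes the pivot matching\<close>

text \<open>A bridge at the pivot has the largest index among all bridges.\<close>

lemma sb_pivot:
  assumes \<sigma>: "\<sigma> \<subseteq> G" and p: "pivot \<sigma> p" "m p \<in> \<sigma>"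
  shows "sb gt \<sigma> = {m p}"
proof -
  have pr: "p \<in> {1..n}" using pivot_range[OF p(1)] by auto
  have br: "is_bridge (m p) \<sigma>" using swing_bridge[OF \<sigma>] p by (auto simp: pivot_def)
  have other: "gt b (m p) \<and> \<not> gt (m p) b" if b: "is_bridge b \<sigma>" "b \<noteq> m p" for b
  proof -
    obtain j where j: "j \<in> {1..<n}" "b = m j" using bridgeE[OF \<sigma> b(1)] by metis
    have jr: "j \<in> {1..n}" using j(1) by simp
    obtain q where "pivot \<sigma> q" "j \<le> q" by (rule bridge_imp_pivot[OF \<sigma> b(1)[unfolded j(2)] jr])
    with pivot_unique[OF p(1)] have "j \<le> p" by blast
    with b(2) j(2) have "j < p" by (cases "j = p") auto
    then show ?thesis using gt_iff jr pr j(2) by simp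
  qed
  show ?thesis using br other unfolding sb_def by blast
qed

text \<open>A set with a bridge whose pivot is absent is the target of the set with the pivot added.  The latter is larger and
  has been treated earlier, so the former is no longer available when its turn comes.  The
  last part of the invariant says how sets leave \<open>\<Omega>\<close>: by being picked, together with their target, or as
  targets.\<close>

lemma bm_reach_invariant:
  assumes "bm_reach G gt \<Omega> B"
  shows "B \<subseteq> pivot_matching \<and> \<Omega> \<subseteq> {\<sigma>. \<sigma> \<subseteq> G \<and> card \<sigma> \<ge> 3} \<and>
    (\<forall>\<sigma>. \<sigma> \<subseteq> G \<and> card \<sigma> \<ge> 3 \<and> \<sigma> \<notin> \<Omega> \<longrightarrow> \<sigma> - sb gt \<sigma> \<notin> \<Omega> \<or> \<sigma> \<in> snd ` B)"
  using assms
proof (induction rule: bm_reach.induct)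
  case start
  then show ?case by auto
next
  case (round \<Omega> B \<sigma>)
  then have B: "B \<subseteq> pivot_matching" and \<Omega>: "\<Omega> \<subseteq> {\<sigma>. \<sigma> \<subseteq> G \<and> card \<sigma> \<ge> 3}"
    and inv: "\<And>\<rho>. \<rho> \<subseteq> G \<Longrightarrow> card \<rho> \<ge> 3 \<Longrightarrow> \<rho> \<notin> \<Omega> \<Longrightarrow> \<rho> - sb gt \<rho> \<notin> \<Omega> \<or> \<rho> \<in> snd ` B"
    by blast+
  let ?B = "if sb gt \<sigma> \<noteq> {} then insert (\<sigma>, \<sigma> - sb gt \<sigma>) B else B"
  have \<sigma>: "\<sigma> \<subseteq> G" "card \<sigma> \<ge> 3" using round.hyps(2) \<Omega> by auto
  have new: "(\<sigma>, \<sigma> - sb gt \<sigma>) \<in> pivot_matching" if "sb gt \<sigma> \<noteq> {}"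
  proof -
    obtain b where b: "is_bridge b \<sigma>" using \<open>sb gt \<sigma> \<noteq> {}\<close> by (auto simp: sb_def)
    obtain i where i: "i \<in> {1..<n}" "b = m i" using bridgeE[OF \<sigma>(1) b] by metis
    have "i \<in> {1..n}" using i(1) by simp
    obtain p where p: "pivot \<sigma> p"
      using bridge_imp_pivot[OF \<sigma>(1) b[unfolded i(2)] \<open>i \<in> {1..n}\<close>] by metis
    \<comment> \<open>Otherwise \<open>\<sigma>\<close> with the pivot added would have been treated before and would have removed \<open>\<sigma>\<close>.\<close>
    have "m p \<in> \<sigma>"
    proof (rule ccontr)
      assume np: "m p \<notin> \<sigma>"
      let ?\<rho> = "insert (m p) \<sigma>"
      have \<rho>: "?\<rho> \<subseteq> G" using \<sigma>(1) pivot_in_G[OF p] by blast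
      have card: "card ?\<rho> = Suc (card \<sigma>)" using np finite_subset_G[OF \<sigma>(1)] by simp
      have piv: "pivot ?\<rho> p" by (rule pivot_toggle[OF _ p]) auto
      have eq: "?\<rho> - sb gt ?\<rho> = \<sigma>" using sb_pivot[OF \<rho> piv] np by auto
      have "?\<rho> \<notin> \<Omega>" using round.hyps(3) card by force
      moreover have "card ?\<rho> \<ge> 3" using card \<sigma>(2) by simp
      ultimately have "?\<rho> \<in> snd ` B" using inv[OF \<rho>] eq round.hyps(2) by metis
      then obtain \<rho>' where "(\<rho>', ?\<rho>) \<in> pivot_matching" using B by auto
      then obtain q where "pivot ?\<rho> q" "m q \<notin> ?\<rho>"
        using pivot_matching_facts by (metis Diff_iff singletonI)
      with pivot_unique[OF piv] show False by blast
    qed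
    with sb_pivot[OF \<sigma>(1) p] show ?thesis using \<sigma>(1) p by (auto simp: pivot_matching_def)
  qed
  have "\<rho> - sb gt \<rho> \<notin> \<Omega> - {\<sigma>, \<sigma> - sb gt \<sigma>} \<or> \<rho> \<in> snd ` ?B"
    if \<rho>: "\<rho> \<subseteq> G" "card \<rho> \<ge> 3" "\<rho> \<notin> \<Omega> - {\<sigma>, \<sigma> - sb gt \<sigma>}" for \<rho>
  proof (cases "\<rho> \<in> \<Omega>")
    case False
    with inv[OF \<rho>(1,2)] show ?thesis by (auto split: if_splits)
  next
    case True
    with \<rho>(3) consider "\<rho> = \<sigma>" | "\<rho> = \<sigma> - sb gt \<sigma>" "sb gt \<sigma> \<noteq> {}" by auto
    then show ?thesis by cases auto
  qed
  with B \<Omega> new show ?case by auto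
qed

text \<open>All edges lie in one matching, so step (3) has nothing to remove.\<close>

lemma potentially_type2_imp_type2:
  assumes "bm_reach G gt \<Omega> B" "potentially_type2 gt B \<sigma>"
  shows "type2 gt B \<sigma>"
proof -
  have B: "B \<subseteq> pivot_matching" using bm_reach_invariant[OF assms(1)] by blast
  have "\<sigma>' = \<sigma>" if "(\<sigma>', \<tau>) \<in> B" "(\<sigma>, \<tau>) \<in> B" for \<sigma>' \<tau>
    using pivot_matching_matching[of "(\<sigma>', \<tau>)" "(\<sigma>, \<tau>)"] B that by auto
  with assms(2) show ?thesis
    unfolding type2_def potentially_type2_def bm_prune_def by blast
qed

end

theorem theorem4p5:
  fixes n :: nat
    and x :: "nat \<Rightarrow> 'v::finite"
    and E :: "('v \<times> 'v) set"
    and w :: "'v \<Rightarrow> nat"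
    and I :: "('v, 'k::field) polyring set"
    and m :: "nat \<Rightarrow> 'v monomial"
    and gt :: "'v monomial \<Rightarrow> 'v monomial \<Rightarrow> bool"
  assumes "weighted_oriented_cycle n x E w"
    and "\<not> classic n x E w"
    and "blockend n x E w n"
    and "I = edge_ideal E w"
    and "\<And>i. m i = cycle_gen n x E w i"
    and "total_ordering_on (min_gens I) gt"
    and "\<And>i. i \<in> {1..<n} \<Longrightarrow> gt (m i) (m (i + 1))"
  shows "bridge_friendly I \<and> has_BW_matching I \<and>
    (\<forall>r a. betti I r a =
       (if \<exists>\<sigma> \<subseteq> min_gens I.
             (\<nexists>b. is_bridge b \<sigma>) \<and> (\<nexists>g. is_true_gap (min_gens I) gt g \<sigma>) \<and>
             card \<sigma> = r \<and> mlcm \<sigma> = a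
        then 1 else 0))"
proof -
  interpret C: blockend_cycle n x E w
    using assms(1,3) by unfold_locales
  have G: "min_gens I = C.G" unfolding assms(4) by (rule C.min_gens_eq)
  interpret C: ordered_blockend_cycle n x E w gt
    using assms(5-7) G by unfold_locales simp_all
  have I: "I = ideal_gen (mono_poly ` C.G)" unfolding assms(4) by (rule C.edge_ideal_eq)
  have "bridge_friendly I"
    unfolding bridge_friendly_def using assms(6) C.potentially_type2_imp_type2 G by metis
  moreover have "has_BW_matching I"
    unfolding has_BW_matching_def G using C.BW_pivot_matching by blast
  moreover have "betti I r a =
       (if \<exists>\<sigma> \<subseteq> min_gens I.
             (\<nexists>b. is_bridge b \<sigma>) \<and> (\<nexists>g. is_true_gap (min_gens I) gt g \<sigma>) \<and>
             card \<sigma> = r \<and> mlcm \<sigma> = a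
        then 1 else 0)" for r a
    unfolding G unfolding I betti_BW_matching_0_1[OF finite_imageI[OF finite_atLeastAtMost] C.BW_pivot_matching]
      C.critical_iff_no_bridge_no_true_gap
    by (simp only: conj_assoc)
  ultimately show ?thesis by blast
qed

end
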